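(* Let $G$ be an essentially principal étale groupoid whose unit space is a Cantor set. Suppose that $G$ is almost finite and minimal. Then any non-trivial subgroup of $[[G]]$ normalized by the commutator subgroup $D([[G]])$ contains $D([[G]])$. In particular, $D([[G]])$ is simple.
   Context: A Cantor set is a (non-empty) compact, metrizable, totally disconnected space with no isolated points. An étale groupoid is a second countable locally compact Hausdorff topological groupoid $G$ whose range map is a local homeomorphism. $G^{(0)}$ is the unit space, $s,r$ are the source and range maps, and $gh$ is defined when $s(g)=r(h)$. The $G$-orbit of $x\in G^{(0)}$ is $\{r(g)\mid g\in G,\ s(g)=x\}$; $G$ is minimal if every $G$-orbit is dense in $G^{(0)}$. $G$ is principal if $\{g\in G\mid r(g)=s(g)\}=G^{(0)}$, and essentially principal if the interior of $\{g\in G\mid r(g)=s(g)\}$ is $G^{(0)}$. A $G$-set is a subset $U\subset G$ such that $r|U$ and $s|U$ are injective; for an open $G$-set $U$, $\pi_U=r\circ(s|U)^{-1}:s(U)\to r(U)$ (a homeomorphism). When $G^{(0)}$ is compact, the topological full group $[[G]]$ is the group of all $\alpha\in\mathrm{Homeo}(G^{(0)})$ for which there is a compact open $G$-set $U$ with $\alpha=\pi_U$ (so $s(U)=r(U)=G^{(0)}$). $D(\Gamma)$ denotes the commutator subgroup of a group $\Gamma$. Let $G$ be an étale groupoid whose unit space is a Cantor set. An elementary subgroupoid of $G$ is a compact open principal subgroupoid $K\subset G$ with $K^{(0)}=G^{(0)}$. $G$ is almost finite if for any compact subset $C\subset G$ and any $\varepsilon>0$ there exists an elementary subgroupoid $K\subset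 G$ such that $\#(CKx\setminus Kx)/\#(Kx)<\varepsilon$ for all $x\in G^{(0)}$, where $Kx=\{g\in K\mid s(g)=x\}$, $CKx=\{cg\mid c\in C,\ g\in Kx,\ s(c)=r(g)\}$ and $\#$ denotes cardinality. *)

theory Defs
  imports "HOL-Analysis.Analysis" "HOL-Algebra.Bij" "HOL-Algebra.Generated_Groups" "HOL-Algebra.Group_Action"
begin

section \<open>Cantor sets and local homeomorphisms\<close>

definition totally_disconnected_space :: "'a topology \<Rightarrow> bool" where
  "totally_disconnected_space X \<longleftrightarrow> (\<forall>S. connectedin X S \<longrightarrow> (\<exists>x. S \<subseteq> {x}))"

definition cantor_set :: "'a topology \<Rightarrow> bool" where
  "cantor_set X \<longleftrightarrow>
     topspace X \<noteq> {} \<and> compact_space X \<and> metrizable_space X \<and>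
     totally_disconnected_space X \<and> (\<forall>x\<in>topspace X. \<not> openin X {x})"

definition local_homeomorphism_map :: "'a topology \<Rightarrow> 'b topology \<Rightarrow> ('a \<Rightarrow> 'b) \<Rightarrow> bool" where
  "local_homeomorphism_map X Y f \<longleftrightarrow>
     f \<in> topspace X \<rightarrow> topspace Y \<and>
     (\<forall>x\<in>topspace X. \<exists>U. openin X U \<and> x \<in> U \<and> openin Y (f ` U) \<and>
        homeomorphic_map (subtopology X U) (subtopology Y (f ` U)) f)"

text \<open>Functions are made extensional so that they are determined by their values on the space.\<close>

definition Homeo :: "'a topology \<Rightarrow> ('a \<Rightarrow> 'a) set" where
  "Homeo X = {f \<in> extensional (topspace X). homeomorphic_map X X f}"


section \<open>Groupoids\<close>

text \<open>
  The points of \<open>gtop G\<close> are the arrows; units are identified with identity arrows, so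
  \<open>gsrc\<close> and \<open>grng\<close> take values in the arrows. The product \<open>gmult G g h\<close> is meaningful
  only if \<open>gsrc G g = grng G h\<close>.
\<close>

record 'a top_groupoid =
  gtop :: "'a topology"
  gsrc :: "'a \<Rightarrow> 'a"
  grng :: "'a \<Rightarrow> 'a"
  gmult :: "'a \<Rightarrow> 'a \<Rightarrow> 'a"
  ginv :: "'a \<Rightarrow> 'a"

definition arrows :: "'a top_groupoid \<Rightarrow> 'a set" where
  "arrows G = topspace (gtop G)"

definition gunits :: "'a top_groupoid \<Rightarrow> 'a set" where
  "gunits G = gsrc G ` arrows G"

definition composable :: "'a top_groupoid \<Rightarrow> ('a \<times> 'a) set" where
  "composable G = {(g, h). g \<in> arrows G \<and> h \<in> arrows G \<and> gsrc G g = grng G h}"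

definition unit_space :: "'a top_groupoid \<Rightarrow> 'a topology" where
  "unit_space G = subtopology (gtop G) (gunits G)"

locale algebraic_groupoid =
  fixes G :: "'a top_groupoid"
  assumes src_closed: "g \<in> arrows G \<Longrightarrow> gsrc G g \<in> arrows G"
    and rng_closed: "g \<in> arrows G \<Longrightarrow> grng G g \<in> arrows G"
    and src_src: "g \<in> arrows G \<Longrightarrow> gsrc G (gsrc G g) = gsrc G g"
    and rng_src: "g \<in> arrows G \<Longrightarrow> grng G (gsrc G g) = gsrc G g"
    and src_rng: "g \<in> arrows G \<Longrightarrow> gsrc G (grng G g) = grng G g"
    and rng_rng: "g \<in> arrows G \<Longrightarrow> grng G (grng G g) = grng G g"
    and mult_closed: "(g, h) \<in> composable G \<Longrightarrow> gmult G g h \<in> arrows G"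
    and src_mult: "(g, h) \<in> composable G \<Longrightarrow> gsrc G (gmult G g h) = gsrc G h"
    and rng_mult: "(g, h) \<in> composable G \<Longrightarrow> grng G (gmult G g h) = grng G g"
    and mult_assoc: "(g, h) \<in> composable G \<Longrightarrow> (h, k) \<in> composable G \<Longrightarrow>
          gmult G (gmult G g h) k = gmult G g (gmult G h k)"
    and rng_left_unit: "g \<in> arrows G \<Longrightarrow> gmult G (grng G g) g = g"
    and src_right_unit: "g \<in> arrows G \<Longrightarrow> gmult G g (gsrc G g) = g"
    and inv_closed: "g \<in> arrows G \<Longrightarrow> ginv G g \<in> arrows G"
    and src_inv: "g \<in> arrows G \<Longrightarrow> gsrc G (ginv G g) = grng G g"
    and rng_inv: "g \<in> arrows G \<Longrightarrow> grng G (ginv G g) = gsrc G g"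
    and inv_left: "g \<in> arrows G \<Longrightarrow> gmult G (ginv G g) g = gsrc G g"
    and inv_right: "g \<in> arrows G \<Longrightarrow> gmult G g (ginv G g) = grng G g"

text \<open>
  Continuity of \<open>gsrc\<close> and \<open>grng\<close> follows, since \<open>gsrc G g = gmult G (ginv G g) g\<close> and
  \<open>grng G g = gmult G g (ginv G g)\<close>.
\<close>

locale topological_groupoid = algebraic_groupoid +
  assumes continuous_mult:
      "continuous_map (subtopology (prod_topology (gtop G) (gtop G)) (composable G)) (gtop G)
         (\<lambda>(g, h). gmult G g h)"
    and continuous_inv: "continuous_map (gtop G) (gtop G) (ginv G)"

locale etale_groupoid = topological_groupoid +
  assumes second_countable_gtop: "second_countable (gtop G)"
    and locally_compact_gtop: "locally_compact_space (gtop G)"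
    and Hausdorff_gtop: "Hausdorff_space (gtop G)"
    and local_homeomorphism_rng: "local_homeomorphism_map (gtop G) (unit_space G) (grng G)"

definition isotropy :: "'a top_groupoid \<Rightarrow> 'a set" where
  "isotropy G = {g \<in> arrows G. grng G g = gsrc G g}"

definition principal :: "'a top_groupoid \<Rightarrow> bool" where
  "principal G \<longleftrightarrow> isotropy G = gunits G"

definition essentially_principal :: "'a top_groupoid \<Rightarrow> bool" where
  "essentially_principal G \<longleftrightarrow> gtop G interior_of isotropy G = gunits G"

definition groupoid_orbit :: "'a top_groupoid \<Rightarrow> 'a \<Rightarrow> 'a set" where
  "groupoid_orbit G x = {grng G g |g. g \<in> arrows G \<and> gsrc G g = x}"

definition minimal_groupoid :: "'a top_groupoid \<Rightarrow> bool" where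
  "minimal_groupoid G \<longleftrightarrow>
     (\<forall>x\<in>gunits G. unit_space G closure_of groupoid_orbit G x = gunits G)"


section \<open>Almost finite groupoids\<close>

definition subgroupoid :: "'a set \<Rightarrow> 'a top_groupoid \<Rightarrow> bool" where
  "subgroupoid K G \<longleftrightarrow>
     K \<subseteq> arrows G \<and> (\<forall>g\<in>K. ginv G g \<in> K) \<and>
     (\<forall>g\<in>K. \<forall>h\<in>K. gsrc G g = grng G h \<longrightarrow> gmult G g h \<in> K)"

definition restrict_groupoid :: "'a top_groupoid \<Rightarrow> 'a set \<Rightarrow> 'a top_groupoid" where
  "restrict_groupoid G K = G\<lparr>gtop := subtopology (gtop G) K\<rparr>"

definition elementary_subgroupoid :: "'a set \<Rightarrow> 'a top_groupoid \<Rightarrow> bool" where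
  "elementary_subgroupoid K G \<longleftrightarrow>
     subgroupoid K G \<and> compactin (gtop G) K \<and> openin (gtop G) K \<and>
     principal (restrict_groupoid G K) \<and> gunits (restrict_groupoid G K) = gunits G"

definition src_fibre :: "'a top_groupoid \<Rightarrow> 'a set \<Rightarrow> 'a \<Rightarrow> 'a set" where
  "src_fibre G K x = {g \<in> K. gsrc G g = x}"

definition set_gmult :: "'a top_groupoid \<Rightarrow> 'a set \<Rightarrow> 'a set \<Rightarrow> 'a set" where
  "set_gmult G C A = {gmult G c g |c g. c \<in> C \<and> g \<in> A \<and> gsrc G c = grng G g}"

text \<open>
  In an etale groupoid a compact set meets every source fibre and every range fibre in a finite
  set, so both cardinalities below are those of finite sets, and \<open>src_fibre G K x\<close> contains \<open>x\<close>.
\<close>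

definition almost_finite :: "'a top_groupoid \<Rightarrow> bool" where
  "almost_finite G \<longleftrightarrow>
     (\<forall>C \<epsilon>. compactin (gtop G) C \<and> (\<epsilon>::real) > 0 \<longrightarrow>
        (\<exists>K. elementary_subgroupoid K G \<and>
           (\<forall>x\<in>gunits G.
              real (card (set_gmult G C (src_fibre G K x) - src_fibre G K x))
                / real (card (src_fibre G K x)) < \<epsilon>)))"


section \<open>The topological full group\<close>

definition G_set :: "'a top_groupoid \<Rightarrow> 'a set \<Rightarrow> bool" where
  "G_set G U \<longleftrightarrow> U \<subseteq> arrows G \<and> inj_on (grng G) U \<and> inj_on (gsrc G) U"

definition G_set_map :: "'a top_groupoid \<Rightarrow> 'a set \<Rightarrow> 'a \<Rightarrow> 'a" where
  "G_set_map G U = (\<lambda>x\<in>gsrc G ` U. grng G (the_inv_into U (gsrc G) x))"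

definition full_group_carrier :: "'a top_groupoid \<Rightarrow> ('a \<Rightarrow> 'a) set" where
  "full_group_carrier G =
     {\<alpha> \<in> Homeo (unit_space G).
        \<exists>U. G_set G U \<and> compactin (gtop G) U \<and> openin (gtop G) U \<and>
            gsrc G ` U = gunits G \<and> grng G ` U = gunits G \<and> \<alpha> = G_set_map G U}"

definition topological_full_group :: "'a top_groupoid \<Rightarrow> ('a \<Rightarrow> 'a) monoid" where
  "topological_full_group G = (BijGroup (gunits G))\<lparr>carrier := full_group_carrier G\<rparr>"


section \<open>Commutator subgroup and simplicity\<close>

definition commutator_subgroup :: "('a, 'b) monoid_scheme \<Rightarrow> 'a set" where
  "commutator_subgroup \<Gamma> = derived \<Gamma> (carrier \<Gamma>)"

text \<open>
  The locale \<open>simple_group\<close> requires \<open>order G > 1\<close>, where \<open>order\<close> is \<open>card\<close> of the carrier;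
  no infinite group satisfies it. The following definition has no finiteness restriction.
\<close>

definition is_simple :: "('a, 'b) monoid_scheme \<Rightarrow> bool" where
  "is_simple \<Gamma> \<longleftrightarrow>
     group \<Gamma> \<and> carrier \<Gamma> \<noteq> {\<one>\<^bsub>\<Gamma>\<^esub>} \<and>
     (\<forall>N. N \<lhd> \<Gamma> \<longrightarrow> N = {\<one>\<^bsub>\<Gamma>\<^esub>} \<or> N = carrier \<Gamma>)"

end

(*
  Every full group element is a locally constant choice of arrows, so it may be cut and glued along
  clopen sets.  A "tower" is a clopen set Y with finitely many disjoint copies f_1(Y), ..., f_n(Y)
  obtained by moving Y along compact open bisections; permuting the levels gives a homomorphism from
  Sym(n) to [[G]].  Let A be the subgroup generated by the 3-cycles of levels; it is normal in [[G]].

  (1) A nontrivial subgroup N normalized by D([[G]]) contains A: some tau in N moves a clopen U off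
  itself, so [a,b] lies in N for all a, b in D([[G]]) supported in U; by minimality every tower can,
  locally, be prolonged by five levels inside U, and a 3-cycle is conjugate under Alt(n+5) to a
  commutator of two 3-cycles of the new levels.

  (2) D([[G]]) is contained in A: given alpha and beta, an elementary subgroupoid K that is almost
  invariant under both cuts X into towers with at least 8 levels on which alpha and beta permute all
  but an eighth of the levels.  Modulo A both can be corrected by even permutations of levels so that
  their supports become small, and then one support can be moved off the other by a further even
  permutation.  Hence alpha and beta commute modulo A.

  Taking N = D([[G]]) in (1) gives D([[G]]) = A, and the theorem follows.
*)
theory Submission
  imports Defs "HOL-Algebra.Sym_Groups"
begin

text \<open>The argument runs in an abstract pseudogroup of partial homeomorphisms between clopen
  sets; arrows enter only when the groupoid is shown to be an instance. If a, b are supported in U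
  and tau moves U off itself, then d = tau a^-1 tau^-1 commutes with b, so [a,b] = [ad,b]; and ad =
  [a,tau] lies in N because a normalizes N. Five new levels serve twice: two 3-cycles sharing one
  point occupy five points, and Alt(m) is perfect for m \<ge> 5, so even permutations of the
  prolonged tower act by elements of D([[G]]), the only ones known to normalize N. In (2) the
  obstacle is that alpha induces only a partial injection of the levels, and a completion of it may
  be odd. An exceptional set of at least two levels absorbs both defects, hence the eight levels;
  enlarged from an eighth to a quarter, the exceptional sets of alpha and beta still fit side by
  side. Corrections over different towers multiply well only on disjoint invariant sets, so the
  gluing runs over clopen sets saturated for the K-orbits.\<close>

section \<open>Even permutations and a compactness principle\<close>

text \<open>The complements of \<open>J\<close> and of its image have equal size, so any bijection
  between them completes \<open>q\<close>. If the result is odd, a transposition of two points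
  outside \<open>J\<close> is applied first; it repairs the parity without touching the values on
  \<open>J\<close>.\<close>

lemma permutes_evenperm_extension:
  fixes q :: "'b \<Rightarrow> 'b"
  assumes S: "finite S" and J: "J \<subseteq> S" and q: "inj_on q J" "q ` J \<subseteq> S" and c: "card (S - J) \<ge> 2"
  obtains p where "p permutes S" "evenperm p" "\<And>j. j \<in> J \<Longrightarrow> p j = q j"
proof -
  have fin: "finite J" "finite (q ` J)" using S J finite_subset by auto
  have "card (S - J) = card (S - q ` J)"
    using q J S fin by (simp add: card_Diff_subset card_image)
  then obtain h where h: "bij_betw h (S - J) (S - q ` J)"
    using S by (meson finite_Diff finite_same_card_bij)
  define p where "p x = (if x \<in> J then q x else if x \<in> S then h x else x)" for x
  have "bij_betw p (J \<union> (S - J)) (q ` J \<union> (S - q ` J))"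
  proof (rule bij_betw_combine)
    show "bij_betw p J (q ` J)"
      using q by (auto simp: bij_betw_def inj_on_def p_def)
    have "bij_betw p (S - J) (S - q ` J) \<longleftrightarrow> bij_betw h (S - J) (S - q ` J)"
      by (rule bij_betw_cong) (simp add: p_def)
    with h show "bij_betw p (S - J) (S - q ` J)" by simp
  qed auto
  then have "bij_betw p S S" using J q(2) by (metis Un_Diff_cancel subset_Un_eq)
  moreover have "p x = x" if "x \<notin> S" for x using that J by (auto simp: p_def)
  ultimately have p: "p permutes S" by (simp add: bij_imp_permutes)
  have pq: "p j = q j" if "j \<in> J" for j using that by (simp add: p_def)
  show thesis
  proof (cases "evenperm p")
    case True
    then show thesis using that p pq by blast
  next
    case False
    obtain T where T: "T \<subseteq> S - J" "card T = 2" using c by (meson obtain_subset_with_card_n)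
    then obtain a b where ab: "T = {a, b}" "a \<noteq> b" by (meson card_2_iff)
    let ?p = "p \<circ> Transposition.transpose a b"
    have tr: "Transposition.transpose a b permutes S" using ab T by (intro permutes_swap_id) auto
    have "evenperm ?p"
      using False ab(2) p S
      by (subst evenperm_comp)
        (auto simp: permutation_permutes evenperm_swap intro: tr)
    moreover have "?p permutes S" using tr p by (rule permutes_compose)
    moreover have "?p j = q j" if "j \<in> J" for j
      using that pq ab T by (auto simp: Transposition.transpose_def)
    ultimately show thesis using that by blast
  qed
qed

lemma evenperm_three_cycle:
  assumes "distinct [a, b, c]"
  shows "evenperm (cycle_of_list [a, b, c])"
proof -
  have "swapidseq (Suc (Suc 0)) ((Transposition.transpose a b) \<circ> (Transposition.transpose b c \<circ> id))"
    using comp_Suc[OF comp_Suc[OF id], of b c a b] assms by simp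
  then show ?thesis by (simp add: evenperm_unique)
qed

text \<open>Two 3-cycles that share exactly one point have a 3-cycle as commutator: (n+1 n+2 n+4)
  and (n+1 n+3 n+5) give (n+1 n+2 n+3). The permutation \<open>p\<close> carries the support of
  \<open>c\<close> to these points; since n+2 points remain free, it can be chosen even.\<close>

lemma three_cycle_conjugate_commutator:
  fixes c :: "nat \<Rightarrow> nat"
  assumes c: "c \<in> three_cycles n"
  obtains p a b where "p permutes {1..n+5}" "evenperm p"
    "a permutes {n+1..n+5}" "evenperm a" "b permutes {n+1..n+5}" "evenperm b"
    "c = inv' p \<circ> (a \<circ> b \<circ> inv' a \<circ> inv' b) \<circ> p"
proof -
  obtain cs where cs: "c = cycle_of_list cs" "cycle cs" "length cs = 3" "set cs \<subseteq> {1..n}"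
    using c by auto
  obtain i j k where ijk: "cs = [i, j, k]" using stupid_lemma[OF cs(3)] by blast
  have dist: "i \<noteq> j" "j \<noteq> k" "i \<noteq> k" and le: "{i,j,k} \<subseteq> {1..n}" using cs ijk by auto
  define q where "q x = (if x = i then n+1 else if x = j then n+2 else n+3)" for x
  have "card ({1..n+5} - {i,j,k}) \<ge> 2"
    using le dist by (subst card_Diff_subset) auto
  then obtain p where p: "p permutes {1..n+5}" "evenperm p" "\<And>x. x \<in> {i,j,k} \<Longrightarrow> p x = q x"
    using permutes_evenperm_extension[of "{1..n+5}" "{i,j,k}" q] le dist
    by (auto simp: q_def inj_on_def)
  define a where "a = cycle_of_list [n+1, n+2, n+4]"
  define b where "b = cycle_of_list [n+1, n+3, n+5]"
  define c' where "c' = cycle_of_list [n+1, n+2, n+3]"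
  have bp: "bij p" using p(1) by (rule permutes_bij)
  have "p \<circ> c \<circ> inv' p = c'"
    using conjugation_of_cycle[OF cs(2) bp] p(3) dist by (simp add: cs(1) ijk c'_def q_def)
  then have c_eq: "c = inv' p \<circ> c' \<circ> p"
    using bp by (simp add: fun_eq_iff bij_is_inj flip: \<open>p \<circ> c \<circ> inv' p = c'\<close>)
  have "a permutes set [n+1, n+2, n+4]" "b permutes set [n+1, n+3, n+5]"
    unfolding a_def b_def by (rule cycle_permutes)+
  then have ab: "a permutes {n+1..n+5}" "b permutes {n+1..n+5}"
    by (auto elim!: permutes_subset)
  have ev: "evenperm a" "evenperm b"
    unfolding a_def b_def by (rule evenperm_three_cycle; simp)+
  have inv_ab: "inv' a = cycle_of_list [n+4, n+2, n+1]" "inv' b = cycle_of_list [n+5, n+3, n+1]"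
    unfolding a_def b_def
    by (rule inv_unique_comp; simp add: fun_eq_iff transpose_commute)+
  have "a \<circ> b \<circ> inv' a \<circ> inv' b = c'"
  proof
    fix x
    consider "x = n+1" | "x = n+2" | "x = n+3" | "x = n+4" | "x = n+5"
      | "x \<notin> {n+1, n+2, n+3, n+4, n+5}" by blast
    then show "(a \<circ> b \<circ> inv' a \<circ> inv' b) x = c' x"
      unfolding inv_ab unfolding a_def b_def c'_def
      by cases (simp_all add: Transposition.transpose_def)
  qed
  with c_eq p ab ev that show thesis by metis
qed

text \<open>A finite cover by good neighbourhoods is made disjoint by subtracting what is already
  covered, which is why goodness is required of every smaller member of \<open>\<B>\<close>. The
  family is a parameter because the principle is applied both to all clopen sets and to the clopen
  sets saturated for an equivalence relation.\<close>

lemma compact_space_clopen_induct: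
  assumes comp: "compact_space T"
    and \<B>: "\<And>A. A \<in> \<B> \<Longrightarrow> openin T A" "topspace T \<in> \<B>"
      "\<And>A B. A \<in> \<B> \<Longrightarrow> B \<in> \<B> \<Longrightarrow> A \<union> B \<in> \<B>" "\<And>A B. A \<in> \<B> \<Longrightarrow> B \<in> \<B> \<Longrightarrow> A - B \<in> \<B>"
    and loc: "\<And>x. x \<in> topspace T \<Longrightarrow> \<exists>Z\<in>\<B>. x \<in> Z \<and> (\<forall>W\<in>\<B>. W \<subseteq> Z \<longrightarrow> P W)"
    and empty: "P {}"
    and union: "\<And>A B. A \<in> \<B> \<Longrightarrow> B \<in> \<B> \<Longrightarrow> A \<inter> B = {} \<Longrightarrow> P A \<Longrightarrow> P B \<Longrightarrow> P (A \<union> B)"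
  shows "P (topspace T)"
proof -
  obtain Z where Z: "\<And>x. x \<in> topspace T \<Longrightarrow> Z x \<in> \<B> \<and> x \<in> Z x \<and> (\<forall>W\<in>\<B>. W \<subseteq> Z x \<longrightarrow> P W)"
    using loc by metis
  have sub: "Z x \<subseteq> topspace T" if "x \<in> topspace T" for x
    using Z \<B>(1) openin_subset that by metis
  obtain F where F: "finite F" "F \<subseteq> topspace T" "topspace T \<subseteq> \<Union> (Z ` F)"
  proof -
    have "\<exists>\<F>. finite \<F> \<and> \<F> \<subseteq> Z ` topspace T \<and> topspace T \<subseteq> \<Union>\<F>"
      using comp Z \<B>(1) unfolding compact_space_alt
      by (elim allE[of _ "Z ` topspace T"] impE) blast+
    then obtain \<F> where "finite \<F>" "\<F> \<subseteq> Z ` topspace T" "topspace T \<subseteq> \<Union>\<F>"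
      by blast
    then show thesis using that finite_subset_image[of \<F> Z "topspace T"] by blast
  qed
  have empty_mem: "{} \<in> \<B>" using \<B>(2) \<B>(4) by (metis Diff_cancel)
  have "\<Union> (Z ` F) \<in> \<B> \<and> P (\<Union> (Z ` F))"
    using F(1,2)
  proof (induction F rule: finite_induct)
    case empty
    then show ?case using empty_mem assms(7) by simp
  next
    case (insert x F)
    let ?U = "\<Union> (Z ` F)"
    have x: "Z x \<in> \<B>" "\<forall>W\<in>\<B>. W \<subseteq> Z x \<longrightarrow> P W" using Z insert by auto
    have IH: "?U \<in> \<B>" "P ?U" using insert by auto
    \<comment> \<open>The new piece is a member of \<open>\<B>\<close> inside \<open>Z x\<close>,
      hence good, and it is disjoint from the part treated so far.\<close>
    have "P (?U \<union> (Z x - ?U))"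
      using x IH \<B>(4) by (intro union) auto
    moreover have "?U \<union> (Z x - ?U) = \<Union> (Z ` insert x F)" by auto
    ultimately show ?case using \<B>(3)[OF IH(1) x(1)] by (auto simp: Un_commute)
  qed
  moreover have "\<Union> (Z ` F) = topspace T" using F sub by auto
  ultimately show ?thesis by simp
qed

section \<open>Ample pseudogroups and towers\<close>

definition clopenin :: "'a topology \<Rightarrow> 'a set \<Rightarrow> bool" where
  "clopenin T A \<longleftrightarrow> openin T A \<and> closedin T A"

text \<open>\<open>loc A f\<close> stands for a partial homeomorphism of the pseudogroup with clopen
  domain \<open>A\<close>; \<open>f\<close> is a total function of which only the values on
  \<open>A\<close> count, as \<open>loc_cong\<close> states. Continuity is present as
  \<open>loc_vimage_clopen\<close>, and \<open>loc_Un\<close> together with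
  \<open>loc_subset\<close> gives the cutting and gluing that makes the pseudogroup ample.\<close>

locale ample_pseudogroup =
  fixes T :: "'a topology" and loc :: "'a set \<Rightarrow> ('a \<Rightarrow> 'a) \<Rightarrow> bool"
  assumes compact_T: "compact_space T"
    and Hausdorff_T: "Hausdorff_space T"
    and clopen_base: "\<And>V x. openin T V \<Longrightarrow> x \<in> V \<Longrightarrow> \<exists>B. clopenin T B \<and> x \<in> B \<and> B \<subseteq> V"
    and loc_clopen: "\<And>A f. loc A f \<Longrightarrow> clopenin T A"
    and loc_inj_on: "\<And>A f. loc A f \<Longrightarrow> inj_on f A"
    and loc_image_clopen: "\<And>A f. loc A f \<Longrightarrow> clopenin T (f ` A)"
    and loc_vimage_clopen: "\<And>A f V. loc A f \<Longrightarrow> clopenin T V \<Longrightarrow> clopenin T {x\<in>A. f x \<in> V}"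
    and loc_cong: "\<And>A f g. loc A f \<Longrightarrow> (\<And>x. x \<in> A \<Longrightarrow> g x = f x) \<Longrightarrow> loc A g"
    and loc_subset: "\<And>A B f. loc A f \<Longrightarrow> clopenin T B \<Longrightarrow> B \<subseteq> A \<Longrightarrow> loc B f"
    and loc_comp: "\<And>A f g. loc A f \<Longrightarrow> loc (f ` A) g \<Longrightarrow> loc A (g \<circ> f)"
    and loc_inv_into: "\<And>A f. loc A f \<Longrightarrow> loc (f ` A) (inv_into A f)"
    and loc_Un: "\<And>A B f. loc A f \<Longrightarrow> loc B f \<Longrightarrow> A \<inter> B = {} \<Longrightarrow> inj_on f (A \<union> B) \<Longrightarrow> loc (A \<union> B) f"
    and loc_ident: "\<And>A. clopenin T A \<Longrightarrow> loc A (\<lambda>x. x)"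
begin

abbreviation clopen :: "'a set \<Rightarrow> bool" where "clopen \<equiv> clopenin T"

abbreviation X :: "'a set" where "X \<equiv> topspace T"

lemma clopen_subset: "clopen A \<Longrightarrow> A \<subseteq> X"
  by (simp add: clopenin_def openin_subset)

lemma clopen_empty: "clopen {}" and clopen_topspace: "clopen X"
  by (simp_all add: clopenin_def)

lemma clopen_Un: "clopen A \<Longrightarrow> clopen B \<Longrightarrow> clopen (A \<union> B)"
  and clopen_Int: "clopen A \<Longrightarrow> clopen B \<Longrightarrow> clopen (A \<inter> B)"
  and clopen_Diff: "clopen A \<Longrightarrow> clopen B \<Longrightarrow> clopen (A - B)"
  by (auto simp: clopenin_def openin_diff closedin_diff)

lemma clopen_UN: "finite I \<Longrightarrow> (\<And>i. i \<in> I \<Longrightarrow> clopen (A i)) \<Longrightarrow> clopen (\<Union>i\<in>I. A i)"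
  by (induction I rule: finite_induct) (auto intro: clopen_Un clopen_empty)

lemma clopen_INT:
  "finite I \<Longrightarrow> clopen B \<Longrightarrow> (\<And>i. i \<in> I \<Longrightarrow> clopen (A i)) \<Longrightarrow> clopen (B \<inter> (\<Inter>i\<in>I. A i))"
proof (induction I rule: finite_induct)
  case (insert i I)
  then have "clopen (A i)" "clopen (B \<inter> (\<Inter>i\<in>I. A i))" by simp_all
  then have "clopen (A i \<inter> (B \<inter> (\<Inter>i\<in>I. A i)))" by (rule clopen_Int)
  then show ?case by (simp add: Int_left_commute)
qed simp

lemma clopen_separate:
  assumes "x \<in> X" "y \<in> X" "x \<noteq> y"
  obtains P where "clopen P" "x \<in> P" "y \<notin> P"
proof -
  obtain U V where "openin T U" "openin T V" "x \<in> U" "y \<in> V" "disjnt U V"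
    using Hausdorff_T assms unfolding Hausdorff_space_def by metis
  then show thesis using clopen_base[of U x] that by (metis disjnt_iff subsetD)
qed

lemma loc_UN:
  assumes "finite I" "\<And>i. i \<in> I \<Longrightarrow> loc (A i) f"
    "\<And>i j. i \<in> I \<Longrightarrow> j \<in> I \<Longrightarrow> i \<noteq> j \<Longrightarrow> A i \<inter> A j = {}" "inj_on f (\<Union>i\<in>I. A i)"
  shows "loc (\<Union>i\<in>I. A i) f"
  using assms
proof (induction I rule: finite_induct)
  case empty
  then show ?case using loc_cong[OF loc_ident[OF clopen_empty]] by simp
next
  case (insert i I)
  have "loc (\<Union>i\<in>I. A i) f"
    using insert.prems by (intro insert.IH) (auto simp: inj_on_Un)
  then have "loc (A i \<union> (\<Union>i\<in>I. A i)) f"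
  proof (intro loc_Un)
    show "A i \<inter> (\<Union>j\<in>I. A j) = {}" using insert.prems(2)[of i] insert.hyps by blast
  qed (use insert.prems in auto)
  then show ?case by simp
qed


section \<open>The full group of an ample pseudogroup\<close>

definition full_carrier :: "('a \<Rightarrow> 'a) set" where
  "full_carrier = {\<gamma> \<in> extensional X. loc X \<gamma> \<and> \<gamma> ` X = X}"

definition full_group :: "('a \<Rightarrow> 'a) monoid" where
  "full_group = (BijGroup X)\<lparr>carrier := full_carrier\<rparr>"

lemma carrier_full_group: "carrier full_group = full_carrier"
  by (simp add: full_group_def)

lemma full_carrier_Bij: "\<gamma> \<in> full_carrier \<Longrightarrow> \<gamma> \<in> Bij X"
  by (simp add: full_carrier_def Bij_def bij_betw_def loc_inj_on)

lemma full_carrierD: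
  assumes "\<gamma> \<in> full_carrier"
  shows "loc X \<gamma>" "\<gamma> ` X = X" "inj_on \<gamma> X" "x \<in> X \<Longrightarrow> \<gamma> x \<in> X" "\<gamma> \<in> extensional X"
  using assms loc_inj_on by (auto simp: full_carrier_def)

lemma loc_ident_X: "loc X (\<lambda>x\<in>X. x)"
  using loc_cong[OF loc_ident[OF clopen_topspace]] by simp

lemma subgroup_full_carrier: "subgroup full_carrier (BijGroup X)"
proof (rule group.subgroupI[OF group_BijGroup])
  show "full_carrier \<subseteq> carrier (BijGroup X)"
    by (auto simp: BijGroup_def full_carrier_Bij)
  have "(\<lambda>x\<in>X. x) \<in> full_carrier" by (simp add: full_carrier_def loc_ident_X)
  then show "full_carrier \<noteq> {}" by blast
next
  fix \<gamma> assume \<gamma>: "\<gamma> \<in> full_carrier"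
  have "loc X (inv_into X \<gamma>)"
    using loc_inv_into[of X \<gamma>] full_carrierD[OF \<gamma>] by simp
  then have "loc X (\<lambda>x\<in>X. inv_into X \<gamma> x)" by (rule loc_cong) simp
  moreover have "inv_into X \<gamma> ` X = X"
    using full_carrier_Bij[OF \<gamma>] by (simp add: Bij_def bij_betw_inv_into bij_betw_imp_surj_on)
  ultimately have "(\<lambda>x\<in>X. inv_into X \<gamma> x) \<in> full_carrier" by (simp add: full_carrier_def)
  then show "inv\<^bsub>BijGroup X\<^esub> \<gamma> \<in> full_carrier"
    by (simp add: inv_BijGroup full_carrier_Bij \<gamma>)
next
  fix \<gamma> \<delta> assume \<gamma>: "\<gamma> \<in> full_carrier" and \<delta>: "\<delta> \<in> full_carrier"
  have "loc X (\<gamma> \<circ> \<delta>)"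
    by (intro loc_comp) (use full_carrierD[OF \<gamma>] full_carrierD[OF \<delta>] in auto)
  then have "loc X (compose X \<gamma> \<delta>)" by (rule loc_cong) (simp add: compose_def)
  moreover have "compose X \<gamma> \<delta> ` X = X"
    using full_carrierD[OF \<gamma>] full_carrierD[OF \<delta>] by (simp add: compose_def flip: image_image)
  ultimately have "compose X \<gamma> \<delta> \<in> full_carrier" by (simp add: full_carrier_def)
  then show "\<gamma> \<otimes>\<^bsub>BijGroup X\<^esub> \<delta> \<in> full_carrier"
    by (simp add: BijGroup_def full_carrier_Bij \<gamma> \<delta>)
qed

sublocale FG: group full_group
  unfolding full_group_def
  by (rule group.subgroup_imp_group[OF group_BijGroup subgroup_full_carrier])

lemma full_mult_apply:
  "\<gamma> \<in> full_carrier \<Longrightarrow> \<delta> \<in> full_carrier \<Longrightarrow> x \<in> X \<Longrightarrow> (\<gamma> \<otimes>\<^bsub>full_group\<^esub> \<delta>) x = \<gamma> (\<delta> x)"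
  by (simp add: full_group_def BijGroup_def full_carrier_Bij compose_def)

lemma full_one_apply: "x \<in> X \<Longrightarrow> \<one>\<^bsub>full_group\<^esub> x = x"
  by (simp add: full_group_def BijGroup_def)

lemma full_mult_closed:
  "\<gamma> \<in> full_carrier \<Longrightarrow> \<delta> \<in> full_carrier \<Longrightarrow> \<gamma> \<otimes>\<^bsub>full_group\<^esub> \<delta> \<in> full_carrier"
  and full_one_closed: "\<one>\<^bsub>full_group\<^esub> \<in> full_carrier"
  and full_inv_closed: "\<gamma> \<in> full_carrier \<Longrightarrow> inv\<^bsub>full_group\<^esub> \<gamma> \<in> full_carrier"
  using FG.m_closed FG.one_closed FG.inv_closed by (simp_all add: carrier_full_group)

lemma full_eqI:
  "\<gamma> \<in> full_carrier \<Longrightarrow> \<delta> \<in> full_carrier \<Longrightarrow> (\<And>x. x \<in> X \<Longrightarrow> \<gamma> x = \<delta> x) \<Longrightarrow> \<gamma> = \<delta>"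
  by (metis extensionalityI full_carrierD(5))

lemma full_inv_apply:
  assumes "\<gamma> \<in> full_carrier" "x \<in> X"
  shows "(inv\<^bsub>full_group\<^esub> \<gamma>) (\<gamma> x) = x" "\<gamma> ((inv\<^bsub>full_group\<^esub> \<gamma>) x) = x"
    "(inv\<^bsub>full_group\<^esub> \<gamma>) x \<in> X"
proof -
  note c = full_inv_closed[OF assms(1)]
  have "inv\<^bsub>full_group\<^esub> \<gamma> \<otimes>\<^bsub>full_group\<^esub> \<gamma> = \<one>\<^bsub>full_group\<^esub>"
    "\<gamma> \<otimes>\<^bsub>full_group\<^esub> inv\<^bsub>full_group\<^esub> \<gamma> = \<one>\<^bsub>full_group\<^esub>"
    using assms by (simp_all add: carrier_full_group)
  then show "(inv\<^bsub>full_group\<^esub> \<gamma>) (\<gamma> x) = x" "\<gamma> ((inv\<^bsub>full_group\<^esub> \<gamma>) x) = x"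
    using full_mult_apply[OF c assms(1,2)] full_mult_apply[OF assms(1) c assms(2)]
      full_one_apply[OF assms(2)] by simp_all
  show "(inv\<^bsub>full_group\<^esub> \<gamma>) x \<in> X" using c assms full_carrierD(4) by blast
qed


section \<open>Towers and the action of the symmetric group on their levels\<close>

definition tower :: "'a set \<Rightarrow> nat \<Rightarrow> (nat \<Rightarrow> 'a \<Rightarrow> 'a) \<Rightarrow> bool" where
  "tower Y n f \<longleftrightarrow> clopen Y \<and> (\<forall>j\<in>{1..n}. loc Y (f j)) \<and>
     (\<forall>i\<in>{1..n}. \<forall>j\<in>{1..n}. i \<noteq> j \<longrightarrow> f i ` Y \<inter> f j ` Y = {})"

definition levels :: "'a set \<Rightarrow> nat \<Rightarrow> (nat \<Rightarrow> 'a \<Rightarrow> 'a) \<Rightarrow> 'a set" where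
  "levels Y n f = (\<Union>j\<in>{1..n}. f j ` Y)"

text \<open>In a tower the pair of level \<open>j\<close> and base point \<open>y\<close> is
  determined by \<open>x\<close>, so \<open>SOME\<close> has a single candidate. Levels are numbered
  from 1 to match \<open>sym_group n\<close>, and the base \<open>Y\<close> itself need not be a
  level.\<close>

definition tower_act :: "'a set \<Rightarrow> nat \<Rightarrow> (nat \<Rightarrow> 'a \<Rightarrow> 'a) \<Rightarrow> (nat \<Rightarrow> nat) \<Rightarrow> 'a \<Rightarrow> 'a" where
  "tower_act Y n f \<sigma> = (\<lambda>x\<in>X. if x \<in> levels Y n f
     then SOME z. \<exists>j\<in>{1..n}. \<exists>y\<in>Y. x = f j y \<and> z = f (\<sigma> j) y else x)"

lemma tower_clopen: "tower Y n f \<Longrightarrow> clopen Y"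
  by (simp add: tower_def)

lemma tower_loc: "tower Y n f \<Longrightarrow> j \<in> {1..n} \<Longrightarrow> loc Y (f j)"
  by (simp add: tower_def)

lemma tower_level_clopen: "tower Y n f \<Longrightarrow> j \<in> {1..n} \<Longrightarrow> clopen (f j ` Y)"
  using tower_loc loc_image_clopen by blast

lemma levels_clopen: "tower Y n f \<Longrightarrow> clopen (levels Y n f)"
  unfolding levels_def by (intro clopen_UN) (auto intro: tower_level_clopen)

lemma tower_in_X: "tower Y n f \<Longrightarrow> j \<in> {1..n} \<Longrightarrow> y \<in> Y \<Longrightarrow> f j y \<in> X"
  using clopen_subset tower_level_clopen by blast

lemma tower_unique:
  assumes "tower Y n f" "i \<in> {1..n}" "j \<in> {1..n}" "y \<in> Y" "z \<in> Y" "f i y = f j z"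
  shows "i = j" "y = z"
proof -
  show "i = j"
    using assms unfolding tower_def by (metis disjoint_iff imageI)
  then show "y = z"
    using assms loc_inj_on[OF tower_loc] by (metis inj_onD)
qed

lemma tower_subset:
  assumes tw: "tower Y n f" and W: "clopen W" "W \<subseteq> Y"
  shows "tower W n f"
  unfolding tower_def
proof (intro conjI ballI impI)
  show "loc W (f j)" if "j \<in> {1..n}" for j
    by (rule loc_subset[OF tower_loc[OF tw that] W])
  fix i j assume "i \<in> {1..n}" "j \<in> {1..n}" "i \<noteq> j"
  then have "f i ` Y \<inter> f j ` Y = {}" using tw by (simp add: tower_def)
  then show "f i ` W \<inter> f j ` W = {}" using W by blast
qed (rule W)

lemma tower_act_level:
  assumes "tower Y n f" "j \<in> {1..n}" "y \<in> Y"
  shows "tower_act Y n f \<sigma> (f j y) = f (\<sigma> j) y"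
proof -
  have "(SOME z. \<exists>i\<in>{1..n}. \<exists>y'\<in>Y. f j y = f i y' \<and> z = f (\<sigma> i) y') = f (\<sigma> j) y"
  proof (rule some_equality)
    show "\<exists>i\<in>{1..n}. \<exists>y'\<in>Y. f j y = f i y' \<and> f (\<sigma> j) y = f (\<sigma> i) y'"
      using assms by blast
  qed (use assms tower_unique[OF assms(1)] in metis)
  then show ?thesis
    using assms tower_in_X[OF assms] by (auto simp: tower_act_def levels_def)
qed

lemma tower_act_outside: "x \<in> X \<Longrightarrow> x \<notin> levels Y n f \<Longrightarrow> tower_act Y n f \<sigma> x = x"
  by (simp add: tower_act_def)

lemma tower_act_in_X:
  assumes "tower Y n f" "\<sigma> permutes {1..n}" "x \<in> X"
  shows "tower_act Y n f \<sigma> x \<in> X"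
proof (cases "x \<in> levels Y n f")
  case True
  then obtain j y where "j \<in> {1..n}" "y \<in> Y" "x = f j y" by (auto simp: levels_def)
  then show ?thesis
    using tower_act_level[OF assms(1)] tower_in_X[OF assms(1)] permutes_in_image[OF assms(2)] by metis
qed (simp add: tower_act_outside assms)

lemma tower_act_comp:
  assumes "tower Y n f" "\<tau> permutes {1..n}" "x \<in> X"
  shows "tower_act Y n f \<sigma> (tower_act Y n f \<tau> x) = tower_act Y n f (\<sigma> \<circ> \<tau>) x"
proof (cases "x \<in> levels Y n f")
  case True
  then obtain j y where "j \<in> {1..n}" "y \<in> Y" "x = f j y" by (auto simp: levels_def)
  then show ?thesis
    using tower_act_level[OF assms(1)] permutes_in_image[OF assms(2)] by simp
qed (simp add: tower_act_outside assms)

lemma tower_act_id: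
  assumes "tower Y n f" "x \<in> X"
  shows "tower_act Y n f id x = x"
proof (cases "x \<in> levels Y n f")
  case True
  then show ?thesis using tower_act_level[OF assms(1)] by (auto simp: levels_def)
qed (simp add: tower_act_outside assms)

text \<open>On level \<open>j\<close> the map is the inverse of \<open>f j\<close> followed by
  \<open>f (\<sigma> j)\<close>, hence local. The levels and the fixed complement are finitely many
  disjoint clopen pieces, and global injectivity comes from the action of the inverse
  permutation.\<close>

lemma tower_act_full:
  assumes tw: "tower Y n f" and \<sigma>: "\<sigma> permutes {1..n}"
  shows "tower_act Y n f \<sigma> \<in> full_carrier"
proof -
  let ?a = "tower_act Y n f \<sigma>" and ?b = "tower_act Y n f (inv' \<sigma>)"
  have \<sigma>': "inv' \<sigma> permutes {1..n}" using \<sigma> by (rule permutes_inv)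
  have ba: "?b (?a x) = x" and ab: "?a (?b x) = x" if "x \<in> X" for x
    using tower_act_comp[OF tw] tower_act_id[OF tw] that \<sigma> \<sigma>' by (simp_all add: permutes_inv_o)
  have inj: "inj_on ?a X" by (metis ba inj_onI)
  have img: "?a ` X = X"
  proof
    show "?a ` X \<subseteq> X" using tower_act_in_X[OF tw \<sigma>] by blast
    show "X \<subseteq> ?a ` X" using ab tower_act_in_X[OF tw \<sigma>'] by (metis imageI subsetI)
  qed
  have lev: "loc (f j ` Y) ?a" if j: "j \<in> {1..n}" for j
  proof -
    have l: "loc (f j ` Y) (inv_into Y (f j))" using tw j tower_loc loc_inv_into by blast
    have i: "inj_on (f j) Y" using tw j tower_loc loc_inj_on by blast
    have sj: "\<sigma> j \<in> {1..n}" using j permutes_in_image[OF \<sigma>] by blast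
    have "loc (inv_into Y (f j) ` (f j ` Y)) (f (\<sigma> j))"
      using tower_loc[OF tw sj] i by simp
    from loc_comp[OF l this] show ?thesis
      by (rule loc_cong) (use tower_act_level[OF tw j] i in auto)
  qed
  have "loc (levels Y n f) ?a"
    unfolding levels_def
  proof (rule loc_UN)
    show "inj_on ?a (\<Union>j\<in>{1..n}. f j ` Y)"
      using inj clopen_subset[OF levels_clopen[OF tw]] by (auto simp: levels_def intro: inj_on_subset)
  qed (use lev tw in \<open>auto simp: tower_def\<close>)
  moreover have "loc (X - levels Y n f) ?a"
    by (rule loc_cong[OF loc_ident])
      (auto intro: clopen_Diff clopen_topspace levels_clopen tw simp: tower_act_outside)
  moreover have X: "levels Y n f \<union> (X - levels Y n f) = X"
    using clopen_subset[OF levels_clopen[OF tw]] by blast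
  ultimately have "loc X ?a"
    using loc_Un[of "levels Y n f" ?a "X - levels Y n f"] inj by auto
  then show ?thesis using img by (simp add: full_carrier_def tower_act_def)
qed

lemma tower_act_hom:
  assumes "tower Y n f"
  shows "group_hom (sym_group n) full_group (tower_act Y n f)"
proof (intro group_hom.intro group_hom_axioms.intro homI)
  show "group (sym_group n)" by (rule sym_group_is_group)
  show "group full_group" by (rule FG.is_group)
next
  fix \<sigma> assume "\<sigma> \<in> carrier (sym_group n)"
  then show "tower_act Y n f \<sigma> \<in> carrier full_group"
    using tower_act_full[OF assms] by (simp add: sym_group_carrier carrier_full_group)
next
  fix \<sigma> \<tau> assume st: "\<sigma> \<in> carrier (sym_group n)" "\<tau> \<in> carrier (sym_group n)"
  then have p: "\<sigma> permutes {1..n}" "\<tau> permutes {1..n}" by (simp_all add: sym_group_carrier)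
  show "tower_act Y n f (\<sigma> \<otimes>\<^bsub>sym_group n\<^esub> \<tau>) =
    tower_act Y n f \<sigma> \<otimes>\<^bsub>full_group\<^esub> tower_act Y n f \<tau>"
    unfolding sym_group_mult
  proof (rule full_eqI)
    show "tower_act Y n f (\<sigma> \<circ> \<tau>) \<in> full_carrier"
      using p by (intro tower_act_full[OF assms] permutes_compose)
    show "tower_act Y n f \<sigma> \<otimes>\<^bsub>full_group\<^esub> tower_act Y n f \<tau> \<in> full_carrier"
      using p by (intro full_mult_closed tower_act_full[OF assms])
  qed (use p in \<open>simp add: tower_act_full[OF assms] full_mult_apply tower_act_comp[OF assms]\<close>)
qed

lemma tower_act_inv:
  assumes "tower Y n f" "\<sigma> permutes {1..n}"
  shows "inv\<^bsub>full_group\<^esub> (tower_act Y n f \<sigma>) = tower_act Y n f (inv' \<sigma>)"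
  using group_hom.hom_inv[OF tower_act_hom[OF assms(1)], of \<sigma>] assms(2)
  by (simp add: sym_group_carrier)

lemma tower_conj:
  assumes tw: "tower Y n f" and \<gamma>: "\<gamma> \<in> full_carrier"
  shows "tower Y n (\<lambda>j. \<gamma> \<circ> f j)"
  unfolding tower_def
proof (intro conjI ballI impI)
  show "clopen Y" using tw tower_clopen by blast
  fix j assume j: "j \<in> {1..n}"
  have sub: "f i ` Y \<subseteq> X" if "i \<in> {1..n}" for i
    using that tw clopen_subset tower_level_clopen by blast
  show "loc Y (\<gamma> \<circ> f j)"
    by (intro loc_comp tower_loc[OF tw j] loc_subset[OF full_carrierD(1)[OF \<gamma>]]
        tower_level_clopen[OF tw j] sub j)
  fix i assume i: "i \<in> {1..n}" and "j \<noteq> i"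
  then have "f j ` Y \<inter> f i ` Y = {}" using tw j by (simp add: tower_def)
  then have "\<gamma> ` (f j ` Y) \<inter> \<gamma> ` (f i ` Y) = {}"
    using inj_on_image_Int[OF full_carrierD(3)[OF \<gamma>] sub[OF j] sub[OF i]] by simp
  then show "(\<gamma> \<circ> f j) ` Y \<inter> (\<gamma> \<circ> f i) ` Y = {}" by (simp add: image_comp)
qed

text \<open>Conjugation only replaces the levels by their images under \<open>\<gamma>\<close> and
  keeps the permutation. This is the source of the normality of
  \<open>alternating_full\<close>.\<close>

lemma tower_act_conj:
  assumes tw: "tower Y n f" and \<gamma>: "\<gamma> \<in> full_carrier" and \<sigma>: "\<sigma> permutes {1..n}"
  shows "\<gamma> \<otimes>\<^bsub>full_group\<^esub> tower_act Y n f \<sigma> \<otimes>\<^bsub>full_group\<^esub> inv\<^bsub>full_group\<^esub> \<gamma>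
    = tower_act Y n (\<lambda>j. \<gamma> \<circ> f j) \<sigma>"
proof (rule full_eqI)
  note tw' = tower_conj[OF tw \<gamma>]
  note cl = \<gamma> tower_act_full[OF tw \<sigma>] full_inv_closed[OF \<gamma>]
  show "\<gamma> \<otimes>\<^bsub>full_group\<^esub> tower_act Y n f \<sigma> \<otimes>\<^bsub>full_group\<^esub> inv\<^bsub>full_group\<^esub> \<gamma> \<in> full_carrier"
    using cl by (simp add: full_mult_closed)
  show "tower_act Y n (\<lambda>j. \<gamma> \<circ> f j) \<sigma> \<in> full_carrier" by (rule tower_act_full[OF tw' \<sigma>])
  fix x assume x: "x \<in> X"
  define x' where "x' = (inv\<^bsub>full_group\<^esub> \<gamma>) x"
  have x': "x' \<in> X" "\<gamma> x' = x" using full_inv_apply[OF \<gamma> x] by (simp_all add: x'_def)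
  have lhs: "(\<gamma> \<otimes>\<^bsub>full_group\<^esub> tower_act Y n f \<sigma> \<otimes>\<^bsub>full_group\<^esub> inv\<^bsub>full_group\<^esub> \<gamma>) x
      = \<gamma> (tower_act Y n f \<sigma> x')"
    using cl x x' by (simp add: full_mult_apply full_mult_closed x'_def)
  show "(\<gamma> \<otimes>\<^bsub>full_group\<^esub> tower_act Y n f \<sigma> \<otimes>\<^bsub>full_group\<^esub> inv\<^bsub>full_group\<^esub> \<gamma>) x
      = tower_act Y n (\<lambda>j. \<gamma> \<circ> f j) \<sigma> x"
  proof (cases "x' \<in> levels Y n f")
    case True
    then obtain j y where jy: "j \<in> {1..n}" "y \<in> Y" "x' = f j y" by (auto simp: levels_def)
    have "tower_act Y n (\<lambda>j. \<gamma> \<circ> f j) \<sigma> ((\<gamma> \<circ> f j) y) = (\<gamma> \<circ> f (\<sigma> j)) y"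
      by (rule tower_act_level[OF tw' jy(1,2)])
    then show ?thesis
      using lhs tower_act_level[OF tw jy(1,2)] jy x' by simp
  next
    case False
    have "x \<notin> levels Y n (\<lambda>j. \<gamma> \<circ> f j)"
    proof
      assume "x \<in> levels Y n (\<lambda>j. \<gamma> \<circ> f j)"
      then obtain j y where jy: "j \<in> {1..n}" "y \<in> Y" "x = \<gamma> (f j y)" by (auto simp: levels_def)
      then have "x' = f j y"
        using x' tower_in_X[OF tw jy(1,2)] full_carrierD(3)[OF \<gamma>] by (metis inj_onD)
      with jy False show False by (auto simp: levels_def)
    qed
    then show ?thesis using lhs False x x' by (simp add: tower_act_outside)
  qed
qed

text \<open>The permutation fixes every index above \<open>n\<close>, so added levels change
  nothing. This lets a 3-cycle of a short tower be computed inside a larger alternating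
  group.\<close>

lemma tower_act_extend:
  assumes tw: "tower Y n f" and tw': "tower Y m g" and nm: "n \<le> m" and \<sigma>: "\<sigma> permutes {1..n}"
    and agree: "\<And>j. j \<in> {1..n} \<Longrightarrow> g j = f j"
  shows "tower_act Y m g \<sigma> = tower_act Y n f \<sigma>"
proof (rule full_eqI)
  have \<sigma>': "\<sigma> permutes {1..m}" using \<sigma> nm by (auto intro: permutes_subset)
  show "tower_act Y m g \<sigma> \<in> full_carrier" "tower_act Y n f \<sigma> \<in> full_carrier"
    using tower_act_full tw tw' \<sigma> \<sigma>' by auto
  fix x assume x: "x \<in> X"
  show "tower_act Y m g \<sigma> x = tower_act Y n f \<sigma> x"
  proof (cases "x \<in> levels Y m g")
    case True
    then obtain j y where jy: "j \<in> {1..m}" "y \<in> Y" "x = g j y" by (auto simp: levels_def)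
    have g: "tower_act Y m g \<sigma> x = g (\<sigma> j) y" using tower_act_level[OF tw' jy(1,2)] jy by simp
    show ?thesis
    proof (cases "j \<in> {1..n}")
      case True
      then have "\<sigma> j \<in> {1..n}" using permutes_in_image[OF \<sigma>] by blast
      then show ?thesis using g agree True tower_act_level[OF tw True jy(2)] jy by simp
    next
      case False
      then have "\<sigma> j = j" using \<sigma> by (simp add: permutes_def)
      moreover have "x \<notin> levels Y n f"
      proof
        assume "x \<in> levels Y n f"
        then obtain i z where "i \<in> {1..n}" "z \<in> Y" "x = f i z" by (auto simp: levels_def)
        then show False
          using agree tower_unique[OF tw', of i j z y] jy False nm by auto
      qed
      ultimately show ?thesis using g jy x by (simp add: tower_act_outside)
    qed
  next
    case False
    moreover have "levels Y n f \<subseteq> levels Y m g"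
      unfolding levels_def by (rule UN_mono) (use agree nm in auto)
    ultimately have "x \<notin> levels Y n f" by blast
    then show ?thesis using False x by (simp add: tower_act_outside)
  qed
qed

text \<open>The levels over \<open>A\<close> and over \<open>B\<close> are disjoint, so the two
  factors move different points. This is the union clause for the compactness principle.\<close>

lemma tower_act_Un:
  assumes tw: "tower Y n f" and AB: "clopen A" "clopen B" "A \<inter> B = {}" "A \<union> B = Y"
    and \<sigma>: "\<sigma> permutes {1..n}"
  shows "tower_act Y n f \<sigma> = tower_act A n f \<sigma> \<otimes>\<^bsub>full_group\<^esub> tower_act B n f \<sigma>"
proof (rule full_eqI)
  have twA: "tower A n f" and twB: "tower B n f"
    using tower_subset[OF tw] AB by auto
  note cl = tower_act_full[OF twA \<sigma>] tower_act_full[OF twB \<sigma>]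
  show "tower_act Y n f \<sigma> \<in> full_carrier" by (rule tower_act_full[OF tw \<sigma>])
  show "tower_act A n f \<sigma> \<otimes>\<^bsub>full_group\<^esub> tower_act B n f \<sigma> \<in> full_carrier"
    using cl by (rule full_mult_closed)
  fix x assume x: "x \<in> X"
  have disjoint_levels: "f j y \<notin> levels C n f" if "C \<subseteq> Y" "j \<in> {1..n}" "y \<in> Y - C" for C j y
  proof
    assume "f j y \<in> levels C n f"
    then obtain i z where "i \<in> {1..n}" "z \<in> C" "f j y = f i z" by (auto simp: levels_def)
    then show False using tower_unique(2)[OF tw that(2), of i y z] that by auto
  qed
  have nA: "f j y \<notin> levels A n f" if "j \<in> {1..n}" "y \<in> B" for j y
    by (rule disjoint_levels) (use that AB in auto)
  have nB: "f j y \<notin> levels B n f" if "j \<in> {1..n}" "y \<in> A" for j y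
    by (rule disjoint_levels) (use that AB in auto)
  have "tower_act Y n f \<sigma> x = tower_act A n f \<sigma> (tower_act B n f \<sigma> x)"
  proof (cases "x \<in> levels Y n f")
    case True
    then obtain j y where jy: "j \<in> {1..n}" "y \<in> Y" "x = f j y" by (auto simp: levels_def)
    have sj: "\<sigma> j \<in> {1..n}" using jy permutes_in_image[OF \<sigma>] by blast
    consider "y \<in> A" | "y \<in> B" using jy AB by auto
    then show ?thesis
    proof cases
      case 1
      then show ?thesis
        using jy x nB tower_act_level[OF tw jy(1,2)] tower_act_level[OF twA jy(1)]
        by (simp add: tower_act_outside)
    next
      case 2
      then show ?thesis
        using jy x nA[OF sj 2] tower_act_level[OF tw jy(1,2)] tower_act_level[OF twB jy(1)]
          tower_in_X[OF twB sj]
        by (simp add: tower_act_outside)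
    qed
  next
    case False
    then have "x \<notin> levels A n f" "x \<notin> levels B n f" using AB by (auto simp: levels_def)
    then show ?thesis using False x by (simp add: tower_act_outside)
  qed
  then show "tower_act Y n f \<sigma> x = (tower_act A n f \<sigma> \<otimes>\<^bsub>full_group\<^esub> tower_act B n f \<sigma>) x"
    using cl x by (simp add: full_mult_apply)
qed

end

section \<open>The alternating full group\<close>

context ample_pseudogroup
begin

text \<open>The alternating full group in the sense of Nekrashevych. Taking only 3-cycles as
  generators keeps inclusions in other subgroups easy to test; all even permutations of levels are
  recovered in \<open>tower_act_even\<close>.\<close>

definition alternating_full :: "('a \<Rightarrow> 'a) set" where
  "alternating_full = generate full_group
     {tower_act Y n f c | Y n f c. tower Y n f \<and> c \<in> three_cycles n}"

lemma three_cycle_permutes: "c \<in> three_cycles n \<Longrightarrow> c permutes {1..n}"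
  using three_cycles_incl alt_group_carrier by blast

lemma alternating_generators_closed:
  "{tower_act Y n f c | Y n f c. tower Y n f \<and> c \<in> three_cycles n} \<subseteq> carrier full_group"
  by (auto simp: carrier_full_group intro!: tower_act_full three_cycle_permutes)

lemma alternating_full_normal: "alternating_full \<lhd> full_group"
  unfolding alternating_full_def
proof (rule FG.normal_generateI[OF alternating_generators_closed])
  fix h \<gamma> assume "h \<in> {tower_act Y n f c | Y n f c. tower Y n f \<and> c \<in> three_cycles n}"
    and \<gamma>: "\<gamma> \<in> carrier full_group"
  then obtain Y n f c where h: "h = tower_act Y n f c" "tower Y n f" "c \<in> three_cycles n" by blast
  have \<gamma>': "\<gamma> \<in> full_carrier" using \<gamma> by (simp add: carrier_full_group)
  have "\<gamma> \<otimes>\<^bsub>full_group\<^esub> h \<otimes>\<^bsub>full_group\<^esub> inv\<^bsub>full_group\<^esub> \<gamma> = tower_act Y n (\<lambda>j. \<gamma> \<circ> f j) c"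
    unfolding h(1) by (rule tower_act_conj[OF h(2) \<gamma>' three_cycle_permutes[OF h(3)]])
  then show "\<gamma> \<otimes>\<^bsub>full_group\<^esub> h \<otimes>\<^bsub>full_group\<^esub> inv\<^bsub>full_group\<^esub> \<gamma>
      \<in> {tower_act Y n f c | Y n f c. tower Y n f \<and> c \<in> three_cycles n}"
    using tower_conj[OF h(2) \<gamma>'] h(3) by blast
qed

lemma alternating_full_subgroup: "subgroup alternating_full full_group"
  using alternating_full_normal by (rule normal_imp_subgroup)

lemma alternating_full_carrier: "\<gamma> \<in> alternating_full \<Longrightarrow> \<gamma> \<in> full_carrier"
  using subgroup.subset[OF alternating_full_subgroup] by (auto simp: carrier_full_group)

lemma alternating_full_leI:
  assumes "subgroup H full_group"
    and "\<And>Y n f c. tower Y n f \<Longrightarrow> c \<in> three_cycles n \<Longrightarrow> tower_act Y n f c \<in> H"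
  shows "alternating_full \<subseteq> H"
  unfolding alternating_full_def using assms by (intro FG.generate_subgroup_incl) blast+

text \<open>Transported from the symmetric group, where the 3-cycles generate Alt(n).\<close>

lemma tower_act_even:
  assumes tw: "tower Y n f" and \<sigma>: "\<sigma> permutes {1..n}" "evenperm \<sigma>"
  shows "tower_act Y n f \<sigma> \<in> alternating_full"
proof -
  interpret h: group_hom "sym_group n" full_group "tower_act Y n f" by (rule tower_act_hom[OF tw])
  have "\<sigma> \<in> generate (alt_group n) (three_cycles n)"
    using \<sigma> alt_group_carrier alt_group_carrier_as_three_cycles by metis
  also have "\<dots> = generate (sym_group n) (three_cycles n)"
    using group.generate_consistent[OF sym_group_is_group three_cycles_incl alt_group_is_subgroup]
    by (simp add: alt_group_def)
  finally have "\<sigma> \<in> generate (sym_group n) (three_cycles n)" .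
  moreover have "three_cycles n \<subseteq> carrier (sym_group n)"
    using three_cycle_permutes sym_group_carrier by blast
  ultimately have "tower_act Y n f \<sigma> \<in> generate full_group (tower_act Y n f ` three_cycles n)"
    using h.generate_img by blast
  also have "\<dots> \<subseteq> alternating_full"
    unfolding alternating_full_def using tw by (intro FG.mono_generate) blast
  finally show ?thesis .
qed

text \<open>Alt(n) is perfect for n \<ge> 5, so \<open>\<sigma>\<close> is already a product of
  commutators before it is mapped to the full group.\<close>

lemma tower_act_even_derived:
  assumes tw: "tower Y n f" and n: "5 \<le> n" and \<sigma>: "\<sigma> permutes {1..n}" "evenperm \<sigma>"
  shows "tower_act Y n f \<sigma> \<in> derived full_group (carrier full_group)"
proof -
  interpret h: group_hom "sym_group n" full_group "tower_act Y n f" by (rule tower_act_hom[OF tw])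
  let ?A = "carrier (alt_group n)"
  have A: "?A \<subseteq> carrier (sym_group n)"
    using alt_group_is_subgroup subgroup.subset by blast
  have "\<sigma> \<in> ?A" using \<sigma> alt_group_carrier by blast
  also have "?A = derived (alt_group n) ?A" by (simp add: derived_alt_group_const[OF n])
  also have "\<dots> = derived (sym_group n) ?A"
    using group.derived_consistent[OF sym_group_is_group subset_refl alt_group_is_subgroup, of n]
    by (simp add: alt_group_def)
  also have "\<dots> \<subseteq> derived (sym_group n) (carrier (sym_group n))"
    by (rule group.mono_derived[OF sym_group_is_group A])
  finally have "tower_act Y n f \<sigma> \<in> tower_act Y n f ` derived (sym_group n) (carrier (sym_group n))"
    by blast
  also have "\<dots> = derived full_group (tower_act Y n f ` carrier (sym_group n))"
    by (simp add: h.derived_img)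
  also have "\<dots> \<subseteq> derived full_group (carrier full_group)"
    by (rule FG.mono_derived) (auto intro: h.hom_closed)
  finally show ?thesis .
qed

text \<open>Finitely many local maps with distinct values at \<open>x\<close> have disjoint images
  near \<open>x\<close>: each pair of values is separated by a clopen set, and the preimages are
  intersected.\<close>

lemma tower_shrink:
  assumes fin: "finite J" and A: "clopen A" "x \<in> A"
    and h: "\<And>j. j \<in> J \<Longrightarrow> loc (B j) (h j)" "\<And>j. j \<in> J \<Longrightarrow> x \<in> B j"
    and inj: "inj_on (\<lambda>j. h j x) J"
  obtains Y where "clopen Y" "x \<in> Y" "Y \<subseteq> A" "\<And>j. j \<in> J \<Longrightarrow> Y \<subseteq> B j"
    "\<And>j. j \<in> J \<Longrightarrow> loc Y (h j)"
    "\<And>i j. i \<in> J \<Longrightarrow> j \<in> J \<Longrightarrow> i \<noteq> j \<Longrightarrow> h i ` Y \<inter> h j ` Y = {}"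
proof -
  have in_X: "h j x \<in> X" if "j \<in> J" for j
    using h that loc_image_clopen clopen_subset by blast
  have "\<exists>P. clopen P \<and> h i x \<in> P \<and> h j x \<notin> P" if "i \<in> J" "j \<in> J" "i \<noteq> j" for i j
    using clopen_separate[OF in_X[OF that(1)] in_X[OF that(2)]] inj that by (metis inj_onD)
  then obtain P where P: "clopen (P i j) \<and> h i x \<in> P i j \<and> h j x \<notin> P i j"
    if "i \<in> J" "j \<in> J" "i \<noteq> j" for i j by metis
  \<comment> \<open>The diagonal pairs keep \<open>Y\<close> inside the domains, the other pairs
    separate the images; one intersection over all pairs handles both.\<close>
  define Q where "Q = (\<lambda>(i, j). if i = j then B i
      else {y \<in> B i. h i y \<in> P i j} \<inter> {y \<in> B j. h j y \<in> X - P i j})"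
  define Y where "Y = A \<inter> (\<Inter>p\<in>J \<times> J. Q p)"
  have Q: "clopen (Q (i, j)) \<and> x \<in> Q (i, j)" if ij: "i \<in> J" "j \<in> J" for i j
  proof (cases "i = j")
    case False
    note Pij = P[OF ij False]
    have "clopen (X - P i j)" using Pij clopen_Diff clopen_topspace by blast
    then have "clopen ({y \<in> B i. h i y \<in> P i j} \<inter> {y \<in> B j. h j y \<in> X - P i j})"
      using Pij h(1)[OF ij(1)] h(1)[OF ij(2)] by (intro clopen_Int loc_vimage_clopen) auto
    then show ?thesis
      using Pij False h(2)[OF ij(1)] h(2)[OF ij(2)] in_X[OF ij(2)] by (simp add: Q_def)
  qed (use h ij loc_clopen in \<open>auto simp: Q_def\<close>)
  have Y: "clopen Y"
    unfolding Y_def using fin A Q by (intro clopen_INT) auto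
  have YB: "Y \<subseteq> B j" if "j \<in> J" for j
    using that by (force simp: Y_def Q_def)
  show thesis
  proof
    show "clopen Y" by (rule Y)
    show "x \<in> Y" using A Q by (auto simp: Y_def)
    show "Y \<subseteq> A" by (auto simp: Y_def)
    fix j assume j: "j \<in> J"
    show "Y \<subseteq> B j" by (rule YB[OF j])
    show "loc Y (h j)" by (rule loc_subset[OF h(1)[OF j] Y YB[OF j]])
    fix i assume i: "i \<in> J" and ne: "i \<noteq> j"
    have "Y \<subseteq> Q (i, j)" using i j by (auto simp: Y_def)
    then have "h i ` Y \<subseteq> P i j" "h j ` Y \<subseteq> - P i j"
      using ne by (auto simp: Q_def)
    then show "h i ` Y \<inter> h j ` Y = {}" by blast
  qed
qed

end

text \<open>Since \<open>F\<close> is an arbitrary finite set, every orbit is required to meet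
  \<open>V\<close> in infinitely many points. This is the form of density from which new levels
  disjoint from given ones can be built.\<close>

locale minimal_pseudogroup = ample_pseudogroup +
  assumes minimal: "\<And>x V F. x \<in> topspace T \<Longrightarrow> openin T V \<Longrightarrow> V \<noteq> {} \<Longrightarrow> finite F \<Longrightarrow>
    \<exists>A f. loc A f \<and> x \<in> A \<and> f x \<in> V - F"
begin

text \<open>Each new map is asked to avoid the points reached so far, which are added to
  \<open>F\<close>.\<close>

lemma many_locals:
  assumes x: "x \<in> X" and V: "clopen V" "V \<noteq> {}" and F: "finite F"
  shows "\<exists>A g. (\<forall>k\<in>{1..m}. loc (A k) (g k) \<and> x \<in> A k \<and> g k x \<in> V - F) \<and>
    inj_on (\<lambda>k. g k x) {1..m::nat}"
proof (induction m)
  case 0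
  then show ?case by simp
next
  case (Suc m)
  then obtain A g where Ag: "\<forall>k\<in>{1..m}. loc (A k) (g k) \<and> x \<in> A k \<and> g k x \<in> V - F"
    "inj_on (\<lambda>k. g k x) {1..m}" by blast
  obtain B h where Bh: "loc B h" "x \<in> B" "h x \<in> V - (F \<union> (\<lambda>k. g k x) ` {1..m})"
    using minimal[OF x, of V "F \<union> (\<lambda>k. g k x) ` {1..m}"] V F by (auto simp: clopenin_def)
  let ?A = "A(Suc m := B)" and ?g = "g(Suc m := h)"
  have "\<forall>k\<in>{1..Suc m}. loc (?A k) (?g k) \<and> x \<in> ?A k \<and> ?g k x \<in> V - F"
    using Ag Bh by (auto simp: le_Suc_eq)
  moreover have "inj_on (\<lambda>k. ?g k x) {1..Suc m}"
  proof -
    have "inj_on (\<lambda>k. ?g k x) {1..m} \<longleftrightarrow> inj_on (\<lambda>k. g k x) {1..m}"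
      by (rule inj_on_cong) auto
    moreover have "?g (Suc m) x \<notin> (\<lambda>k. ?g k x) ` {1..m}"
      using Bh(3) by (auto simp: image_iff)
    moreover have "{1..Suc m} = insert (Suc m) {1..m}" by auto
    ultimately show ?thesis using Ag(2) by (simp add: inj_on_insert del: fun_upd_apply)
  qed
  ultimately show ?case by blast
qed

text \<open>At \<open>x\<close> alone one needs \<open>m\<close> further orbit points in
  \<open>V\<close>, distinct from the points \<open>f j x\<close> and from each other.
  \<open>tower_shrink\<close> then turns distinct points into disjoint levels over a smaller
  base.\<close>

lemma tower_extend:
  assumes tw: "tower Y n f" and x: "x \<in> Y" and V: "clopen V" "V \<noteq> {}"
  obtains Z g where "tower Z (n + m) g" "x \<in> Z" "Z \<subseteq> Y" "\<And>j. j \<in> {1..n} \<Longrightarrow> g j = f j"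
    "\<And>j. j \<in> {n+1..n+m} \<Longrightarrow> g j ` Z \<subseteq> V"
proof -
  have xX: "x \<in> X" using x tw tower_clopen clopen_subset by blast
  obtain A k where Ak: "\<forall>j\<in>{1..m}. loc (A j) (k j) \<and> x \<in> A j \<and> k j x \<in> V - (\<lambda>j. f j x) ` {1..n}"
    and inj: "inj_on (\<lambda>j. k j x) {1..m}"
    using many_locals[OF xX V, of "(\<lambda>j. f j x) ` {1..n}" m] by blast
  define g where "g j = (if j \<le> n then f j else k (j - n))" for j
  \<comment> \<open>Cutting the domains of the new maps down to the preimage of \<open>V\<close>
    puts whole levels, not only the points over \<open>x\<close>, inside \<open>V\<close>.\<close>
  define B where "B j = (if j \<le> n then Y else {y \<in> A (j - n). k (j - n) y \<in> V})" for j
  have "loc (B j) (g j) \<and> x \<in> B j" if j: "j \<in> {1..n+m}" for j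
  proof (cases "j \<le> n")
    case True
    then show ?thesis using j x tower_loc[OF tw, of j] by (simp add: B_def g_def)
  next
    case False
    then have j': "j - n \<in> {1..m}" using j by auto
    then have l: "loc (A (j - n)) (k (j - n))" using Ak by blast
    have "loc {y \<in> A (j - n). k (j - n) y \<in> V} (k (j - n))"
      by (rule loc_subset[OF l loc_vimage_clopen[OF l V(1)]]) blast
    then show ?thesis using False Ak j' by (simp add: B_def g_def)
  qed
  then have loc: "\<And>j. j \<in> {1..n+m} \<Longrightarrow> loc (B j) (g j)" and xB: "\<And>j. j \<in> {1..n+m} \<Longrightarrow> x \<in> B j"
    by blast+
  have injg: "inj_on (\<lambda>j. g j x) {1..n+m}"
  proof (rule inj_onI)
    fix i j assume ij: "i \<in> {1..n+m}" "j \<in> {1..n+m}" and eq: "g i x = g j x"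
    have *: "k (l - n) x \<notin> (\<lambda>j. f j x) ` {1..n}" if "l \<in> {1..n+m}" "\<not> l \<le> n" for l
    proof -
      have "l - n \<in> {1..m}" using that by auto
      then show ?thesis using Ak by blast
    qed
    consider "i \<le> n" "j \<le> n" | "i \<le> n" "\<not> j \<le> n" | "\<not> i \<le> n" "j \<le> n" | "\<not> i \<le> n" "\<not> j \<le> n"
      by blast
    then show "i = j"
    proof cases
      case 1
      then show ?thesis using eq ij tower_unique(1)[OF tw, of i j x x] x by (simp add: g_def)
    next
      case 2
      then have "f i x = k (j - n) x" using eq by (simp add: g_def)
      then show ?thesis using 2 ij *[of j] by (metis atLeastAtMost_iff image_eqI)
    next
      case 3
      then have "f j x = k (i - n) x" using eq by (simp add: g_def)
      then show ?thesis using 3 ij *[of i] by (metis atLeastAtMost_iff image_eqI)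
    next
      case 4
      then have "i - n \<in> {1..m}" "j - n \<in> {1..m}" "k (i - n) x = k (j - n) x"
        using eq ij by (auto simp: g_def)
      then have "i - n = j - n" using inj by (meson inj_onD)
      then show ?thesis using 4 by simp
    qed
  qed
  obtain Z where Z: "clopen Z" "x \<in> Z" "Z \<subseteq> Y" "\<And>j. j \<in> {1..n+m} \<Longrightarrow> Z \<subseteq> B j"
    "\<And>j. j \<in> {1..n+m} \<Longrightarrow> loc Z (g j)"
    "\<And>i j. i \<in> {1..n+m} \<Longrightarrow> j \<in> {1..n+m} \<Longrightarrow> i \<noteq> j \<Longrightarrow> g i ` Z \<inter> g j ` Z = {}"
    by (rule tower_shrink[OF _ tower_clopen[OF tw] x loc xB injg]) auto
  show thesis
  proof
    show "tower Z (n + m) g" using Z by (simp add: tower_def)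
    show "x \<in> Z" "Z \<subseteq> Y" by (fact Z)+
    show "g j = f j" if "j \<in> {1..n}" for j using that by (simp add: g_def)
    fix j assume j: "j \<in> {n+1..n+m}"
    then have "\<not> j \<le> n" "j \<in> {1..n+m}" by auto
    then show "g j ` Z \<subseteq> V" using Z(4)[of j] by (auto simp: B_def g_def)
  qed
qed

text \<open>Prolong the tower with base \<open>X\<close> and no levels at all, for which every level
  condition is vacuous.\<close>

lemma tower_exists:
  assumes x: "x \<in> X"
  obtains Y f where "tower Y n f" "x \<in> Y"
proof -
  have "tower X 0 (\<lambda>_ x. x)"
    unfolding tower_def using clopen_topspace by simp
  moreover have "X \<noteq> {}" using x by blast
  ultimately obtain Z g where "tower Z (0 + n) g" "x \<in> Z"
    by (rule tower_extend[OF _ x clopen_topspace, of 0 _ n])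
  then show thesis using that by simp
qed

end

section \<open>Subgroups normalized by the commutator subgroup\<close>

text \<open>With d = tau alpha^-1 tau^-1, the product of alpha and d is the commutator of alpha and
  tau, which lies in \<open>N\<close> because alpha normalizes \<open>N\<close>. Its commutator with
  beta lies in \<open>N\<close> because beta normalizes \<open>N\<close>, and it equals the
  commutator of alpha and beta because d commutes with beta.\<close>

lemma (in group) commutator_mem_normalized:
  assumes N: "subgroup N G" and \<tau>: "\<tau> \<in> N" and car: "\<alpha> \<in> carrier G" "\<beta> \<in> carrier G"
    and conj: "\<And>n. n \<in> N \<Longrightarrow> \<alpha> \<otimes> n \<otimes> inv \<alpha> \<in> N" "\<And>n. n \<in> N \<Longrightarrow> \<beta> \<otimes> n \<otimes> inv \<beta> \<in> N"
    and comm: "(\<tau> \<otimes> inv \<alpha> \<otimes> inv \<tau>) \<otimes> \<beta> = \<beta> \<otimes> (\<tau> \<otimes> inv \<alpha> \<otimes> inv \<tau>)"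
  shows "\<alpha> \<otimes> \<beta> \<otimes> inv \<alpha> \<otimes> inv \<beta> \<in> N"
proof -
  have \<tau>c: "\<tau> \<in> carrier G" using N \<tau> subgroup.subset by blast
  define d where "d = \<tau> \<otimes> inv \<alpha> \<otimes> inv \<tau>"
  have d: "d \<in> carrier G" using car \<tau>c by (simp add: d_def)
  have "\<alpha> \<otimes> d = (\<alpha> \<otimes> \<tau> \<otimes> inv \<alpha>) \<otimes> inv \<tau>" using car \<tau>c by (simp add: d_def m_assoc)
  then have c: "\<alpha> \<otimes> d \<in> N"
    using conj(1)[OF \<tau>] N \<tau> by (simp add: subgroup.m_closed subgroup.m_inv_closed)
  then have "(\<alpha> \<otimes> d) \<otimes> (\<beta> \<otimes> inv (\<alpha> \<otimes> d) \<otimes> inv \<beta>) \<in> N"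
    using conj(2) N by (simp add: subgroup.m_closed subgroup.m_inv_closed)
  also have "(\<alpha> \<otimes> d) \<otimes> (\<beta> \<otimes> inv (\<alpha> \<otimes> d) \<otimes> inv \<beta>) = \<alpha> \<otimes> (d \<otimes> \<beta>) \<otimes> inv d \<otimes> inv \<alpha> \<otimes> inv \<beta>"
    using car d by (simp add: m_assoc inv_mult_group)
  also have "\<dots> = \<alpha> \<otimes> (\<beta> \<otimes> d) \<otimes> inv d \<otimes> inv \<alpha> \<otimes> inv \<beta>"
    using comm by (simp add: d_def)
  also have "\<dots> = \<alpha> \<otimes> \<beta> \<otimes> inv \<alpha> \<otimes> inv \<beta>"
    using car d by (simp add: m_assoc inv_solve_left)
  finally show ?thesis .
qed

lemma (in group) normalizer_conj_mem:
  assumes "subgroup N G" "d \<in> normalizer G N" "n \<in> N"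
  shows "d \<otimes> n \<otimes> inv d \<in> N"
proof -
  have "d <# N #> inv d = N"
    using assms(2) subgroup.subset[OF assms(1)] by (simp add: normalizer_def stabilizer_def)
  moreover have "d \<otimes> n \<otimes> inv d \<in> d <# N #> inv d"
    using assms(3) by (auto simp: l_coset_def r_coset_def)
  ultimately show ?thesis by simp
qed

context ample_pseudogroup
begin

text \<open>By injectivity a map that moves \<open>x\<close> also moves the image of
  \<open>x\<close>, so that image is again fixed by the other map.\<close>

lemma disjoint_support_commute:
  assumes \<gamma>: "\<gamma> \<in> full_carrier" and \<delta>: "\<delta> \<in> full_carrier"
    and dis: "\<And>x. x \<in> X \<Longrightarrow> \<gamma> x = x \<or> \<delta> x = x"
  shows "\<gamma> \<otimes>\<^bsub>full_group\<^esub> \<delta> = \<delta> \<otimes>\<^bsub>full_group\<^esub> \<gamma>"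
proof (rule full_eqI)
  fix x assume x: "x \<in> X"
  note inj = inj_onD[OF full_carrierD(3)[OF \<gamma>]] inj_onD[OF full_carrierD(3)[OF \<delta>]]
  note mem = full_carrierD(4)[OF \<gamma>] full_carrierD(4)[OF \<delta>]
  have "\<gamma> (\<delta> x) = \<delta> (\<gamma> x)"
    using dis[OF x] dis[OF mem(1)[OF x]] dis[OF mem(2)[OF x]] inj mem x by metis
  then show "(\<gamma> \<otimes>\<^bsub>full_group\<^esub> \<delta>) x = (\<delta> \<otimes>\<^bsub>full_group\<^esub> \<gamma>) x"
    using \<gamma> \<delta> x by (simp add: full_mult_apply)
qed (use \<gamma> \<delta> full_mult_closed in auto)

lemma tower_act_empty:
  assumes "\<sigma> permutes {1..n}"
  shows "tower_act {} n f \<sigma> = \<one>\<^bsub>full_group\<^esub>"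
proof (rule full_eqI)
  have "tower {} n f"
    using loc_cong[OF loc_ident[OF clopen_empty]] by (simp add: tower_def clopen_empty)
  then show "tower_act {} n f \<sigma> \<in> full_carrier" using assms by (rule tower_act_full)
qed (simp_all add: full_one_closed full_one_apply tower_act_def levels_def)

end

context minimal_pseudogroup
begin

lemma nontrivial_displaces:
  assumes \<tau>: "\<tau> \<in> full_carrier" "\<tau> \<noteq> \<one>\<^bsub>full_group\<^esub>"
  obtains U where "clopen U" "U \<noteq> {}" "\<tau> ` U \<inter> U = {}"
proof -
  obtain x where x: "x \<in> X" "\<tau> x \<noteq> x"
    using \<tau> full_eqI[OF \<tau>(1) full_one_closed] full_one_apply by auto
  then obtain P where P: "clopen P" "x \<in> P" "\<tau> x \<notin> P"
    using clopen_separate[of x "\<tau> x"] full_carrierD(4)[OF \<tau>(1)] by metis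
  let ?U = "P \<inter> {y \<in> X. \<tau> y \<in> X - P}"
  have "clopen ?U"
    using P full_carrierD(1)[OF \<tau>(1)]
    by (intro clopen_Int loc_vimage_clopen clopen_Diff clopen_topspace) auto
  moreover have "x \<in> ?U" using P x full_carrierD(4)[OF \<tau>(1)] by auto
  moreover have "\<tau> ` ?U \<inter> ?U = {}" by auto
  ultimately show thesis using that by blast
qed

text \<open>Over a base small enough to carry five more levels inside a displaced set
  \<open>U\<close>, the 3-cycle is conjugate by an element of \<open>?D\<close> to a commutator to
  which \<open>commutator_mem_normalized\<close> applies. Since \<open>N\<close> is closed under
  products, small bases can be glued.\<close>

lemma alternating_full_le_normalized:
  assumes N: "subgroup N full_group" "N \<noteq> {\<one>\<^bsub>full_group\<^esub>}"
    and norm: "derived full_group (carrier full_group) \<subseteq> normalizer full_group N"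
  shows "alternating_full \<subseteq> N"
proof (rule alternating_full_leI[OF N(1)])
  fix Y n f c assume tw: "tower Y n f" and c3: "c \<in> three_cycles n"
  note c = three_cycle_permutes[OF c3]
  let ?D = "derived full_group (carrier full_group)"
  have conj: "d \<otimes>\<^bsub>full_group\<^esub> \<nu> \<otimes>\<^bsub>full_group\<^esub> inv\<^bsub>full_group\<^esub> d \<in> N" if "d \<in> ?D" "\<nu> \<in> N" for d \<nu>
    using FG.normalizer_conj_mem[OF N(1)] norm that by blast
  have N_full: "\<nu> \<in> full_carrier" if "\<nu> \<in> N" for \<nu>
    using subgroup.subset[OF N(1)] that by (auto simp: carrier_full_group)
  obtain \<tau> where \<tau>: "\<tau> \<in> N" "\<tau> \<noteq> \<one>\<^bsub>full_group\<^esub>"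
    using N subgroup.one_closed[OF N(1)] by blast
  note \<tau>f = N_full[OF \<tau>(1)]
  obtain U where U: "clopen U" "U \<noteq> {}" "\<tau> ` U \<inter> U = {}"
    using nontrivial_displaces[OF \<tau>f \<tau>(2)] by blast
  obtain p a b where p: "p permutes {1..n+5}" "evenperm p"
    and a: "a permutes {n+1..n+5}" "evenperm a" and b: "b permutes {n+1..n+5}" "evenperm b"
    and c_eq: "c = inv' p \<circ> (a \<circ> b \<circ> inv' a \<circ> inv' b) \<circ> p"
    by (rule three_cycle_conjugate_commutator[OF c3])
  have a': "a permutes {1..n+5}" and b': "b permutes {1..n+5}"
    using a b by (auto intro: permutes_subset)
  have small: "tower_act W n f c \<in> N"
    if tw5: "tower W (n + 5) g" and agree: "\<And>j. j \<in> {1..n} \<Longrightarrow> g j = f j"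
      and twn: "tower W n f" and inU: "\<And>j. j \<in> {n+1..n+5} \<Longrightarrow> g j ` W \<subseteq> U" for W g
  proof -
    define \<Phi> where "\<Phi> = tower_act W (n + 5) g"
    interpret h: group_hom "sym_group (n + 5)" full_group \<Phi>
      unfolding \<Phi>_def by (rule tower_act_hom[OF tw5])
    have car: "p \<in> carrier (sym_group (n+5))" "a \<in> carrier (sym_group (n+5))" "b \<in> carrier (sym_group (n+5))"
      using p a' b' by (simp_all add: sym_group_carrier)
    have \<Phi>f: "\<Phi> \<sigma> \<in> full_carrier" if "\<sigma> permutes {1..n+5}" for \<sigma>
      unfolding \<Phi>_def by (rule tower_act_full[OF tw5 that])
    have \<Phi>D: "\<Phi> \<sigma> \<in> ?D" if "\<sigma> permutes {1..n+5}" "evenperm \<sigma>" for \<sigma>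
      unfolding \<Phi>_def by (rule tower_act_even_derived[OF tw5 _ that]) simp
    have supp: "\<Phi> \<sigma> x = x" if \<sigma>: "\<sigma> permutes {n+1..n+5}" and x: "x \<in> X" "x \<notin> U" for \<sigma> x
    proof (cases "x \<in> levels W (n + 5) g")
      case True
      then obtain j y where jy: "j \<in> {1..n+5}" "y \<in> W" "x = g j y" by (auto simp: levels_def)
      then have "j \<notin> {n+1..n+5}" using inU x by blast
      then have "\<sigma> j = j" using \<sigma> by (simp add: permutes_def)
      then show ?thesis using tower_act_level[OF tw5 jy(1,2)] jy by (simp add: \<Phi>_def)
    next
      case False
      then show ?thesis using x by (simp add: \<Phi>_def tower_act_outside)
    qed
    let ?A = "\<Phi> a" and ?B = "\<Phi> b"
    define K where "K = \<tau> \<otimes>\<^bsub>full_group\<^esub> inv\<^bsub>full_group\<^esub> ?A \<otimes>\<^bsub>full_group\<^esub> inv\<^bsub>full_group\<^esub> \<tau>"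
    have inv_A: "inv\<^bsub>full_group\<^esub> ?A = \<Phi> (inv' a)"
      unfolding \<Phi>_def by (rule tower_act_inv[OF tw5 a'])
    note cl = \<tau>f full_inv_closed[OF \<tau>f] full_inv_closed[OF \<Phi>f[OF a']]
    have Kf: "K \<in> full_carrier" unfolding K_def using cl by (simp add: full_mult_closed)
    \<comment> \<open>\<open>K\<close> is supported in the image of \<open>U\<close> under
      \<open>\<tau>\<close>, which is disjoint from \<open>U\<close>, while \<open>?B\<close> is
      supported in \<open>U\<close>.\<close>
    have "K x = x \<or> ?B x = x" if x: "x \<in> X" for x
    proof (cases "x \<in> U")
      case True
      define x' where "x' = (inv\<^bsub>full_group\<^esub> \<tau>) x"
      have x': "x' \<in> X" "\<tau> x' = x" using full_inv_apply[OF \<tau>f x] by (simp_all add: x'_def)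
      then have "x' \<notin> U" using True U(3) by blast
      then have "(inv\<^bsub>full_group\<^esub> ?A) x' = x'"
        unfolding inv_A using supp[OF permutes_inv[OF a(1)] x'(1)] by blast
      then have "K x = x"
        unfolding K_def using cl x x' by (simp add: full_mult_apply full_mult_closed flip: x'_def)
      then show ?thesis ..
    next
      case False
      then show ?thesis using supp[OF b(1) x] by blast
    qed
    then have "K \<otimes>\<^bsub>full_group\<^esub> ?B = ?B \<otimes>\<^bsub>full_group\<^esub> K"
      by (rule disjoint_support_commute[OF Kf \<Phi>f[OF b']])
    then have AB: "?A \<otimes>\<^bsub>full_group\<^esub> ?B \<otimes>\<^bsub>full_group\<^esub> inv\<^bsub>full_group\<^esub> ?A \<otimes>\<^bsub>full_group\<^esub> inv\<^bsub>full_group\<^esub> ?B \<in> N"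
      using conj[OF \<Phi>D[OF a' a(2)]] conj[OF \<Phi>D[OF b' b(2)]] \<Phi>f[OF a'] \<Phi>f[OF b']
      by (intro FG.commutator_mem_normalized[OF N(1) \<tau>(1)])
        (simp_all add: carrier_full_group K_def)
    have pe: "inv' p permutes {1..n+5}" "evenperm (inv' p)"
      using p evenperm_inv permutes_inv by (auto simp: permutation_permutes)
    have cc: "c = inv' p \<otimes>\<^bsub>sym_group (n+5)\<^esub> (a \<otimes>\<^bsub>sym_group (n+5)\<^esub> b
        \<otimes>\<^bsub>sym_group (n+5)\<^esub> inv\<^bsub>sym_group (n+5)\<^esub> a \<otimes>\<^bsub>sym_group (n+5)\<^esub> inv\<^bsub>sym_group (n+5)\<^esub> b)
        \<otimes>\<^bsub>sym_group (n+5)\<^esub> inv\<^bsub>sym_group (n+5)\<^esub> (inv' p)"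
      using car pe p by (simp add: c_eq sym_group_mult sym_group_carrier permutes_inv_inv)
    have "\<Phi> c = \<Phi> (inv' p) \<otimes>\<^bsub>full_group\<^esub> (?A \<otimes>\<^bsub>full_group\<^esub> ?B \<otimes>\<^bsub>full_group\<^esub> inv\<^bsub>full_group\<^esub> ?A
        \<otimes>\<^bsub>full_group\<^esub> inv\<^bsub>full_group\<^esub> ?B) \<otimes>\<^bsub>full_group\<^esub> inv\<^bsub>full_group\<^esub> (\<Phi> (inv' p))"
    proof -
      have "inv' p \<in> carrier (sym_group (n+5))" using pe(1) by (simp add: sym_group_carrier)
      \<comment> \<open>The inverses must remain group inverses in \<open>sym_group (n+5)\<close>
        for the homomorphism \<open>\<Phi>\<close> to carry them over.\<close>
      then show ?thesis unfolding cc using car by (simp del: sym_group_inv_equality)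
    qed
    also have "\<dots> \<in> N" by (rule conj[OF \<Phi>D[OF pe] AB])
    finally have "\<Phi> c \<in> N" .
    moreover have "\<Phi> c = tower_act W n f c"
      unfolding \<Phi>_def by (rule tower_act_extend[OF twn tw5 _ c agree]) simp_all
    ultimately show ?thesis by simp
  qed
  \<comment> \<open>The compactness principle speaks of the whole space, so it is applied to subsets
    \<open>W\<close> of \<open>X\<close> with base \<open>W \<inter> Y\<close>; near points outside
    \<open>Y\<close> this base is empty and the action is the identity.\<close>
  have "tower_act (X \<inter> Y) n f c \<in> N"
  proof (rule compact_space_clopen_induct[where \<B> = "Collect clopen"
        and P = "\<lambda>W. tower_act (W \<inter> Y) n f c \<in> N", OF compact_T])
    show "openin T A" if "A \<in> Collect clopen" for A using that by (simp add: clopenin_def)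
    show "tower_act ({} \<inter> Y) n f c \<in> N"
      using tower_act_empty[OF c] subgroup.one_closed[OF N(1)] by simp
  next
    fix A B assume AB: "A \<in> Collect clopen" "B \<in> Collect clopen" "A \<inter> B = {}"
      "tower_act (A \<inter> Y) n f c \<in> N" "tower_act (B \<inter> Y) n f c \<in> N"
    have cl: "clopen (A \<inter> Y)" "clopen (B \<inter> Y)" "clopen ((A \<union> B) \<inter> Y)"
      using AB tower_clopen[OF tw] clopen_Int clopen_Un by auto
    have "tower_act ((A \<union> B) \<inter> Y) n f c
        = tower_act (A \<inter> Y) n f c \<otimes>\<^bsub>full_group\<^esub> tower_act (B \<inter> Y) n f c"
      by (rule tower_act_Un[OF tower_subset[OF tw cl(3)] cl(1,2) _ _ c]) (use AB in auto)
    then show "tower_act ((A \<union> B) \<inter> Y) n f c \<in> N"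
      using AB subgroup.m_closed[OF N(1)] by simp
  next
    fix x assume x: "x \<in> topspace T"
    show "\<exists>Z\<in>Collect clopen. x \<in> Z \<and> (\<forall>W\<in>Collect clopen. W \<subseteq> Z \<longrightarrow> tower_act (W \<inter> Y) n f c \<in> N)"
    proof (cases "x \<in> Y")
      case True
      obtain Z g where Z: "tower Z (n + 5) g" "x \<in> Z" "Z \<subseteq> Y" "\<And>j. j \<in> {1..n} \<Longrightarrow> g j = f j"
        "\<And>j. j \<in> {n+1..n+5} \<Longrightarrow> g j ` Z \<subseteq> U"
        by (rule tower_extend[OF tw True U(1,2), of 5]) blast
      have "tower_act (W \<inter> Y) n f c \<in> N" if W: "clopen W" "W \<subseteq> Z" for W
      proof -
        have "W \<inter> Y = W" using W Z by blast
        moreover have "tower_act W n f c \<in> N"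
        proof (rule small[OF tower_subset[OF Z(1) W] Z(4) tower_subset[OF tw W(1)]])
          show "W \<subseteq> Y" using W Z(3) by blast
          show "g j ` W \<subseteq> U" if "j \<in> {n+1..n+5}" for j using W Z(5)[OF that] by blast
        qed
        ultimately show ?thesis by simp
      qed
      then show ?thesis using Z(2) tower_clopen[OF Z(1)] by (intro bexI[of _ Z]) auto
    next
      case False
      have "tower_act (W \<inter> Y) n f c \<in> N" if "W \<subseteq> X - Y" for W
      proof -
        have "W \<inter> Y = {}" using that by blast
        then show ?thesis
          using tower_act_empty[OF c] subgroup.one_closed[OF N(1)] by simp
      qed
      moreover have "clopen (X - Y)" using clopen_Diff clopen_topspace tower_clopen[OF tw] by blast
      ultimately show ?thesis using x False by blast
    qed
  qed (auto intro: clopen_Un clopen_Diff clopen_topspace)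
  moreover have "X \<inter> Y = Y" using clopen_subset[OF tower_clopen[OF tw]] by blast
  ultimately show "tower_act Y n f c \<in> N" by simp
qed

end

section \<open>The commutator subgroup is contained in the alternating full group\<close>

text \<open>
  Enlarging the exceptional set to \<open>n div 4 \<ge> 2\<close> points leaves two of them for correcting the
  parity, and still two such sets can be made disjoint by an even permutation.
\<close>

lemma even_approximation:
  assumes n: "8 \<le> n" and J: "J \<subseteq> {1..n}" "8 * card ({1..n} - J) \<le> n"
    and q: "inj_on q J" "q ` J \<subseteq> {1..n}"
  obtains B \<sigma> where "B \<subseteq> {1..n}" "card B = n div 4" "\<sigma> permutes {1..n}" "evenperm \<sigma>"
    "\<And>j. j \<in> {1..n} - B \<Longrightarrow> j \<in> J \<and> \<sigma> j = q j"
proof -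
  have "card ({1..n} - J) \<le> n div 4"
    using J(2) by (simp add: less_eq_div_iff_mult_less_eq)
  then obtain B where B: "{1..n} - J \<subseteq> B" "B \<subseteq> {1..n}" "card B = n div 4"
    using exists_subset_between[of "{1..n} - J" "n div 4" "{1..n}"] by auto
  then have sub: "{1..n} - B \<subseteq> J" by auto
  obtain \<sigma> where \<sigma>: "\<sigma> permutes {1..n}" "evenperm \<sigma>" "\<And>j. j \<in> {1..n} - B \<Longrightarrow> \<sigma> j = q j"
  proof (rule permutes_evenperm_extension[of "{1..n}" "{1..n} - B" q])
    show "inj_on q ({1..n} - B)" using q sub inj_on_subset by blast
    show "q ` ({1..n} - B) \<subseteq> {1..n}" using q sub by blast
    have "{1..n} - ({1..n} - B) = B" using B by blast
    then show "2 \<le> card ({1..n} - ({1..n} - B))" using B(3) n by simp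
  qed auto
  show thesis using that[OF B(2,3) \<sigma>(1,2)] sub \<sigma>(3) by blast
qed

lemma even_approximations:
  assumes n: "8 \<le> n"
    and J: "J \<subseteq> {1..n}" "8 * card ({1..n} - J) \<le> n" "inj_on q J" "q ` J \<subseteq> {1..n}"
    and J': "J' \<subseteq> {1..n}" "8 * card ({1..n} - J') \<le> n" "inj_on q' J'" "q' ` J' \<subseteq> {1..n}"
  obtains \<sigma> \<sigma>' \<rho> where "\<sigma> permutes {1..n}" "evenperm \<sigma>" "\<sigma>' permutes {1..n}" "evenperm \<sigma>'"
    "\<rho> permutes {1..n}" "evenperm \<rho>"
    "\<And>j. j \<in> {1..n} \<Longrightarrow> (j \<in> J \<and> \<sigma> j = q j) \<or> (\<rho> j \<in> J' \<and> \<sigma>' (\<rho> j) = q' (\<rho> j))"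
proof -
  obtain B \<sigma> where B: "B \<subseteq> {1..n}" "card B = n div 4" and \<sigma>: "\<sigma> permutes {1..n}" "evenperm \<sigma>"
    "\<And>j. j \<in> {1..n} - B \<Longrightarrow> j \<in> J \<and> \<sigma> j = q j"
    by (rule even_approximation[OF n J]) blast
  obtain B' \<sigma>' where B': "B' \<subseteq> {1..n}" "card B' = n div 4" and \<sigma>': "\<sigma>' permutes {1..n}" "evenperm \<sigma>'"
    "\<And>j. j \<in> {1..n} - B' \<Longrightarrow> j \<in> J' \<and> \<sigma>' j = q' j"
    by (rule even_approximation[OF n J']) blast
  have fin: "finite B" "finite B'" using B B' finite_subset by auto
  have c: "card ({1..n} - B) = n - n div 4" "card ({1..n} - B') = n - n div 4"
    using B B' fin by (simp_all add: card_Diff_subset)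
  \<comment> \<open>A quarter fits into the remaining three quarters, so \<open>\<rho>\<close> can
    send every bad level of the first map to a good level of the second.\<close>
  have "card B \<le> card ({1..n} - B')" unfolding c B(2) by linarith
  then obtain r where r: "r ` B \<subseteq> {1..n} - B'" "inj_on r B"
    using card_le_inj[of B "{1..n} - B'"] fin by auto
  obtain \<rho> where \<rho>: "\<rho> permutes {1..n}" "evenperm \<rho>" "\<And>j. j \<in> B \<Longrightarrow> \<rho> j = r j"
    by (rule permutes_evenperm_extension[of "{1..n}" B r]) (use B r c n in auto)
  show thesis
  proof
    fix j assume j: "j \<in> {1..n}"
    show "(j \<in> J \<and> \<sigma> j = q j) \<or> (\<rho> j \<in> J' \<and> \<sigma>' (\<rho> j) = q' (\<rho> j))"
    proof (cases "j \<in> B")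
      case True
      then have "\<rho> j \<in> {1..n} - B'" using \<rho>(3) r(1) by auto
      then show ?thesis using \<sigma>'(3) by blast
    next
      case False
      then show ?thesis using \<sigma>(3) j by blast
    qed
  qed (fact \<sigma> \<sigma>' \<rho>)+
qed

text \<open>In the quotient by \<open>A\<close> the elements \<open>k\<close>, \<open>k'\<close> and
  \<open>h\<close> vanish, so the two commuting elements become the classes of
  \<open>\<alpha>\<close> and \<open>\<beta>\<close>. The computation is done with right
  cosets.\<close>

lemma (in group) commutator_mem_normal:
  assumes A: "A \<lhd> G" and k: "k \<in> A" "k' \<in> A" "h \<in> A" and c: "\<alpha> \<in> carrier G" "\<beta> \<in> carrier G"
    and comm: "(inv k \<otimes> \<alpha>) \<otimes> (inv h \<otimes> (inv k' \<otimes> \<beta>) \<otimes> h) = (inv h \<otimes> (inv k' \<otimes> \<beta>) \<otimes> h) \<otimes> (inv k \<otimes> \<alpha>)"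
  shows "\<alpha> \<otimes> \<beta> \<otimes> inv \<alpha> \<otimes> inv \<beta> \<in> A"
proof -
  interpret A: normal A G by (rule A)
  have kc: "k \<in> carrier G" "k' \<in> carrier G" "h \<in> carrier G" using k A.subset by auto
  have absorb_left: "A #> (l \<otimes> x) = A #> x" if "l \<in> A" "x \<in> carrier G" for l x
    using that A.subset by (metis A.is_subgroup coset_join2 coset_mult_assoc subsetD)
  have absorb_right: "A #> (x \<otimes> l) = A #> x" if "l \<in> A" "x \<in> carrier G" for l x
  proof -
    have lc: "l \<in> carrier G" using that A.subset by auto
    have "x \<otimes> l = (x \<otimes> l \<otimes> inv x) \<otimes> x" using lc that by (simp add: m_assoc)
    then show ?thesis using absorb_left A.inv_op_closed2 that by metis
  qed
  let ?a = "inv k \<otimes> \<alpha>" and ?b = "inv h \<otimes> (inv k' \<otimes> \<beta>) \<otimes> h"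
  have ab: "?a \<in> carrier G" "?b \<in> carrier G" using kc c by simp_all
  have a: "A #> ?a = A #> \<alpha>" using k c by (intro absorb_left) simp_all
  have "A #> ?b = A #> (inv h \<otimes> (inv k' \<otimes> \<beta>))" using k kc c by (intro absorb_right) simp_all
  also have "\<dots> = A #> \<beta>" using k kc c by (simp add: absorb_left)
  finally have b: "A #> ?b = A #> \<beta>" .
  have "A #> (\<alpha> \<otimes> \<beta>) = (A #> ?a) <#> (A #> ?b)" unfolding a b using c by (simp add: A.rcos_sum)
  also have "\<dots> = (A #> ?b) <#> (A #> ?a)" using ab by (simp add: A.rcos_sum comm)
  also have "\<dots> = A #> (\<beta> \<otimes> \<alpha>)" unfolding a b using c by (simp add: A.rcos_sum)
  finally have "\<alpha> \<otimes> \<beta> \<in> A #> (\<beta> \<otimes> \<alpha>)" using c rcos_self[OF _ A.is_subgroup] by (metis m_closed)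
  then obtain l where l: "l \<in> A" "\<alpha> \<otimes> \<beta> = l \<otimes> (\<beta> \<otimes> \<alpha>)" by (auto simp: r_coset_def)
  then have lc: "l \<in> carrier G" using A.subset by auto
  have "\<alpha> \<otimes> \<beta> \<otimes> inv \<alpha> \<otimes> inv \<beta> = (\<alpha> \<otimes> \<beta>) \<otimes> inv (\<beta> \<otimes> \<alpha>)"
    using c by (simp add: m_assoc inv_mult_group)
  also have "\<dots> = l \<otimes> ((\<beta> \<otimes> \<alpha>) \<otimes> inv (\<beta> \<otimes> \<alpha>))"
    unfolding l(2) using lc c by (intro m_assoc) simp_all
  also have "\<dots> = l"
    unfolding r_inv[OF m_closed[OF c(2,1)]] using lc by simp
  finally show ?thesis using l(1) by simp
qed

context ample_pseudogroup
begin

text \<open>On a good level the map preserves the base coordinate \<open>y\<close>, and one target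
  level \<open>l\<close> serves all of \<open>Y\<close>; there it acts exactly like a permutation of
  levels. At most an eighth of the levels may be bad.\<close>

definition mostly_permutes :: "('a \<Rightarrow> 'a) \<Rightarrow> 'a set \<Rightarrow> nat \<Rightarrow> (nat \<Rightarrow> 'a \<Rightarrow> 'a) \<Rightarrow> bool" where
  "mostly_permutes \<gamma> Y n f \<longleftrightarrow> (\<exists>J\<subseteq>{1..n}. 8 * card ({1..n} - J) \<le> n \<and>
     (\<forall>j\<in>J. \<exists>l\<in>{1..n}. \<forall>y\<in>Y. \<gamma> (f j y) = f l y))"

text \<open>Evaluation at the point \<open>x\<close> makes \<open>q\<close> injective; over an empty
  base the target levels would be arbitrary.\<close>

lemma mostly_permutesE:
  assumes tw: "tower Y n f" and x: "x \<in> Y" and \<gamma>: "\<gamma> \<in> full_carrier" "mostly_permutes \<gamma> Y n f"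
  obtains J q where "J \<subseteq> {1..n}" "8 * card ({1..n} - J) \<le> n" "inj_on q J" "q ` J \<subseteq> {1..n}"
    "\<And>j y. j \<in> J \<Longrightarrow> y \<in> Y \<Longrightarrow> \<gamma> (f j y) = f (q j) y"
proof -
  obtain J where J: "J \<subseteq> {1..n}" "8 * card ({1..n} - J) \<le> n"
    "\<forall>j\<in>J. \<exists>l\<in>{1..n}. \<forall>y\<in>Y. \<gamma> (f j y) = f l y"
    using \<gamma>(2) by (auto simp: mostly_permutes_def)
  obtain q where q: "\<And>j. j \<in> J \<Longrightarrow> q j \<in> {1..n} \<and> (\<forall>y\<in>Y. \<gamma> (f j y) = f (q j) y)"
    using bchoice[of J "\<lambda>j l. l \<in> {1..n} \<and> (\<forall>y\<in>Y. \<gamma> (f j y) = f l y)"] J(3) by blast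
  have "inj_on q J"
  proof (rule inj_onI)
    fix i j assume ij: "i \<in> J" "j \<in> J" "q i = q j"
    then have "\<gamma> (f i x) = \<gamma> (f j x)" using q x by simp
    then have "f i x = f j x"
      using ij J(1) x tower_in_X[OF tw] full_carrierD(3)[OF \<gamma>(1)] by (meson inj_onD subsetD)
    then show "i = j" using tower_unique(1)[OF tw _ _ x x] ij J(1) by blast
  qed
  then show thesis using that J(1,2) q by blast
qed

end

text \<open>\<open>R\<close> sends a point to its class under an equivalence relation with finite
  classes, later the orbits of an elementary subgroupoid. The fibre of each tower over a base point
  is a whole class, so a saturated clopen set inside a tower is again made of complete
  fibres.\<close>

locale almost_finite_pseudogroup = minimal_pseudogroup +
  assumes almost_finite_towers: "\<And>\<alpha> \<beta>. \<alpha> \<in> full_carrier \<Longrightarrow> \<beta> \<in> full_carrier \<Longrightarrow>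
    \<exists>R. (\<forall>x\<in>topspace T. R x \<subseteq> topspace T \<and> x \<in> R x \<and> (\<forall>y\<in>R x. R y = R x)) \<and>
      (\<forall>x\<in>topspace T. \<exists>Y n f. tower Y n f \<and> x \<in> Y \<and> 8 \<le> n \<and>
         (\<forall>y\<in>Y. R y = (\<lambda>j. f j y) ` {1..n}) \<and>
         mostly_permutes \<alpha> Y n f \<and> mostly_permutes \<beta> Y n f)"
begin

text \<open>
  The condition on \<open>W\<close> says that \<open>k\<inverse> \<alpha>\<close> and \<open>h\<inverse> (k'\<inverse> \<beta>) h\<close> have disjoint supports there. In this
  form it is local, so that corrections on disjoint invariant sets can be glued.
\<close>

definition commuting_correction :: "('a \<Rightarrow> 'a) \<Rightarrow> ('a \<Rightarrow> 'a) \<Rightarrow> 'a set \<Rightarrow> bool" where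
  "commuting_correction \<alpha> \<beta> W \<longleftrightarrow>
     (\<exists>k\<in>alternating_full. \<exists>k'\<in>alternating_full. \<exists>h\<in>alternating_full.
        (\<forall>x\<in>X - W. k x = x \<and> k' x = x \<and> h x = x) \<and>
        (\<forall>x\<in>W. \<alpha> x = k x \<or> \<beta> (h x) = k' (h x)))"

lemma full_carrier_preserves:
  assumes "k \<in> full_carrier" "\<And>x. x \<in> X - W \<Longrightarrow> k x = x" "W \<subseteq> X" "x \<in> W"
  shows "k x \<in> W"
proof (rule ccontr)
  assume "k x \<notin> W"
  then have "k x \<in> X - W" using full_carrierD(4)[OF assms(1)] assms by blast
  then have "k (k x) = k x" "k x \<in> X" using assms(2) by auto
  then have "k x = x" using full_carrierD(3)[OF assms(1)] assms by (meson inj_onD subsetD)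
  then show False using \<open>k x \<notin> W\<close> assms by simp
qed

text \<open>The corrections are multiplied. Each one maps its own set to itself and is the identity
  on the other, so on either set the products reduce to the factors belonging to it, also at the
  moved points \<open>h x\<close> and \<open>m x\<close>.\<close>

lemma commuting_correction_Un:
  assumes A: "commuting_correction \<alpha> \<beta> A" "A \<subseteq> X" and B: "commuting_correction \<alpha> \<beta> B" "B \<subseteq> X"
    and dis: "A \<inter> B = {}"
  shows "commuting_correction \<alpha> \<beta> (A \<union> B)"
proof -
  obtain k k' h where k: "k \<in> alternating_full" "k' \<in> alternating_full" "h \<in> alternating_full"
    and out: "\<And>x. x \<in> X - A \<Longrightarrow> k x = x" "\<And>x. x \<in> X - A \<Longrightarrow> k' x = x" "\<And>x. x \<in> X - A \<Longrightarrow> h x = x"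
    and eq: "\<And>x. x \<in> A \<Longrightarrow> \<alpha> x = k x \<or> \<beta> (h x) = k' (h x)"
    using A(1) unfolding commuting_correction_def by blast
  obtain l l' m where l: "l \<in> alternating_full" "l' \<in> alternating_full" "m \<in> alternating_full"
    and out': "\<And>x. x \<in> X - B \<Longrightarrow> l x = x" "\<And>x. x \<in> X - B \<Longrightarrow> l' x = x" "\<And>x. x \<in> X - B \<Longrightarrow> m x = x"
    and eq': "\<And>x. x \<in> B \<Longrightarrow> \<alpha> x = l x \<or> \<beta> (m x) = l' (m x)"
    using B(1) unfolding commuting_correction_def by blast
  note kf = k[THEN alternating_full_carrier] and lf = l[THEN alternating_full_carrier]
  have mult: "u \<otimes>\<^bsub>full_group\<^esub> v \<in> alternating_full" if "u \<in> alternating_full" "v \<in> alternating_full" for u v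
    using that subgroup.m_closed[OF alternating_full_subgroup] by blast
  have onA: "(u \<otimes>\<^bsub>full_group\<^esub> v) x = u x"
    if "u \<in> full_carrier" "v \<in> full_carrier" "\<And>x. x \<in> X - B \<Longrightarrow> v x = x" "x \<in> A" for u v x
  proof -
    have x: "x \<in> X" "x \<in> X - B" using that(4) A(2) dis by auto
    show ?thesis using full_mult_apply[OF that(1,2) x(1)] that(3)[OF x(2)] by simp
  qed
  have onB: "(u \<otimes>\<^bsub>full_group\<^esub> v) x = v x"
    if "u \<in> full_carrier" "v \<in> full_carrier" "\<And>x. x \<in> X - A \<Longrightarrow> u x = x"
      "\<And>x. x \<in> X - B \<Longrightarrow> v x = x" "x \<in> B" for u v x
  proof -
    have x: "x \<in> X" using that(5) B(2) by auto
    have "v x \<in> B" using full_carrier_preserves[OF that(2,4) B(2) that(5)] .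
    then have "v x \<in> X - A" using B(2) dis by auto
    then show ?thesis using full_mult_apply[OF that(1,2) x] that(3) by simp
  qed
  show ?thesis
    unfolding commuting_correction_def
  proof (rule bexI[OF _ mult[OF k(1) l(1)]], rule bexI[OF _ mult[OF k(2) l(2)]],
      rule bexI[OF _ mult[OF k(3) l(3)]], intro conjI ballI)
    fix x assume x: "x \<in> X - (A \<union> B)"
    then have x': "x \<in> X" "x \<in> X - A" "x \<in> X - B" by auto
    show "(k \<otimes>\<^bsub>full_group\<^esub> l) x = x" "(k' \<otimes>\<^bsub>full_group\<^esub> l') x = x" "(h \<otimes>\<^bsub>full_group\<^esub> m) x = x"
      using full_mult_apply[OF kf(1) lf(1) x'(1)] full_mult_apply[OF kf(2) lf(2) x'(1)]
        full_mult_apply[OF kf(3) lf(3) x'(1)] out[OF x'(2)] out'[OF x'(3)] by simp_all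
  next
    fix x assume "x \<in> A \<union> B"
    then show "\<alpha> x = (k \<otimes>\<^bsub>full_group\<^esub> l) x \<or>
        \<beta> ((h \<otimes>\<^bsub>full_group\<^esub> m) x) = (k' \<otimes>\<^bsub>full_group\<^esub> l') ((h \<otimes>\<^bsub>full_group\<^esub> m) x)"
    proof
      assume x: "x \<in> A"
      have "h x \<in> A" by (rule full_carrier_preserves[OF kf(3) out(3) A(2) x])
      then show ?thesis
        using eq[OF x] onA[OF kf(1) lf(1) out'(1) x] onA[OF kf(3) lf(3) out'(3) x]
          onA[OF kf(2) lf(2) out'(2), of "h x"] by simp
    next
      assume x: "x \<in> B"
      have "m x \<in> B" by (rule full_carrier_preserves[OF lf(3) out'(3) B(2) x])
      then show ?thesis
        using eq'[OF x] onB[OF kf(1) lf(1) out(1) out'(1) x] onB[OF kf(3) lf(3) out(3) out'(3) x]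
          onB[OF kf(2) lf(2) out(2) out'(2), of "m x"] by simp
    qed
  qed
qed

text \<open>The witnesses \<open>k\<close>, \<open>k'\<close> and \<open>h\<close> are the actions
  of \<open>\<sigma>\<close>, \<open>\<sigma>'\<close> and \<open>\<rho>\<close>.\<close>

lemma commuting_correction_levels:
  assumes tw: "tower Y n f" and n: "8 \<le> n" and \<sigma>: "\<sigma> permutes {1..n}" "evenperm \<sigma>"
    and \<sigma>': "\<sigma>' permutes {1..n}" "evenperm \<sigma>'" and \<rho>: "\<rho> permutes {1..n}" "evenperm \<rho>"
    and eq: "\<And>j y. j \<in> {1..n} \<Longrightarrow> y \<in> Y \<Longrightarrow> \<alpha> (f j y) = f (\<sigma> j) y \<or> \<beta> (f (\<rho> j) y) = f (\<sigma>' (\<rho> j)) y"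
  shows "commuting_correction \<alpha> \<beta> (levels Y n f)"
  unfolding commuting_correction_def
proof (rule bexI[OF _ tower_act_even[OF tw \<sigma>]], rule bexI[OF _ tower_act_even[OF tw \<sigma>']],
    rule bexI[OF _ tower_act_even[OF tw \<rho>]], intro conjI ballI)
  fix x assume "x \<in> levels Y n f"
  then obtain j y where jy: "j \<in> {1..n}" "y \<in> Y" "x = f j y" by (auto simp: levels_def)
  have "\<rho> j \<in> {1..n}" using jy permutes_in_image[OF \<rho>(1)] by blast
  then show "\<alpha> x = tower_act Y n f \<sigma> x \<or>
      \<beta> (tower_act Y n f \<rho> x) = tower_act Y n f \<sigma>' (tower_act Y n f \<rho> x)"
    using eq[OF jy(1,2)] jy tower_act_level[OF tw] by simp
qed (auto simp: tower_act_outside)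

lemma commuting_correction_global:
  assumes \<alpha>: "\<alpha> \<in> full_carrier" and \<beta>: "\<beta> \<in> full_carrier"
  shows "commuting_correction \<alpha> \<beta> X"
proof -
  obtain R where R0: "\<forall>x\<in>X. R x \<subseteq> X \<and> x \<in> R x \<and> (\<forall>y\<in>R x. R y = R x)"
    and tow: "\<forall>x\<in>X. \<exists>Y n f. tower Y n f \<and> x \<in> Y \<and> 8 \<le> n \<and>
         (\<forall>y\<in>Y. R y = (\<lambda>j. f j y) ` {1..n}) \<and>
         mostly_permutes \<alpha> Y n f \<and> mostly_permutes \<beta> Y n f"
    using almost_finite_towers[OF \<alpha> \<beta>] by (elim exE conjE)
  have R: "R x \<subseteq> X" "x \<in> R x" "y \<in> R x \<Longrightarrow> R y = R x" if "x \<in> X" for x y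
    using R0 that by blast+
  define \<B> where "\<B> = {W. clopen W \<and> (\<forall>x\<in>W. R x \<subseteq> W)}"
  show ?thesis
  proof (rule compact_space_clopen_induct[where \<B> = \<B> and P = "commuting_correction \<alpha> \<beta>", OF compact_T])
    show "openin T A" if "A \<in> \<B>" for A using that by (simp add: \<B>_def clopenin_def)
    show "X \<in> \<B>" using R(1) by (simp add: \<B>_def clopen_topspace)
    show "A \<union> B \<in> \<B>" if "A \<in> \<B>" "B \<in> \<B>" for A B
      using that by (auto simp: \<B>_def intro: clopen_Un)
    show "A - B \<in> \<B>" if AB: "A \<in> \<B>" "B \<in> \<B>" for A B
    proof -
      have "R x \<subseteq> A - B" if x: "x \<in> A - B" for x
      proof
        fix y assume y: "y \<in> R x"
        have xX: "x \<in> X" using x AB clopen_subset by (auto simp: \<B>_def)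
        have "y \<notin> B"
        proof
          assume "y \<in> B"
          then have "R y \<subseteq> B" using AB by (auto simp: \<B>_def)
          then show False using R(2)[OF xX] R(3)[OF xX y] x by auto
        qed
        then show "y \<in> A - B" using y x AB by (auto simp: \<B>_def)
      qed
      then show ?thesis using AB by (auto simp: \<B>_def intro: clopen_Diff)
    qed
    have one: "\<one>\<^bsub>full_group\<^esub> \<in> alternating_full"
      using alternating_full_subgroup by (rule subgroup.one_closed)
    show "commuting_correction \<alpha> \<beta> {}"
      unfolding commuting_correction_def
      by (rule bexI[OF _ one], rule bexI[OF _ one], rule bexI[OF _ one]) (simp add: full_one_apply)
    show "commuting_correction \<alpha> \<beta> (A \<union> B)"
      if "A \<in> \<B>" "B \<in> \<B>" "A \<inter> B = {}" "commuting_correction \<alpha> \<beta> A" "commuting_correction \<alpha> \<beta> B" for A B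
      using that clopen_subset by (intro commuting_correction_Un) (auto simp: \<B>_def)
  next
    fix x assume xT: "x \<in> topspace T"
    obtain Y n f where tw: "tower Y n f" and x: "x \<in> Y" and n: "8 \<le> n"
      and orb: "\<forall>y\<in>Y. R y = (\<lambda>j. f j y) ` {1..n}"
      and mp: "mostly_permutes \<alpha> Y n f" "mostly_permutes \<beta> Y n f"
      using bspec[OF tow xT] by (elim exE conjE)
    have YX: "Y \<subseteq> X" using clopen_subset[OF tower_clopen[OF tw]] .
    obtain J q where J: "J \<subseteq> {1..n}" "8 * card ({1..n} - J) \<le> n" "inj_on q J" "q ` J \<subseteq> {1..n}"
      and q: "\<And>j y. j \<in> J \<Longrightarrow> y \<in> Y \<Longrightarrow> \<alpha> (f j y) = f (q j) y"
      by (rule mostly_permutesE[OF tw x \<alpha> mp(1)]) blast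
    obtain J' q' where J': "J' \<subseteq> {1..n}" "8 * card ({1..n} - J') \<le> n" "inj_on q' J'" "q' ` J' \<subseteq> {1..n}"
      and q': "\<And>j y. j \<in> J' \<Longrightarrow> y \<in> Y \<Longrightarrow> \<beta> (f j y) = f (q' j) y"
      by (rule mostly_permutesE[OF tw x \<beta> mp(2)]) blast
    obtain \<sigma> \<sigma>' \<rho> where \<sigma>: "\<sigma> permutes {1..n}" "evenperm \<sigma>" and \<sigma>': "\<sigma>' permutes {1..n}" "evenperm \<sigma>'"
      and \<rho>: "\<rho> permutes {1..n}" "evenperm \<rho>"
      and or: "\<And>j. j \<in> {1..n} \<Longrightarrow> (j \<in> J \<and> \<sigma> j = q j) \<or> (\<rho> j \<in> J' \<and> \<sigma>' (\<rho> j) = q' (\<rho> j))"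
      by (rule even_approximations[OF n J J']) blast
    have lev: "levels Y n f = (\<Union>y\<in>Y. R y)"
      using orb by (auto simp: levels_def)
    have "R z \<subseteq> levels Y n f" if z: "z \<in> levels Y n f" for z
    proof -
      obtain y where y: "y \<in> Y" "z \<in> R y" using z lev by blast
      then have "R z = R y" using R(3)[of y z] YX by blast
      then show ?thesis using lev y(1) by blast
    qed
    then have "levels Y n f \<in> \<B>" using levels_clopen[OF tw] by (simp add: \<B>_def)
    moreover have "x \<in> levels Y n f" using R(2)[of x] x YX lev by blast
    moreover have "commuting_correction \<alpha> \<beta> W" if W: "W \<in> \<B>" "W \<subseteq> levels Y n f" for W
    proof -
      have W': "clopen W" "\<And>y. y \<in> W \<Longrightarrow> R y \<subseteq> W" using W by (auto simp: \<B>_def)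
      have tw': "tower (Y \<inter> W) n f"
        using tower_subset[OF tw] clopen_Int tower_clopen[OF tw] W'(1) by simp
      have "levels (Y \<inter> W) n f = (\<Union>y\<in>Y \<inter> W. R y)"
        using orb by (auto simp: levels_def)
      \<comment> \<open>A point \<open>w\<close> of \<open>W\<close> lies in the class of some
        \<open>y\<close> in the base; by symmetry \<open>y\<close> lies in the class of
        \<open>w\<close>, hence in the saturated set \<open>W\<close>.\<close>
      also have "\<dots> = W"
      proof
        show "(\<Union>y\<in>Y \<inter> W. R y) \<subseteq> W" using W' by blast
        show "W \<subseteq> (\<Union>y\<in>Y \<inter> W. R y)"
        proof
          fix w assume w: "w \<in> W"
          then obtain y where y: "y \<in> Y" "w \<in> R y" using W(2) lev by blast
          then have yX: "y \<in> X" using YX by blast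
          have "y \<in> R w" using R(2)[OF yX] R(3)[OF yX y(2)] by simp
          then have "y \<in> W" using W'(2)[OF w] by blast
          then show "w \<in> (\<Union>y\<in>Y \<inter> W. R y)" using y by blast
        qed
      qed
      finally have "levels (Y \<inter> W) n f = W" .
      moreover have "commuting_correction \<alpha> \<beta> (levels (Y \<inter> W) n f)"
      proof (rule commuting_correction_levels[OF tw' n \<sigma> \<sigma>' \<rho>])
        fix j y assume "j \<in> {1..n}" "y \<in> Y \<inter> W"
        then show "\<alpha> (f j y) = f (\<sigma> j) y \<or> \<beta> (f (\<rho> j) y) = f (\<sigma>' (\<rho> j)) y"
          using or[of j] q[of j y] q'[of "\<rho> j" y] by auto
      qed
      ultimately show ?thesis by simp
    qed
    ultimately show "\<exists>Z\<in>\<B>. x \<in> Z \<and> (\<forall>W\<in>\<B>. W \<subseteq> Z \<longrightarrow> commuting_correction \<alpha> \<beta> W)" by blast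
  qed
qed

text \<open>Where \<open>\<alpha>\<close> agrees with \<open>k\<close>, the element
  \<open>?a\<close> fixes the point; where \<open>\<beta>\<close> agrees with \<open>k'\<close> at
  \<open>h x\<close>, the element \<open>?b\<close> fixes \<open>x\<close>. The correction says that
  one of the two always happens, so \<open>?a\<close> and \<open>?b\<close> have disjoint
  supports.\<close>

lemma derived_le_alternating_full:
  "derived full_group (carrier full_group) \<subseteq> alternating_full"
  unfolding derived_def
proof (rule FG.generate_subgroup_incl[OF _ alternating_full_subgroup], clarify)
  fix \<alpha> \<beta> assume "\<alpha> \<in> carrier full_group" "\<beta> \<in> carrier full_group"
  then have \<alpha>: "\<alpha> \<in> full_carrier" and \<beta>: "\<beta> \<in> full_carrier" by (simp_all add: carrier_full_group)
  obtain k k' h where k: "k \<in> alternating_full" "k' \<in> alternating_full" "h \<in> alternating_full"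
    and eq: "\<And>x. x \<in> X \<Longrightarrow> \<alpha> x = k x \<or> \<beta> (h x) = k' (h x)"
    using commuting_correction_global[OF \<alpha> \<beta>] unfolding commuting_correction_def by blast
  note kf = k[THEN alternating_full_carrier]
  note inv_kf = kf[THEN full_inv_closed]
  let ?a = "inv\<^bsub>full_group\<^esub> k \<otimes>\<^bsub>full_group\<^esub> \<alpha>"
  let ?b = "inv\<^bsub>full_group\<^esub> h \<otimes>\<^bsub>full_group\<^esub> (inv\<^bsub>full_group\<^esub> k' \<otimes>\<^bsub>full_group\<^esub> \<beta>) \<otimes>\<^bsub>full_group\<^esub> h"
  have "?a \<otimes>\<^bsub>full_group\<^esub> ?b = ?b \<otimes>\<^bsub>full_group\<^esub> ?a"
  proof (rule disjoint_support_commute)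
    show "?a \<in> full_carrier" "?b \<in> full_carrier" using kf inv_kf \<alpha> \<beta> by (simp_all add: full_mult_closed)
    fix x assume x: "x \<in> X"
    have hx: "h x \<in> X" using full_carrierD(4)[OF kf(3) x] .
    have bhx: "\<beta> (h x) \<in> X" using full_carrierD(4)[OF \<beta> hx] .
    have a: "?a x = (inv\<^bsub>full_group\<^esub> k) (\<alpha> x)" using inv_kf \<alpha> x by (simp add: full_mult_apply)
    have b: "?b x = (inv\<^bsub>full_group\<^esub> h) ((inv\<^bsub>full_group\<^esub> k') (\<beta> (h x)))"
      using kf inv_kf \<beta> x hx by (simp add: full_mult_apply full_mult_closed)
    from eq[OF x] show "?a x = x \<or> ?b x = x"
      using a b full_inv_apply(1)[OF kf(1) x] full_inv_apply(1)[OF kf(2) hx]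
        full_inv_apply(1)[OF kf(3) x] by auto
  qed
  then show "\<alpha> \<otimes>\<^bsub>full_group\<^esub> \<beta> \<otimes>\<^bsub>full_group\<^esub> inv\<^bsub>full_group\<^esub> \<alpha> \<otimes>\<^bsub>full_group\<^esub> inv\<^bsub>full_group\<^esub> \<beta> \<in> alternating_full"
    using k \<alpha> \<beta> by (intro FG.commutator_mem_normal[OF alternating_full_normal]) (auto simp: carrier_full_group)
qed

lemma derived_le_normalized:
  assumes "subgroup N full_group" "N \<noteq> {\<one>\<^bsub>full_group\<^esub>}"
    and "commutator_subgroup full_group \<subseteq> normalizer full_group N"
  shows "commutator_subgroup full_group \<subseteq> N"
  using derived_le_alternating_full
    alternating_full_le_normalized[OF assms(1,2) assms(3)[unfolded commutator_subgroup_def]]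
  unfolding commutator_subgroup_def by (rule subset_trans)

text \<open>A 3-cycle moves a point as soon as the base is nonempty; five levels are taken so that
  perfectness of Alt(5) puts it into the commutator subgroup.\<close>

lemma commutator_subgroup_nontrivial:
  assumes "X \<noteq> {}"
  shows "commutator_subgroup full_group \<noteq> {\<one>\<^bsub>full_group\<^esub>}"
proof -
  obtain x where x: "x \<in> X" using assms by blast
  obtain Y f where tw: "tower Y 5 f" and xY: "x \<in> Y" by (rule tower_exists[OF x])
  define c where "c = cycle_of_list [1, 2, 3::nat]"
  have c3: "c \<in> three_cycles 5" unfolding c_def by (rule CollectI, rule exI[of _ "[1,2,3]"]) auto
  then have c: "c permutes {1..5}" "evenperm c"
    using three_cycles_incl alt_group_carrier by blast+
  have "tower_act Y 5 f c \<in> commutator_subgroup full_group"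
    unfolding commutator_subgroup_def by (rule tower_act_even_derived[OF tw _ c]) simp
  moreover have "tower_act Y 5 f c (f 1 x) = f 2 x"
    using tower_act_level[OF tw _ xY, of 1 c] by (simp add: c_def)
  moreover have "f 1 x \<noteq> f 2 x" "f 1 x \<in> X"
    using tower_unique(1)[OF tw, of 1 2 x x] tower_in_X[OF tw _ xY, of 1] xY by auto
  ultimately show ?thesis using full_one_apply[of "f 1 x"] by auto
qed

lemma simple_commutator_subgroup:
  assumes "X \<noteq> {}"
  shows "is_simple (full_group\<lparr>carrier := commutator_subgroup full_group\<rparr>)"
proof -
  let ?D = "commutator_subgroup full_group"
  let ?H = "full_group\<lparr>carrier := ?D\<rparr>"
  have sub: "subgroup ?D full_group"
    unfolding commutator_subgroup_def by (rule FG.derived_is_subgroup) simp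
  have H: "group ?H" by (rule FG.subgroup_imp_group[OF sub])
  have "N = {\<one>\<^bsub>full_group\<^esub>} \<or> N = ?D" if N: "N \<lhd> ?H" for N
  proof (cases "N = {\<one>\<^bsub>full_group\<^esub>}")
    case False
    have NH: "subgroup N ?H" using N by (rule normal_imp_subgroup)
    have NG: "subgroup N full_group" by (rule FG.incl_subgroup[OF sub NH])
    have ND: "N \<subseteq> ?D" using subgroup.subset[OF NH] by simp
    \<comment> \<open>Normality inside \<open>?D\<close> gives equality of left and right cosets for
      elements of \<open>?D\<close>, which in the big group says that these elements normalize
      \<open>N\<close>.\<close>
    have "?D \<subseteq> normalizer full_group N"
    proof
      fix d assume d: "d \<in> ?D"
      have dc: "d \<in> carrier full_group" using d subgroup.subset[OF sub] by blast
      have Nc: "N \<subseteq> carrier full_group" using subgroup.subset[OF NG] .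
      have cos: "N #>\<^bsub>full_group\<^esub> d = d <#\<^bsub>full_group\<^esub> N"
        using normal.coset_eq[OF N] d by (simp add: r_coset_def l_coset_def)
      have "d <#\<^bsub>full_group\<^esub> N #>\<^bsub>full_group\<^esub> inv\<^bsub>full_group\<^esub> d = N"
        unfolding cos[symmetric] using dc Nc by (simp add: FG.coset_mult_assoc FG.coset_mult_one)
      then show "d \<in> normalizer full_group N"
        using dc Nc by (simp add: normalizer_def stabilizer_def)
    qed
    then have "?D \<subseteq> N" by (rule derived_le_normalized[OF NG False])
    then show ?thesis using ND by blast
  qed simp
  then show ?thesis
    unfolding is_simple_def using H commutator_subgroup_nontrivial[OF assms] by simp
qed

end

section \<open>Compact open bisections\<close>

text \<open>In a compact Hausdorff space quasi-components are components, here points. So every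
  point outside \<open>V\<close> is separated from \<open>x\<close> by a clopen set, and finitely
  many of these suffice by compactness of the complement of \<open>V\<close>.\<close>

lemma compact_Hausdorff_clopen_base:
  assumes comp: "compact_space T" and Haus: "Hausdorff_space T" and td: "totally_disconnected_space T"
    and V: "openin T V" "x \<in> V"
  shows "\<exists>B. (openin T B \<and> closedin T B) \<and> x \<in> B \<and> B \<subseteq> V"
proof -
  have xT: "x \<in> topspace T" using V openin_subset by blast
  have sep: "\<exists>P. closedin T P \<and> openin T P \<and> x \<in> P \<and> y \<notin> P" if y: "y \<in> topspace T" "y \<noteq> x" for y
  proof -
    have "\<not> connected_component_of T x y"
      using td y unfolding totally_disconnected_space_def connected_component_of_def by blast
    moreover have "quasi_component_of T x y = connected_component_of T x y"
      using comp Haus by (simp add: quasi_eq_connected_component_of)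
    ultimately show ?thesis
      using xT y unfolding quasi_component_of by blast
  qed
  then obtain P where P: "\<And>y. y \<in> topspace T \<Longrightarrow> y \<noteq> x \<Longrightarrow>
      closedin T (P y) \<and> openin T (P y) \<and> x \<in> P y \<and> y \<notin> P y"
    by metis
  let ?C = "topspace T - V"
  have "compactin T ?C" using comp V closedin_compact_space by blast
  moreover have "\<forall>U\<in>(\<lambda>y. topspace T - P y) ` ?C. openin T U"
    using P V(2) by (auto intro!: openin_diff)
  moreover have "?C \<subseteq> \<Union> ((\<lambda>y. topspace T - P y) ` ?C)"
    using P V(2) by fastforce
  ultimately obtain \<F> where "finite \<F>" "\<F> \<subseteq> (\<lambda>y. topspace T - P y) ` ?C" "?C \<subseteq> \<Union>\<F>"
    unfolding compactin_def by meson
  then obtain F where F: "finite F" "F \<subseteq> ?C" "?C \<subseteq> (\<Union>y\<in>F. topspace T - P y)"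
    using finite_subset_image[of \<F> "\<lambda>y. topspace T - P y" ?C] by metis
  have PF: "closedin T (P y) \<and> openin T (P y) \<and> x \<in> P y" if "y \<in> F" for y
  proof -
    have "y \<in> topspace T" "y \<noteq> x" using that F(2) V(2) by auto
    then show ?thesis using P by blast
  qed
  let ?B = "topspace T \<inter> (\<Inter>y\<in>F. P y)"
  have "openin T ?B \<and> closedin T ?B"
    using F(1) PF
  proof (induction F rule: finite_induct)
    case (insert y F)
    have "topspace T \<inter> (\<Inter>z\<in>insert y F. P z) = P y \<inter> (topspace T \<inter> (\<Inter>z\<in>F. P z))" by auto
    then show ?case using insert by auto
  qed simp
  moreover have "x \<in> ?B" using PF xT by auto
  moreover have "?B \<subseteq> V" using F(3) by auto
  ultimately show ?thesis by blast
qed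

section \<open>Arrow calculus and continuity of the structure maps\<close>

context algebraic_groupoid
begin

lemma gunits_arrows: "x \<in> gunits G \<Longrightarrow> x \<in> arrows G"
  using src_closed by (auto simp: gunits_def)

lemma src_unit: "x \<in> gunits G \<Longrightarrow> gsrc G x = x"
  and rng_unit: "x \<in> gunits G \<Longrightarrow> grng G x = x"
  using src_src rng_src by (auto simp: gunits_def)

lemma src_gunits: "g \<in> arrows G \<Longrightarrow> gsrc G g \<in> gunits G"
  by (simp add: gunits_def)

lemma rng_gunits: "g \<in> arrows G \<Longrightarrow> grng G g \<in> gunits G"
  using src_rng[of g] src_gunits[of "grng G g"] rng_closed[of g] by simp

lemma composableI: "g \<in> arrows G \<Longrightarrow> h \<in> arrows G \<Longrightarrow> gsrc G g = grng G h \<Longrightarrow> (g, h) \<in> composable G"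
  by (simp add: composable_def)

lemma mult_src: "g \<in> arrows G \<Longrightarrow> h \<in> arrows G \<Longrightarrow> gsrc G g = grng G h \<Longrightarrow> gsrc G (gmult G g h) = gsrc G h"
  and mult_rng: "g \<in> arrows G \<Longrightarrow> h \<in> arrows G \<Longrightarrow> gsrc G g = grng G h \<Longrightarrow> grng G (gmult G g h) = grng G g"
  and mult_arrows: "g \<in> arrows G \<Longrightarrow> h \<in> arrows G \<Longrightarrow> gsrc G g = grng G h \<Longrightarrow> gmult G g h \<in> arrows G"
  using src_mult rng_mult mult_closed composableI by auto

lemma mult_inv_cancel_right:
  assumes "v \<in> arrows G" "u \<in> arrows G" "gsrc G v = grng G u"
  shows "gmult G (gmult G v u) (ginv G u) = v"
proof -
  have "gmult G (gmult G v u) (ginv G u) = gmult G v (gmult G u (ginv G u))"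
    using assms inv_closed rng_inv by (intro mult_assoc composableI) auto
  then show ?thesis using assms by (metis inv_right src_right_unit)
qed

lemma mult_cancel_inv_right:
  assumes "v \<in> arrows G" "u \<in> arrows G" "gsrc G v = gsrc G u"
  shows "gmult G (gmult G v (ginv G u)) u = v"
proof -
  have "gmult G (gmult G v (ginv G u)) u = gmult G v (gmult G (ginv G u) u)"
    using assms inv_closed rng_inv src_inv by (intro mult_assoc composableI) auto
  then show ?thesis using assms by (metis inv_left src_right_unit)
qed

text \<open>Obtained by multiplying the double inverse with the unit g^-1 g and reassociating, since
  uniqueness of inverses is not among the axioms.\<close>

lemma inv_inv:
  assumes g: "g \<in> arrows G"
  shows "ginv G (ginv G g) = g"
proof -
  let ?h = "ginv G g" let ?k = "ginv G ?h"
  have h: "?h \<in> arrows G" and k: "?k \<in> arrows G" using g inv_closed by auto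
  have "?k = gmult G (gmult G ?k ?h) g"
  proof -
    have "gmult G (gmult G ?k ?h) g = gmult G ?k (gmult G ?h g)"
      using g h k src_inv by (intro mult_assoc composableI) auto
    also have "gmult G ?h g = gsrc G ?k" using g h inv_left src_inv rng_inv by simp
    finally show ?thesis using src_right_unit[OF k] by simp
  qed
  also have "gmult G ?k ?h = grng G g" using h g inv_left src_inv by simp
  finally show ?thesis using rng_left_unit[OF g] by simp
qed

lemma inv_image_mem: "U \<subseteq> arrows G \<Longrightarrow> ginv G ` U = {g \<in> arrows G. ginv G g \<in> U}"
  using inv_inv inv_closed by (force simp: image_iff)

end

context topological_groupoid
begin

lemma continuous_mult_comp:
  assumes f: "continuous_map Z (gtop G) f" and g: "continuous_map Z (gtop G) g"
    and c: "\<And>z. z \<in> topspace Z \<Longrightarrow> (f z, g z) \<in> composable G"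
  shows "continuous_map Z (gtop G) (\<lambda>z. gmult G (f z) (g z))"
proof -
  have "continuous_map Z (subtopology (prod_topology (gtop G) (gtop G)) (composable G)) (\<lambda>z. (f z, g z))"
    using continuous_map_pairedI[OF f g] c by (simp add: continuous_map_in_subtopology)
  from continuous_map_compose[OF this continuous_mult] show ?thesis
    by (simp add: o_def)
qed

lemma continuous_src: "continuous_map (gtop G) (gtop G) (gsrc G)"
proof (rule continuous_map_eq)
  show "continuous_map (gtop G) (gtop G) (\<lambda>g. gmult G (ginv G g) g)"
  proof (rule continuous_mult_comp[OF continuous_inv])
    show "continuous_map (gtop G) (gtop G) (\<lambda>g. g)" using continuous_map_id by (simp add: id_def)
  qed (auto simp: arrows_def[symmetric] intro: composableI inv_closed src_inv)
qed (simp add: arrows_def[symmetric] inv_left)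

lemma continuous_rng: "continuous_map (gtop G) (gtop G) (grng G)"
proof (rule continuous_map_eq)
  show "continuous_map (gtop G) (gtop G) (\<lambda>g. gmult G g (ginv G g))"
  proof (rule continuous_mult_comp[OF _ continuous_inv])
    show "continuous_map (gtop G) (gtop G) (\<lambda>g. g)" using continuous_map_id by (simp add: id_def)
  qed (auto simp: arrows_def[symmetric] intro: composableI inv_closed simp: rng_inv)
qed (simp add: arrows_def[symmetric] inv_right)

lemma topspace_unit_space: "topspace (unit_space G) = gunits G"
  using gunits_arrows by (auto simp: unit_space_def arrows_def)

lemma continuous_src_unit: "continuous_map (gtop G) (unit_space G) (gsrc G)"
  and continuous_rng_unit: "continuous_map (gtop G) (unit_space G) (grng G)"
  unfolding unit_space_def
  using continuous_src continuous_rng src_gunits rng_gunits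
  by (auto simp: continuous_map_in_subtopology arrows_def)

lemma openin_inv_image: "openin (gtop G) W \<Longrightarrow> openin (gtop G) (ginv G ` W)"
  using openin_continuous_map_preimage[OF continuous_inv, of W] openin_subset[of "gtop G" W]
  by (simp add: inv_image_mem arrows_def)

end

definition compact_open_bisection :: "'a top_groupoid \<Rightarrow> 'a set \<Rightarrow> bool" where
  "compact_open_bisection G U \<longleftrightarrow> G_set G U \<and> compactin (gtop G) U \<and> openin (gtop G) U"

text \<open>On \<open>A\<close> the function \<open>f\<close> is the map \<pi>_U of a compact open
  bisection with source \<open>A\<close>; its values elsewhere are left free. This is the instance
  of \<open>loc\<close>.\<close>

definition bisection_map_on :: "'a top_groupoid \<Rightarrow> 'a set \<Rightarrow> ('a \<Rightarrow> 'a) \<Rightarrow> bool" where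
  "bisection_map_on G A f \<longleftrightarrow>
     (\<exists>U. compact_open_bisection G U \<and> gsrc G ` U = A \<and> (\<forall>u\<in>U. f (gsrc G u) = grng G u))"

section \<open>Calculus of compact open bisections over a Cantor unit space\<close>

locale cantor_groupoid = etale_groupoid +
  assumes cantor: "cantor_set (unit_space G)"
begin

abbreviation "X \<equiv> gunits G"
abbreviation "T \<equiv> unit_space G"
abbreviation "bis \<equiv> compact_open_bisection G"

lemma compact_unit_space: "compact_space T"
  using cantor by (simp add: cantor_set_def)

lemma Hausdorff_unit_space: "Hausdorff_space T"
  using cantor by (simp add: cantor_set_def metrizable_imp_Hausdorff_space)

lemma clopen_base_unit_space:
  "openin T V \<Longrightarrow> x \<in> V \<Longrightarrow> \<exists>B. (openin T B \<and> closedin T B) \<and> x \<in> B \<and> B \<subseteq> V"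
  using cantor compact_Hausdorff_clopen_base[OF compact_unit_space Hausdorff_unit_space]
  by (simp add: cantor_set_def)

lemma bisD:
  assumes "bis U"
  shows "U \<subseteq> arrows G" "inj_on (grng G) U" "inj_on (gsrc G) U" "compactin (gtop G) U" "openin (gtop G) U"
    "u \<in> U \<Longrightarrow> u \<in> arrows G"
  using assms by (auto simp: compact_open_bisection_def G_set_def)

lemma rng_local:
  assumes "g \<in> arrows G"
  obtains U where "openin (gtop G) U" "g \<in> U" "openin T (grng G ` U)" "inj_on (grng G) U"
    "homeomorphic_map (subtopology (gtop G) U) (subtopology T (grng G ` U)) (grng G)"
proof -
  obtain U where U: "openin (gtop G) U" "g \<in> U" "openin T (grng G ` U)"
    "homeomorphic_map (subtopology (gtop G) U) (subtopology T (grng G ` U)) (grng G)"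
    using local_homeomorphism_rng assms unfolding local_homeomorphism_map_def arrows_def by blast
  have "topspace (subtopology (gtop G) U) = U" using U(1) openin_subset by fastforce
  then have "inj_on (grng G) U" using homeomorphic_imp_injective_map[OF U(4)] by simp
  then show thesis using that U by blast
qed

lemma openin_rng_image:
  assumes W: "openin (gtop G) W"
  shows "openin T (grng G ` W)"
proof (subst openin_subopen, intro ballI)
  fix y assume "y \<in> grng G ` W"
  then obtain g where g: "g \<in> W" "y = grng G g" by blast
  have gA: "g \<in> arrows G" using g W openin_subset by (fastforce simp: arrows_def)
  obtain U where U: "openin (gtop G) U" "g \<in> U" "openin T (grng G ` U)" "inj_on (grng G) U"
    "homeomorphic_map (subtopology (gtop G) U) (subtopology T (grng G ` U)) (grng G)"
    by (rule rng_local[OF gA])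
  have "openin (subtopology (gtop G) U) (W \<inter> U)" using W by (auto simp: openin_subtopology)
  then have "openin (subtopology T (grng G ` U)) (grng G ` (W \<inter> U))"
    using homeomorphic_imp_open_map[OF U(5)] by (simp add: open_map_def)
  then have "openin T (grng G ` (W \<inter> U))" using U(3) openin_trans_full by blast
  then show "\<exists>S. openin T S \<and> y \<in> S \<and> S \<subseteq> grng G ` W" using g U by blast
qed

lemma src_image_inv: "W \<subseteq> arrows G \<Longrightarrow> gsrc G ` W = grng G ` (ginv G ` W)"
  using rng_inv by (force simp: image_iff)

lemma openin_src_image: "openin (gtop G) W \<Longrightarrow> openin T (gsrc G ` W)"
  using openin_rng_image[OF openin_inv_image] src_image_inv openin_subset
  by (metis arrows_def)

text \<open>Near a unit the range map is injective on some open \<open>U\<close>. If both g and r(g)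
  lie in \<open>U\<close>, then r(r(g)) = r(g) forces g = r(g), so g is a unit.\<close>

lemma openin_gunits: "openin (gtop G) X"
proof (subst openin_subopen, intro ballI)
  fix x assume x: "x \<in> X"
  obtain U where U: "openin (gtop G) U" "x \<in> U" "inj_on (grng G) U"
    by (rule rng_local[OF gunits_arrows[OF x]])
  let ?S = "U \<inter> {g \<in> topspace (gtop G). grng G g \<in> U}"
  have "openin (gtop G) ?S"
    using U openin_continuous_map_preimage[OF continuous_rng] by blast
  moreover have "x \<in> ?S" using U x gunits_arrows rng_unit by (auto simp: arrows_def)
  moreover have "?S \<subseteq> X"
  proof
    fix g assume g: "g \<in> ?S"
    then have gA: "g \<in> arrows G" by (auto simp: arrows_def)
    have "grng G (grng G g) = grng G g" by (rule rng_rng[OF gA])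
    then have "grng G g = g" using U(3) g by (auto dest: inj_onD)
    then show "g \<in> X" using rng_gunits[OF gA] by simp
  qed
  ultimately show "\<exists>S. openin (gtop G) S \<and> x \<in> S \<and> S \<subseteq> X" by blast
qed

lemma openin_unit_space_iff: "openin T A \<longleftrightarrow> openin (gtop G) A \<and> A \<subseteq> X"
  unfolding unit_space_def by (rule openin_open_subtopology[OF openin_gunits])

lemma compactin_unit_space_iff: "compactin T A \<longleftrightarrow> compactin (gtop G) A \<and> A \<subseteq> X"
  unfolding unit_space_def by (rule compactin_subtopology)

lemma bis_src_preimage:
  assumes U: "bis U" and V: "openin T V" "closedin T V"
  shows "bis {u \<in> U. gsrc G u \<in> V}"
proof -
  have eq: "{u \<in> U. gsrc G u \<in> V} = {g \<in> topspace (gtop G). gsrc G g \<in> V} \<inter> U"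
    using bisD(1)[OF U] by (auto simp: arrows_def)
  have "openin (gtop G) ({g \<in> topspace (gtop G). gsrc G g \<in> V} \<inter> U)"
    using openin_continuous_map_preimage[OF continuous_src_unit V(1)] bisD(5)[OF U] by blast
  moreover have "compactin (gtop G) ({g \<in> topspace (gtop G). gsrc G g \<in> V} \<inter> U)"
    using closedin_continuous_map_preimage[OF continuous_src_unit V(2)] bisD(4)[OF U]
    by (rule closed_Int_compactin)
  ultimately show ?thesis
    using bisD(1,2,3)[OF U] unfolding compact_open_bisection_def G_set_def
    by (auto simp flip: eq intro: inj_on_subset)
qed

lemma bis_rng_preimage:
  assumes U: "bis U" and V: "openin T V" "closedin T V"
  shows "bis {u \<in> U. grng G u \<in> V}"
proof -
  have eq: "{u \<in> U. grng G u \<in> V} = {g \<in> topspace (gtop G). grng G g \<in> V} \<inter> U"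
    using bisD(1)[OF U] by (auto simp: arrows_def)
  have "openin (gtop G) ({g \<in> topspace (gtop G). grng G g \<in> V} \<inter> U)"
    using openin_continuous_map_preimage[OF continuous_rng_unit V(1)] bisD(5)[OF U] by blast
  moreover have "compactin (gtop G) ({g \<in> topspace (gtop G). grng G g \<in> V} \<inter> U)"
    using closedin_continuous_map_preimage[OF continuous_rng_unit V(2)] bisD(4)[OF U]
    by (rule closed_Int_compactin)
  ultimately show ?thesis
    using bisD(1,2,3)[OF U] unfolding compact_open_bisection_def G_set_def
    by (auto simp flip: eq intro: inj_on_subset)
qed

lemma bis_Int_clopen:
  assumes U: "bis U" and K: "compactin (gtop G) K" "openin (gtop G) K"
  shows "bis (U \<inter> K)"
proof -
  have "compactin (gtop G) (U \<inter> K)"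
    using compactin_imp_closedin[OF Hausdorff_gtop bisD(4)[OF U]] K(1) by (rule closed_Int_compactin)
  then show ?thesis
    using bisD(1,2,3,5)[OF U] K(2) unfolding compact_open_bisection_def G_set_def
    by (auto intro: inj_on_subset)
qed

lemma bis_src_clopen: "bis U \<Longrightarrow> openin T (gsrc G ` U) \<and> closedin T (gsrc G ` U)"
  using openin_src_image bisD(4,5) image_compactin[OF _ continuous_src_unit]
    compactin_imp_closedin[OF Hausdorff_unit_space] by blast

lemma bis_rng_clopen: "bis U \<Longrightarrow> openin T (grng G ` U) \<and> closedin T (grng G ` U)"
  using openin_rng_image bisD(4,5) image_compactin[OF _ continuous_rng_unit]
    compactin_imp_closedin[OF Hausdorff_unit_space] by blast

lemma bis_inv:
  assumes U: "bis U"
  shows "bis (ginv G ` U)" "gsrc G ` (ginv G ` U) = grng G ` U" "grng G ` (ginv G ` U) = gsrc G ` U"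
proof -
  note D = bisD[OF U]
  have "G_set G (ginv G ` U)"
    unfolding G_set_def
  proof (intro conjI inj_onI)
    show "ginv G ` U \<subseteq> arrows G" using D(1) inv_closed by blast
    fix g h assume gh: "g \<in> ginv G ` U" "h \<in> ginv G ` U"
    then obtain u v where uv: "u \<in> U" "v \<in> U" "g = ginv G u" "h = ginv G v" by blast
    show "g = h" if "grng G g = grng G h"
      using that uv D(6) rng_inv inj_onD[OF D(3)] by metis
    show "g = h" if "gsrc G g = gsrc G h"
      using that uv D(6) src_inv inj_onD[OF D(2)] by metis
  qed
  then show "bis (ginv G ` U)"
    using image_compactin[OF D(4) continuous_inv] openin_inv_image[OF D(5)]
    by (simp add: compact_open_bisection_def)
  show "gsrc G ` (ginv G ` U) = grng G ` U" "grng G ` (ginv G ` U) = gsrc G ` U"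
    using D(6) src_inv rng_inv by (force simp: image_image)+
qed

lemma bis_Un:
  assumes U: "bis U" and V: "bis V"
    and s: "gsrc G ` U \<inter> gsrc G ` V = {}" and r: "grng G ` U \<inter> grng G ` V = {}"
  shows "bis (U \<union> V)"
proof -
  have "inj_on (gsrc G) (U \<union> V)" "inj_on (grng G) (U \<union> V)"
    using bisD(2,3)[OF U] bisD(2,3)[OF V] s r by (auto simp: inj_on_Un)
  then show ?thesis
    using bisD(1,4,5)[OF U] bisD(1,4,5)[OF V]
    by (simp add: compact_open_bisection_def G_set_def compactin_Un openin_Un)
qed

lemma bis_clopen_units:
  assumes "openin T A" "closedin T A"
  shows "bis A" "gsrc G ` A = A"
proof -
  have A: "A \<subseteq> X" using assms(1) by (simp add: openin_unit_space_iff)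
  have "inj_on (gsrc G) A" "inj_on (grng G) A"
    using A src_unit rng_unit by (metis inj_onI subsetD)+
  moreover have "compactin (gtop G) A"
    using closedin_compact_space[OF compact_unit_space assms(2)] by (simp add: compactin_unit_space_iff)
  ultimately show "bis A"
    using assms(1) A gunits_arrows
    by (auto simp: compact_open_bisection_def G_set_def openin_unit_space_iff)
  show "gsrc G ` A = A" using A src_unit by force
qed

text \<open>Injectivity of the range map near the inverse of \<open>g\<close> is injectivity of the
  source map near \<open>g\<close>. Compactness is gained by pulling back a clopen set of units
  along the local homeomorphism \<open>grng G\<close>.\<close>

lemma bis_exists:
  assumes g: "g \<in> O'" and O': "openin (gtop G) O'"
  obtains U where "bis U" "g \<in> U" "U \<subseteq> O'"
proof -
  have gA: "g \<in> arrows G" using g O' openin_subset by (fastforce simp: arrows_def)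
  obtain U where U: "openin (gtop G) U" "g \<in> U" "inj_on (grng G) U"
    "homeomorphic_map (subtopology (gtop G) U) (subtopology T (grng G ` U)) (grng G)"
    by (rule rng_local[OF gA])
  obtain W where W: "openin (gtop G) W" "ginv G g \<in> W" "inj_on (grng G) W"
    by (rule rng_local[OF inv_closed[OF gA]])
  let ?W = "{h \<in> topspace (gtop G). ginv G h \<in> W}"
  let ?V = "U \<inter> ?W \<inter> O'"
  have Vopen: "openin (gtop G) ?V"
    using U(1) openin_continuous_map_preimage[OF continuous_inv W(1)] O' by blast
  have gV: "g \<in> ?V" using U g W gA by (auto simp: arrows_def)
  have injs: "inj_on (gsrc G) ?V"
  proof (rule inj_onI)
    fix h k assume hk: "h \<in> ?V" "k \<in> ?V" "gsrc G h = gsrc G k"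
    then have A: "h \<in> arrows G" "k \<in> arrows G" by (auto simp: arrows_def)
    have "ginv G h = ginv G k"
      by (rule inj_onD[OF W(3)]) (use hk A rng_inv in auto)
    then show "h = k" using A inv_inv by metis
  qed
  obtain B where B: "openin T B" "closedin T B" "grng G g \<in> B" "B \<subseteq> grng G ` ?V"
    using clopen_base_unit_space[OF openin_rng_image[OF Vopen], of "grng G g"] gV by blast
  let ?U = "{h \<in> topspace (gtop G). grng G h \<in> B} \<inter> ?V"
  have op: "openin (gtop G) ?U"
    using openin_continuous_map_preimage[OF continuous_rng_unit B(1)] Vopen by blast
  have img: "grng G ` ?U = B" using B(4) by auto
  have "compactin (subtopology T (grng G ` U)) (grng G ` ?U)"
    unfolding compactin_subtopology img using closedin_compact_space[OF compact_unit_space B(2)] B(4) by auto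
  then have "compactin (subtopology (gtop G) U) ?U"
    using homeomorphic_map_compactness[OF U(4), of ?U] by auto
  then have "compactin (gtop G) ?U" by (simp add: compactin_subtopology)
  then have "bis ?U"
    using op U(3) injs unfolding compact_open_bisection_def G_set_def
    by (auto simp: arrows_def intro: inj_on_subset)
  then show thesis using that gV B(3) gA by (auto simp: arrows_def)
qed

text \<open>The source map is open, and openness on subsets of \<open>U\<close> is continuity of its
  inverse.\<close>

lemma bis_section_continuous:
  assumes U: "bis U"
  shows "continuous_map (subtopology T (gsrc G ` U)) (gtop G) (the_inv_into U (gsrc G))"
  unfolding continuous_map_def
proof (intro conjI allI impI)
  have top: "topspace (subtopology T (gsrc G ` U)) = gsrc G ` U"
    using bis_src_clopen[OF U] openin_subset by fastforce
  have sec: "the_inv_into U (gsrc G) (gsrc G u) = u" if "u \<in> U" for u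
    using the_inv_into_f_f[OF bisD(3)[OF U] that] .
  show "the_inv_into U (gsrc G) \<in> topspace (subtopology T (gsrc G ` U)) \<rightarrow> topspace (gtop G)"
    unfolding top using sec bisD(6)[OF U] by (auto simp: arrows_def)
  fix W assume W: "openin (gtop G) W"
  have "{x \<in> topspace (subtopology T (gsrc G ` U)). the_inv_into U (gsrc G) x \<in> W} = gsrc G ` (U \<inter> W)"
    unfolding top using sec by force
  moreover have "openin T (gsrc G ` (U \<inter> W))"
    using openin_src_image bisD(5)[OF U] W by blast
  ultimately show "openin (subtopology T (gsrc G ` U))
      {x \<in> topspace (subtopology T (gsrc G ` U)). the_inv_into U (gsrc G) x \<in> W}"
    using bis_src_clopen[OF U] by (simp add: openin_open_subtopology image_mono)
qed

text \<open>Compactness: the product is the continuous image of the composable part of V x U, which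
  is closed in a compact set. Openness: an arrow g with source in s(U) lies in the product exactly
  when g u^-1 lies in \<open>V\<close>, where u is the arrow of \<open>U\<close> with the same
  source, and u depends continuously on g.\<close>

lemma bis_mult:
  assumes U: "bis U" and V: "bis V" and match: "gsrc G ` V = grng G ` U"
  shows "bis (set_gmult G V U)" "gsrc G ` set_gmult G V U = gsrc G ` U"
proof -
  note DU = bisD[OF U] and DV = bisD[OF V]
  let ?W = "set_gmult G V U"
  have mem: "?W = {gmult G v u | v u. v \<in> V \<and> u \<in> U \<and> gsrc G v = grng G u}"
    by (simp add: set_gmult_def)
  have elim: "\<exists>v u. v \<in> V \<and> u \<in> U \<and> v \<in> arrows G \<and> u \<in> arrows G \<and> gsrc G v = grng G u \<and> w = gmult G v u \<and>
      w \<in> arrows G \<and> gsrc G w = gsrc G u \<and> grng G w = grng G v" if "w \<in> ?W" for w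
    using that DU(6) DV(6) mult_src mult_rng mult_arrows unfolding mem by blast
  have gs: "G_set G ?W"
    unfolding G_set_def
  proof (intro conjI inj_onI)
    show "?W \<subseteq> arrows G" using elim by blast
    fix w w' assume mem: "w \<in> ?W" "w' \<in> ?W"
    obtain v u where w: "v \<in> V" "u \<in> U" "gsrc G v = grng G u" "w = gmult G v u"
        "gsrc G w = gsrc G u" "grng G w = grng G v"
      using elim[OF mem(1)] by (elim exE conjE) blast
    obtain v' u' where w': "v' \<in> V" "u' \<in> U" "gsrc G v' = grng G u'" "w' = gmult G v' u'"
        "gsrc G w' = gsrc G u'" "grng G w' = grng G v'"
      using elim[OF mem(2)] by (elim exE conjE) blast
    show "w = w'" if "grng G w = grng G w'"
    proof -
      have "v = v'" using inj_onD[OF DV(2)] that w w' by simp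
      then have "u = u'" using inj_onD[OF DU(2)] w w' by simp
      then show ?thesis using \<open>v = v'\<close> w w' by simp
    qed
    show "w = w'" if "gsrc G w = gsrc G w'"
    proof -
      have "u = u'" using inj_onD[OF DU(3)] that w w' by simp
      then have "v = v'" using inj_onD[OF DV(3)] w w' by simp
      then show ?thesis using \<open>u = u'\<close> w w' by simp
    qed
  qed
  show srcW: "gsrc G ` ?W = gsrc G ` U"
  proof
    show "gsrc G ` ?W \<subseteq> gsrc G ` U" using elim by force
    show "gsrc G ` U \<subseteq> gsrc G ` ?W"
    proof
      fix x assume "x \<in> gsrc G ` U"
      then obtain u where u: "u \<in> U" "x = gsrc G u" by blast
      then obtain v where v: "v \<in> V" "gsrc G v = grng G u" using match by (metis imageE imageI)
      then have "gmult G v u \<in> ?W" unfolding mem using u by blast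
      moreover have "gsrc G (gmult G v u) = x" using mult_src[OF DV(6)[OF v(1)] DU(6)[OF u(1)] v(2)] u by simp
      ultimately show "x \<in> gsrc G ` ?W" by blast
    qed
  qed
  have comp: "compactin (gtop G) ?W"
  proof -
    let ?P = "prod_topology (gtop G) (gtop G)"
    have "closedin ?P {p \<in> topspace ?P. (gsrc G \<circ> fst) p = (grng G \<circ> snd) p}"
      by (rule closedin_continuous_maps_eq[OF Hausdorff_gtop
            continuous_map_compose[OF continuous_map_fst continuous_src]
            continuous_map_compose[OF continuous_map_snd continuous_rng]])
    moreover have "{p \<in> topspace ?P. (gsrc G \<circ> fst) p = (grng G \<circ> snd) p} = composable G"
      by (auto simp: composable_def arrows_def)
    ultimately have "compactin ?P (composable G \<inter> (V \<times> U))"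
      using DU(4) DV(4) by (intro closed_Int_compactin) (simp_all add: compactin_Times)
    then have "compactin (subtopology ?P (composable G)) (composable G \<inter> (V \<times> U))"
      by (simp add: compactin_subtopology)
    from image_compactin[OF this continuous_mult]
    have "compactin (gtop G) ((\<lambda>(g, h). gmult G g h) ` (composable G \<inter> (V \<times> U)))" .
    moreover have "(\<lambda>(g, h). gmult G g h) ` (composable G \<inter> (V \<times> U)) = ?W"
      unfolding mem using DU(6) DV(6) by (force simp: composable_def)
    ultimately show ?thesis by simp
  qed
  have "openin (gtop G) ?W"
  proof -
    let ?O = "{g \<in> topspace (gtop G). gsrc G g \<in> gsrc G ` U}"
    have O: "openin (gtop G) ?O"
      using openin_continuous_map_preimage[OF continuous_src_unit] bis_src_clopen[OF U] by blast
    let ?Z = "subtopology (gtop G) ?O"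
    let ?sec = "the_inv_into U (gsrc G)"
    have sec: "?sec (gsrc G u) = u" if "u \<in> U" for u
      using the_inv_into_f_f[OF DU(3) that] .
    have topZ: "topspace ?Z = ?O" by auto
    have "continuous_map ?Z (subtopology T (gsrc G ` U)) (gsrc G)"
      using continuous_map_from_subtopology[OF continuous_src_unit]
      by (auto simp: continuous_map_in_subtopology)
    from continuous_map_compose[OF continuous_map_compose[OF this bis_section_continuous[OF U]] continuous_inv]
    have c1: "continuous_map ?Z (gtop G) (\<lambda>g. ginv G (?sec (gsrc G g)))" by (simp add: o_def)
    have c2: "continuous_map ?Z (gtop G) (\<lambda>g. gmult G g (ginv G (?sec (gsrc G g))))"
    proof (rule continuous_mult_comp[OF _ c1])
      show "continuous_map ?Z (gtop G) (\<lambda>g. g)"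
        using continuous_map_from_subtopology[OF continuous_map_id] by (simp add: id_def)
      fix g assume "g \<in> topspace ?Z"
      then obtain u where u: "g \<in> arrows G" "u \<in> U" "gsrc G g = gsrc G u" unfolding topZ by (auto simp: arrows_def)
      then show "(g, ginv G (?sec (gsrc G g))) \<in> composable G"
        using sec DU(6) inv_closed rng_inv by (intro composableI) auto
    qed
    have "openin ?Z {g \<in> topspace ?Z. gmult G g (ginv G (?sec (gsrc G g))) \<in> V}"
      by (rule openin_continuous_map_preimage[OF c2 DV(5)])
    then have "openin (gtop G) {g \<in> ?O. gmult G g (ginv G (?sec (gsrc G g))) \<in> V}"
      unfolding topZ using openin_trans_full[OF _ O] by blast
    moreover have "{g \<in> ?O. gmult G g (ginv G (?sec (gsrc G g))) \<in> V} = ?W"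
    proof (intro subset_antisym subsetI)
      fix g assume "g \<in> {g \<in> ?O. gmult G g (ginv G (?sec (gsrc G g))) \<in> V}"
      then obtain u where u: "g \<in> arrows G" "u \<in> U" "gsrc G g = gsrc G u"
        and gV: "gmult G g (ginv G (?sec (gsrc G g))) \<in> V" by (auto simp: arrows_def)
      have uA: "u \<in> arrows G" using DU(6) u by blast
      have v: "gmult G g (ginv G u) \<in> V" using gV sec[OF u(2)] u(3) by simp
      have "gsrc G (gmult G g (ginv G u)) = gsrc G (ginv G u)"
        by (rule mult_src) (use u uA inv_closed rng_inv in auto)
      also have "\<dots> = grng G u" by (rule src_inv[OF uA])
      finally have sv: "gsrc G (gmult G g (ginv G u)) = grng G u" .
      have "gmult G (gmult G g (ginv G u)) u \<in> ?W" unfolding mem using v sv u(2) by blast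
      moreover have "gmult G (gmult G g (ginv G u)) u = g"
        by (rule mult_cancel_inv_right) (use u uA in auto)
      ultimately show "g \<in> ?W" by simp
    next
      fix w assume mem_w: "w \<in> ?W"
      obtain v u where w: "v \<in> V" "u \<in> U" "v \<in> arrows G" "u \<in> arrows G" "gsrc G v = grng G u"
        "w = gmult G v u" "w \<in> arrows G" "gsrc G w = gsrc G u"
        using elim[OF mem_w] by (elim exE conjE) blast
      have "gmult G w (ginv G (?sec (gsrc G w))) = v"
        using w sec mult_inv_cancel_right by simp
      then show "w \<in> {g \<in> ?O. gmult G g (ginv G (?sec (gsrc G g))) \<in> V}"
        using w by (auto simp: arrows_def)
    qed
    ultimately show ?thesis by simp
  qed
  with gs comp show "bis ?W" by (simp add: compact_open_bisection_def)
qed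

end

context cantor_groupoid
begin

section \<open>Maps induced by bisections form an ample pseudogroup with full group [[G]]\<close>

lemma bisection_map_onE:
  assumes "bisection_map_on G A f"
  obtains U where "bis U" "gsrc G ` U = A" "\<And>u. u \<in> U \<Longrightarrow> f (gsrc G u) = grng G u" "f ` A = grng G ` U"
proof -
  obtain U where U: "bis U" "gsrc G ` U = A" "\<forall>u\<in>U. f (gsrc G u) = grng G u"
    using assms unfolding bisection_map_on_def by blast
  moreover have "f ` A = grng G ` U" unfolding U(2)[symmetric] using U(3) by (force simp: image_image)
  ultimately show thesis using that by blast
qed

lemma bisection_map_onI:
  "bis U \<Longrightarrow> gsrc G ` U = A \<Longrightarrow> (\<And>u. u \<in> U \<Longrightarrow> f (gsrc G u) = grng G u) \<Longrightarrow> bisection_map_on G A f"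
  unfolding bisection_map_on_def by blast

lemma bisection_map_on_inj:
  assumes "bisection_map_on G A f"
  shows "inj_on f A"
proof -
  obtain U where U: "bis U" "gsrc G ` U = A" "\<And>u. u \<in> U \<Longrightarrow> f (gsrc G u) = grng G u"
    by (rule bisection_map_onE[OF assms]) blast
  show ?thesis
  proof (rule inj_onI)
    fix x y assume "x \<in> A" "y \<in> A" and eq: "f x = f y"
    then obtain u v where uv: "u \<in> U" "v \<in> U" "x = gsrc G u" "y = gsrc G v" using U(2) by blast
    then have "u = v" using eq U(3) inj_onD[OF bisD(2)[OF U(1)]] by simp
    then show "x = y" using uv by simp
  qed
qed

lemma bisection_map_on_preimage:
  assumes "bisection_map_on G A f"
  obtains U where "bis U" "gsrc G ` U = A" "\<And>u. u \<in> U \<Longrightarrow> f (gsrc G u) = grng G u"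
    "\<And>V. {x \<in> A. f x \<in> V} = gsrc G ` {u \<in> U. grng G u \<in> V}"
proof -
  obtain U where U: "bis U" "gsrc G ` U = A" "\<And>u. u \<in> U \<Longrightarrow> f (gsrc G u) = grng G u"
    by (rule bisection_map_onE[OF assms]) blast
  have "{x \<in> A. f x \<in> V} = gsrc G ` {u \<in> U. grng G u \<in> V}" for V
    unfolding U(2)[symmetric] using U(3) by (auto simp: image_iff)
  then show thesis using that U by blast
qed

lemma bisection_map_on_subset:
  assumes f: "bisection_map_on G A f" and B: "openin T B" "closedin T B" "B \<subseteq> A"
  shows "bisection_map_on G B f"
proof -
  obtain U where U: "bis U" "gsrc G ` U = A" "\<And>u. u \<in> U \<Longrightarrow> f (gsrc G u) = grng G u"
    by (rule bisection_map_onE[OF f]) blast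
  show ?thesis
  proof (rule bisection_map_onI[OF bis_src_preimage[OF U(1) B(1,2)]])
    show "gsrc G ` {u \<in> U. gsrc G u \<in> B} = B" using U(2) B(3) by auto
  qed (use U(3) in auto)
qed

lemma bisection_map_on_comp:
  assumes f: "bisection_map_on G A f" and g: "bisection_map_on G (f ` A) g"
  shows "bisection_map_on G A (g \<circ> f)"
proof -
  obtain U where U: "bis U" "gsrc G ` U = A" "\<And>u. u \<in> U \<Longrightarrow> f (gsrc G u) = grng G u" "f ` A = grng G ` U"
    by (rule bisection_map_onE[OF f]) blast
  obtain V where V: "bis V" "gsrc G ` V = f ` A" "\<And>u. u \<in> V \<Longrightarrow> g (gsrc G u) = grng G u"
    by (rule bisection_map_onE[OF g]) blast
  have match: "gsrc G ` V = grng G ` U" using U V by simp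
  show ?thesis
  proof (rule bisection_map_onI[OF bis_mult(1)[OF U(1) V(1) match]])
    show "gsrc G ` set_gmult G V U = A" using bis_mult(2)[OF U(1) V(1) match] U by simp
    fix w assume "w \<in> set_gmult G V U"
    then obtain v u where w: "w = gmult G v u" "v \<in> V" "u \<in> U" "gsrc G v = grng G u"
      by (auto simp: set_gmult_def)
    have A: "v \<in> arrows G" "u \<in> arrows G" using bisD(6)[OF V(1) w(2)] bisD(6)[OF U(1) w(3)] .
    show "(g \<circ> f) (gsrc G w) = grng G w"
      using mult_src[OF A w(4)] mult_rng[OF A w(4)] w U(3)[OF w(3)] V(3)[OF w(2)] by simp
  qed
qed

lemma bisection_map_on_inv_into:
  assumes f: "bisection_map_on G A f"
  shows "bisection_map_on G (f ` A) (inv_into A f)"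
proof -
  obtain U where U: "bis U" "gsrc G ` U = A" "\<And>u. u \<in> U \<Longrightarrow> f (gsrc G u) = grng G u" "f ` A = grng G ` U"
    by (rule bisection_map_onE[OF f]) blast
  show ?thesis
  proof (rule bisection_map_onI[OF bis_inv(1)[OF U(1)]])
    show "gsrc G ` (ginv G ` U) = f ` A" using bis_inv(2)[OF U(1)] U(4) by simp
    fix w assume "w \<in> ginv G ` U"
    then obtain u where u: "u \<in> U" "w = ginv G u" by blast
    have uA: "u \<in> arrows G" by (rule bisD(6)[OF U(1) u(1)])
    have "inv_into A f (f (gsrc G u)) = gsrc G u"
      using bisection_map_on_inj[OF f] u U(2) by (intro inv_into_f_f) auto
    then show "inv_into A f (gsrc G w) = grng G w"
      using u U(3) src_inv[OF uA] rng_inv[OF uA] by simp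
  qed
qed

text \<open>Injectivity on the union makes the ranges disjoint, without which the union of the two
  bisections could fail to be a bisection.\<close>

lemma bisection_map_on_Un:
  assumes f: "bisection_map_on G A f" and g: "bisection_map_on G B f"
    and dis: "A \<inter> B = {}" and inj: "inj_on f (A \<union> B)"
  shows "bisection_map_on G (A \<union> B) f"
proof -
  obtain U where U: "bis U" "gsrc G ` U = A" "\<And>u. u \<in> U \<Longrightarrow> f (gsrc G u) = grng G u" "f ` A = grng G ` U"
    by (rule bisection_map_onE[OF f]) blast
  obtain V where V: "bis V" "gsrc G ` V = B" "\<And>u. u \<in> V \<Longrightarrow> f (gsrc G u) = grng G u" "f ` B = grng G ` V"
    by (rule bisection_map_onE[OF g]) blast
  have "f ` A \<inter> f ` B = {}" using inj dis inj_on_image_Int[of f "A \<union> B" A B] by simp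
  then have "bis (U \<union> V)" using U V dis by (intro bis_Un) simp_all
  then show ?thesis
    by (rule bisection_map_onI) (use U V in \<open>auto simp: image_Un\<close>)
qed

sublocale P: ample_pseudogroup T "bisection_map_on G"
proof (unfold_locales, unfold clopenin_def)
  show "compact_space T" "Hausdorff_space T" by (fact compact_unit_space Hausdorff_unit_space)+
  show "\<exists>B. (openin T B \<and> closedin T B) \<and> x \<in> B \<and> B \<subseteq> V" if "openin T V" "x \<in> V" for V x
    using that by (rule clopen_base_unit_space)
  show "openin T A \<and> closedin T A" if f: "bisection_map_on G A f" for A f
  proof -
    obtain U where "bis U" "gsrc G ` U = A" by (rule bisection_map_onE[OF f]) blast
    then show ?thesis using bis_src_clopen by blast
  qed
  show "inj_on f A" if "bisection_map_on G A f" for A f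
    using that by (rule bisection_map_on_inj)
  show "openin T (f ` A) \<and> closedin T (f ` A)" if f: "bisection_map_on G A f" for A f
  proof -
    obtain U where "bis U" "f ` A = grng G ` U" by (rule bisection_map_onE[OF f]) blast
    then show ?thesis using bis_rng_clopen by simp
  qed
  show "openin T {x \<in> A. f x \<in> V} \<and> closedin T {x \<in> A. f x \<in> V}"
    if f: "bisection_map_on G A f" and V: "openin T V \<and> closedin T V" for A f V
  proof -
    obtain U where U: "bis U" "\<And>V. {x \<in> A. f x \<in> V} = gsrc G ` {u \<in> U. grng G u \<in> V}"
      by (rule bisection_map_on_preimage[OF f]) blast
    have "bis {u \<in> U. grng G u \<in> V}" using bis_rng_preimage[OF U(1)] V by blast
    then show ?thesis unfolding U(2) by (rule bis_src_clopen)
  qed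
  show "bisection_map_on G A g" if f: "bisection_map_on G A f" and fg: "\<And>x. x \<in> A \<Longrightarrow> g x = f x" for A f g
  proof -
    obtain U where U: "bis U" "gsrc G ` U = A" "\<And>u. u \<in> U \<Longrightarrow> f (gsrc G u) = grng G u"
      by (rule bisection_map_onE[OF f]) blast
    show ?thesis by (rule bisection_map_onI[OF U(1,2)]) (use U(2,3) fg in auto)
  qed
  show "bisection_map_on G B f"
    if "bisection_map_on G A f" "openin T B \<and> closedin T B" "B \<subseteq> A" for A B f
    using that bisection_map_on_subset by blast
  show "bisection_map_on G A (g \<circ> f)"
    if "bisection_map_on G A f" "bisection_map_on G (f ` A) g" for A f g
    using that by (rule bisection_map_on_comp)
  show "bisection_map_on G (f ` A) (inv_into A f)" if "bisection_map_on G A f" for A f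
    using that by (rule bisection_map_on_inv_into)
  show "bisection_map_on G (A \<union> B) f"
    if "bisection_map_on G A f" "bisection_map_on G B f" "A \<inter> B = {}" "inj_on f (A \<union> B)" for A B f
    using that by (rule bisection_map_on_Un)
  show "bisection_map_on G A (\<lambda>x. x)" if "openin T A \<and> closedin T A" for A
  proof (rule bisection_map_onI)
    show "bis A" "gsrc G ` A = A" using bis_clopen_units that by blast+
    fix u assume "u \<in> A"
    then have "u \<in> X" using that by (auto simp: openin_unit_space_iff)
    then show "gsrc G u = grng G u" using src_unit rng_unit by simp
  qed
qed

lemma full_carrier_homeomorphic:
  assumes \<gamma>: "\<gamma> \<in> P.full_carrier"
  shows "homeomorphic_map T T \<gamma>"
proof (rule continuous_imp_homeomorphic_map)
  obtain U where U: "bis U" "gsrc G ` U = topspace T" "\<And>V. {x \<in> topspace T. \<gamma> x \<in> V} = gsrc G ` {u \<in> U. grng G u \<in> V}"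
    by (rule bisection_map_on_preimage[OF P.full_carrierD(1)[OF \<gamma>]]) blast
  show "continuous_map T T \<gamma>"
    unfolding continuous_map_def
  proof (intro conjI allI impI)
    show "\<gamma> \<in> topspace T \<rightarrow> topspace T" using P.full_carrierD(4)[OF \<gamma>] by blast
    fix V assume V: "openin T V"
    have "{u \<in> U. grng G u \<in> V} = U \<inter> {u \<in> topspace (gtop G). grng G u \<in> V}"
      using bisD(1)[OF U(1)] by (auto simp: arrows_def)
    then have "openin (gtop G) {u \<in> U. grng G u \<in> V}"
      using bisD(5)[OF U(1)] openin_continuous_map_preimage[OF continuous_rng_unit V] by auto
    then show "openin T {x \<in> topspace T. \<gamma> x \<in> V}" unfolding U(3) by (rule openin_src_image)
  qed
qed (use P.full_carrierD[OF \<gamma>] compact_unit_space Hausdorff_unit_space in auto)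

lemma G_set_map_src: "bis U \<Longrightarrow> u \<in> U \<Longrightarrow> G_set_map G U (gsrc G u) = grng G u"
  using the_inv_into_f_f[OF bisD(3)] by (simp add: G_set_map_def)

text \<open>This transfers the abstract results to [[G]]. From right to left the homeomorphism
  property has to be supplied; it comes from \<open>full_carrier_homeomorphic\<close>, that is, from
  continuity and bijectivity on a compact Hausdorff space.\<close>

lemma full_group_carrier_eq: "full_group_carrier G = P.full_carrier"
proof (intro subset_antisym subsetI)
  fix \<alpha> assume "\<alpha> \<in> full_group_carrier G"
  then obtain U where \<alpha>: "\<alpha> \<in> extensional (topspace T)" "\<alpha> = G_set_map G U" and U: "bis U"
    and sr: "gsrc G ` U = X" "grng G ` U = X"
    by (auto simp: full_group_carrier_def Homeo_def compact_open_bisection_def)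
  have "bisection_map_on G X \<alpha>"
    by (rule bisection_map_onI[OF U sr(1)]) (simp add: \<alpha>(2) G_set_map_src[OF U])
  moreover have "\<alpha> ` X = X"
    unfolding sr(1)[symmetric] image_image \<alpha>(2) using sr G_set_map_src[OF U] by (simp cong: image_cong)
  ultimately show "\<alpha> \<in> P.full_carrier"
    using \<alpha>(1) by (simp add: P.full_carrier_def topspace_unit_space)
next
  fix \<alpha> assume \<alpha>: "\<alpha> \<in> P.full_carrier"
  note D = P.full_carrierD[OF \<alpha>, unfolded topspace_unit_space]
  obtain U where U: "bis U" "gsrc G ` U = X" "\<And>u. u \<in> U \<Longrightarrow> \<alpha> (gsrc G u) = grng G u" "\<alpha> ` X = grng G ` U"
    by (rule bisection_map_onE[OF D(1)]) blast
  have "\<alpha> = G_set_map G U"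
  proof (rule extensionalityI[OF D(5)])
    show "G_set_map G U \<in> extensional X" by (simp add: G_set_map_def U(2))
    fix x assume "x \<in> X"
    then obtain u where "u \<in> U" "x = gsrc G u" using U(2) by blast
    then show "\<alpha> x = G_set_map G U x" using U(3) G_set_map_src[OF U(1)] by simp
  qed
  moreover have "\<alpha> \<in> Homeo T"
    using full_carrier_homeomorphic[OF \<alpha>] P.full_carrierD(5)[OF \<alpha>] by (simp add: Homeo_def)
  ultimately show "\<alpha> \<in> full_group_carrier G"
    using U D(2) by (auto simp: full_group_carrier_def compact_open_bisection_def)
qed

lemma topological_full_group_eq: "topological_full_group G = P.full_group"
  by (simp add: topological_full_group_def P.full_group_def full_group_carrier_eq topspace_unit_space)

end

section \<open>Dense orbits in a space without isolated points\<close>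

locale minimal_cantor_groupoid = cantor_groupoid +
  assumes minimal: "minimal_groupoid G"
begin

text \<open>Removing the other points of a finite open set, closed by the Hausdorff property, would
  isolate \<open>x\<close>.\<close>

lemma infinite_open_unit_space:
  assumes V: "openin T V" "x \<in> V"
  shows "infinite V"
proof
  assume fin: "finite V"
  have "closedin T (V - {x})"
    using fin V openin_subset by (intro closedin_Hausdorff_finite[OF Hausdorff_unit_space]) blast+
  then have "openin T (V - (V - {x}))" using V(1) by (rule openin_diff[rotated])
  moreover have "V - (V - {x}) = {x}" using V by blast
  moreover have "x \<in> topspace T" using V openin_subset by blast
  ultimately show False using cantor by (auto simp: cantor_set_def)
qed

text \<open>A nonempty open set stays open and nonempty after removal of a finite set, so the dense
  orbit of \<open>x\<close> meets it; a bisection through the arrow that leads there is the required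
  local map.\<close>

sublocale P: minimal_pseudogroup T "bisection_map_on G"
proof
  fix x V and F :: "'a set" assume x: "x \<in> topspace T" and V: "openin T V" "V \<noteq> {}" and F: "finite F"
  have xX: "x \<in> X" using x by (simp add: topspace_unit_space)
  have "closedin T (F \<inter> topspace T)"
    using F by (intro closedin_Hausdorff_finite[OF Hausdorff_unit_space]) auto
  then have "openin T (V - (F \<inter> topspace T))" using V by blast
  moreover have "V - (F \<inter> topspace T) = V - F" using openin_subset[OF V(1)] by blast
  ultimately have op: "openin T (V - F)" by simp
  have "infinite V" using V infinite_open_unit_space by blast
  then have "infinite (V - F)" using F by (rule Diff_infinite_finite[rotated])
  then have "V - F \<noteq> {}" by (metis finite.emptyI)
  then obtain y where y: "y \<in> V - F" by blast
  then have "y \<in> topspace T" using V(1) openin_subset by blast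
  then have "y \<in> T closure_of groupoid_orbit G x"
    using minimal xX unfolding minimal_groupoid_def by (simp add: topspace_unit_space)
  then obtain z where "z \<in> groupoid_orbit G x" "z \<in> V - F"
    using op y by (meson in_closure_of)
  then obtain g where g: "g \<in> arrows G" "gsrc G g = x" "grng G g \<in> V - F"
    by (auto simp: groupoid_orbit_def)
  obtain U where U: "bis U" "g \<in> U"
    using bis_exists[of g "topspace (gtop G)"] g(1) by (auto simp: arrows_def)
  have "bisection_map_on G (gsrc G ` U) (G_set_map G U)"
    using G_set_map_src[OF U(1)] by (intro bisection_map_onI[OF U(1)]) auto
  moreover have "G_set_map G U x \<in> V - F" using G_set_map_src[OF U] g by simp
  ultimately show "\<exists>A f. bisection_map_on G A f \<and> x \<in> A \<and> f x \<in> V - F" using U(2) g(2) by blast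
qed

end

section \<open>Towers from almost finiteness\<close>

context cantor_groupoid
begin

text \<open>Finitely many bisections cover \<open>C\<close>, and each has at most one arrow with a
  given source.\<close>

lemma finite_src_fibre:
  assumes C: "compactin (gtop G) C"
  shows "finite {c \<in> C. gsrc G c = x}"
proof -
  have CA: "C \<subseteq> arrows G" using compactin_subset_topspace[OF C] by (simp add: arrows_def)
  have "\<forall>U\<in>Collect bis. openin (gtop G) U" using bisD(5) by blast
  moreover have "C \<subseteq> \<Union> (Collect bis)"
  proof
    fix c assume "c \<in> C"
    then have "c \<in> topspace (gtop G)" using CA by (auto simp: arrows_def)
    then obtain U where "bis U" "c \<in> U"
      using bis_exists[OF _ openin_topspace] by blast
    then show "c \<in> \<Union> (Collect bis)" by blast
  qed
  ultimately obtain \<F> where F: "finite \<F>" "\<F> \<subseteq> Collect bis" "C \<subseteq> \<Union>\<F>"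
    using C unfolding compactin_def by meson
  have "finite {c \<in> U. gsrc G c = x}" if "U \<in> \<F>" for U
  proof -
    have inj: "inj_on (gsrc G) U" using that F(2) bisD(3) by blast
    show ?thesis
    proof (cases "{c \<in> U. gsrc G c = x} = {}")
      case False
      then obtain c where "c \<in> U" "gsrc G c = x" by blast
      then have "{c \<in> U. gsrc G c = x} \<subseteq> {c}" using inj by (auto dest: inj_onD)
      then show ?thesis using finite_subset by blast
    qed (simp only: finite.emptyI)
  qed
  then have "finite (\<Union>U\<in>\<F>. {c \<in> U. gsrc G c = x})" using F(1) by blast
  moreover have "{c \<in> C. gsrc G c = x} \<subseteq> (\<Union>U\<in>\<F>. {c \<in> U. gsrc G c = x})" using F(3) by blast
  ultimately show ?thesis by (rule rev_finite_subset)
qed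

lemma finite_set_gmult_fibre:
  assumes C: "compactin (gtop G) C" and K: "compactin (gtop G) K"
  shows "finite (set_gmult G C (src_fibre G K x))"
proof -
  have "finite (src_fibre G K x)" using finite_src_fibre[OF K] by (simp add: src_fibre_def)
  then have "finite (\<Union>g\<in>src_fibre G K x. (\<lambda>c. gmult G c g) ` {c \<in> C. gsrc G c = grng G g})"
    using finite_src_fibre[OF C] by blast
  moreover have "set_gmult G C (src_fibre G K x)
      \<subseteq> (\<Union>g\<in>src_fibre G K x. (\<lambda>c. gmult G c g) ` {c \<in> C. gsrc G c = grng G g})"
    by (auto simp: set_gmult_def)
  ultimately show ?thesis by (rule rev_finite_subset)
qed

end

section \<open>Towers from the orbits of an elementary subgroupoid\<close>

locale elementary_in_cantor_groupoid = cantor_groupoid +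
  fixes K :: "'a set"
  assumes elementary: "elementary_subgroupoid K G"
begin

text \<open>The K-orbit of \<open>x\<close>; these sets are the classes \<open>R x\<close> of the
  abstract tower partition.\<close>

definition orb :: "'a \<Rightarrow> 'a set" where
  "orb x = grng G ` src_fibre G K x"

lemma K_arrows: "K \<subseteq> arrows G"
  and K_inv: "g \<in> K \<Longrightarrow> ginv G g \<in> K"
  and K_mult: "g \<in> K \<Longrightarrow> h \<in> K \<Longrightarrow> gsrc G g = grng G h \<Longrightarrow> gmult G g h \<in> K"
  and K_compact: "compactin (gtop G) K" and K_open: "openin (gtop G) K"
  using elementary by (auto simp: elementary_subgroupoid_def subgroupoid_def)

lemma K_arrow: "k \<in> K \<Longrightarrow> k \<in> arrows G"
  using K_arrows by blast

lemma arrows_restrict: "arrows (restrict_groupoid G K) = K"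
  using K_arrows by (auto simp: arrows_def restrict_groupoid_def)

lemma K_src_image: "gsrc G ` K = X"
  using elementary arrows_restrict
  by (simp add: elementary_subgroupoid_def gunits_def restrict_groupoid_def)

lemma unit_in_K:
  assumes "x \<in> X"
  shows "x \<in> K"
proof -
  obtain k where k: "k \<in> K" "x = gsrc G k" using assms K_src_image by blast
  have kA: "k \<in> arrows G" using k K_arrow by blast
  have "gmult G (ginv G k) k \<in> K"
    using k K_inv src_inv[OF kA] by (intro K_mult) auto
  then show ?thesis using inv_left[OF kA] k by simp
qed

lemma K_isotropy:
  assumes "k \<in> K" "grng G k = gsrc G k"
  shows "k \<in> X"
proof -
  have "isotropy (restrict_groupoid G K) = gunits (restrict_groupoid G K)"
    "gunits (restrict_groupoid G K) = X"
    using elementary by (auto simp: elementary_subgroupoid_def principal_def)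
  moreover have "k \<in> isotropy (restrict_groupoid G K)"
    using assms arrows_restrict by (simp add: isotropy_def) (simp add: restrict_groupoid_def)
  ultimately show ?thesis by simp
qed

text \<open>Principality of \<open>K\<close> enters here: for two arrows k, h of the fibre with the
  same range, h k^-1 lies in \<open>K\<close> and has equal source and range, so it is a unit and k
  = h.\<close>

lemma inj_on_rng_fibre: "inj_on (grng G) (src_fibre G K x)"
proof (rule inj_onI)
  fix k h assume kh: "k \<in> src_fibre G K x" "h \<in> src_fibre G K x" and r: "grng G k = grng G h"
  then have K: "k \<in> K" "h \<in> K" and s: "gsrc G k = x" "gsrc G h = x" by (auto simp: src_fibre_def)
  have A: "k \<in> arrows G" "h \<in> arrows G" using K K_arrow by auto
  define u where "u = gmult G h (ginv G k)"
  have c: "gsrc G h = grng G (ginv G k)" using A rng_inv s by simp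
  have uK: "u \<in> K" unfolding u_def using K K_inv c by (intro K_mult) auto
  have "grng G u = grng G h" "gsrc G u = grng G k"
    unfolding u_def using mult_rng[OF A(2) inv_closed[OF A(1)] c] mult_src[OF A(2) inv_closed[OF A(1)] c]
      src_inv[OF A(1)] by simp_all
  then have "u \<in> X" using r uK K_isotropy by simp
  then have u: "u = grng G k" using src_unit \<open>gsrc G u = grng G k\<close> by simp
  have "gmult G u k = h" unfolding u_def by (rule mult_cancel_inv_right) (use A s in auto)
  then show "k = h" using u rng_left_unit[OF A(1)] by simp
qed

lemma orb_subset: "orb x \<subseteq> X"
  using rng_gunits K_arrow by (auto simp: orb_def src_fibre_def)

lemma orb_self: "x \<in> X \<Longrightarrow> x \<in> orb x"
  using unit_in_K src_unit rng_unit by (force simp: orb_def src_fibre_def)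

lemma orb_mem:
  assumes "k \<in> K"
  shows "orb (grng G k) = orb (gsrc G k)"
proof -
  have sub: "orb (grng G k) \<subseteq> orb (gsrc G k)" if k: "k \<in> K" for k
  proof
    fix z assume "z \<in> orb (grng G k)"
    then obtain h where h: "h \<in> K" "gsrc G h = grng G k" "z = grng G h"
      by (auto simp: orb_def src_fibre_def)
    have "gmult G h k \<in> src_fibre G K (gsrc G k)"
      using K_mult h k mult_src K_arrow by (auto simp: src_fibre_def)
    moreover have "grng G (gmult G h k) = z" using mult_rng h k K_arrow by simp
    ultimately show "z \<in> orb (gsrc G k)" by (force simp: orb_def)
  qed
  have kA: "k \<in> arrows G" using assms K_arrow by blast
  have "orb (gsrc G k) \<subseteq> orb (grng G k)"
    using sub[OF K_inv[OF assms]] rng_inv[OF kA] src_inv[OF kA] by simp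
  with sub[OF assms] show ?thesis by blast
qed

lemma orb_eq:
  assumes "y \<in> orb x"
  shows "orb y = orb x"
proof -
  obtain k where "k \<in> K" "gsrc G k = x" "y = grng G k"
    using assms by (auto simp: orb_def src_fibre_def)
  then show ?thesis using orb_mem by blast
qed

text \<open>Each arrow \<open>e j\<close> of the finite fibre extends to a bisection inside
  \<open>K\<close>, and these bisections give the levels. At \<open>x\<close> the levels are
  distinct points because the range map is injective on the fibre, so they are disjoint over a small
  base.\<close>

lemma local_tower:
  assumes x: "x \<in> X"
  obtains Y f e where "P.tower Y (card (src_fibre G K x)) f" "x \<in> Y"
    "\<forall>y\<in>Y. orb y = (\<lambda>j. f j y) ` {1..card (src_fibre G K x)}"
    "bij_betw e {1..card (src_fibre G K x)} (src_fibre G K x)"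
    "\<forall>j\<in>{1..card (src_fibre G K x)}. f j x = grng G (e j)"
proof -
  define n where "n = card (src_fibre G K x)"
  have fin: "finite (src_fibre G K x)" using finite_src_fibre[OF K_compact] by (simp add: src_fibre_def)
  obtain e where e: "bij_betw e {1..n} (src_fibre G K x)"
    using ex_bij_betw_nat_finite_1[OF fin] n_def by blast
  have ek: "e j \<in> K" "gsrc G (e j) = x" if "j \<in> {1..n}" for j
    using bij_betw_apply[OF e that] by (auto simp: src_fibre_def)
  have "\<exists>U. bis U \<and> e j \<in> U \<and> U \<subseteq> K" if j: "j \<in> {1..n}" for j
  proof -
    obtain U where "bis U" "e j \<in> U" "U \<subseteq> K" by (rule bis_exists[OF ek(1)[OF j] K_open])
    then show ?thesis by blast
  qed
  then obtain U where U: "\<And>j. j \<in> {1..n} \<Longrightarrow> bis (U j) \<and> e j \<in> U j \<and> U j \<subseteq> K" by metis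
  define f where "f j = G_set_map G (U j)" for j
  have fU: "f j (gsrc G u) = grng G u" if "j \<in> {1..n}" "u \<in> U j" for j u
    unfolding f_def using G_set_map_src U that by blast
  have fx: "f j x = grng G (e j)" if j: "j \<in> {1..n}" for j
    using fU[OF j, of "e j"] U[OF j] ek(2)[OF j] by simp
  \<comment> \<open>The arrows of \<open>K\<close> missed by the bisections form a compact set,
    whose sources form a closed set that avoids \<open>x\<close>. Off this closed set every fibre of
    \<open>K\<close> is covered by the bisections, so the tower exhausts the orbits.\<close>
  let ?R = "K \<inter> (topspace (gtop G) - (\<Union>j\<in>{1..n}. U j))"
  have "openin (gtop G) (\<Union>j\<in>{1..n}. U j)" using U bisD(5) by blast
  then have "compactin (gtop G) ?R"
    using K_compact by (intro compact_Int_closedin) auto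
  then have "closedin T (gsrc G ` ?R)"
    using image_compactin[OF _ continuous_src_unit] compactin_imp_closedin[OF Hausdorff_unit_space] by blast
  then have op: "openin T (topspace T - gsrc G ` ?R)" by blast
  have "x \<notin> gsrc G ` ?R"
  proof
    assume "x \<in> gsrc G ` ?R"
    then obtain k where k: "k \<in> K" "gsrc G k = x" "k \<notin> (\<Union>j\<in>{1..n}. U j)" by blast
    then have "k \<in> e ` {1..n}" using bij_betw_imp_surj_on[OF e] by (simp add: src_fibre_def)
    then show False using U k(3) by blast
  qed
  then have "x \<in> topspace T - gsrc G ` ?R" using x by (simp add: topspace_unit_space)
  then obtain A where A: "clopenin T A" "x \<in> A" "A \<subseteq> topspace T - gsrc G ` ?R"
    using P.clopen_base[OF op] by blast
  have bm: "bisection_map_on G (gsrc G ` U j) (f j)" if "j \<in> {1..n}" for j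
    using U that fU by (intro bisection_map_onI[of "U j"]) auto
  have xU: "x \<in> gsrc G ` U j" if "j \<in> {1..n}" for j
    using U[OF that] ek(2)[OF that] by force
  have inj: "inj_on (\<lambda>j. f j x) {1..n}"
  proof (rule inj_onI)
    fix i j assume ij: "i \<in> {1..n}" "j \<in> {1..n}" "f i x = f j x"
    then have "grng G (e i) = grng G (e j)" using fx by simp
    then have "e i = e j"
      using inj_onD[OF inj_on_rng_fibre] bij_betw_apply[OF e] ij by blast
    then show "i = j" using bij_betw_imp_inj_on[OF e] ij by (meson inj_onD)
  qed
  obtain Y where Y: "clopenin T Y" "x \<in> Y" "Y \<subseteq> A" "\<And>j. j \<in> {1..n} \<Longrightarrow> Y \<subseteq> gsrc G ` U j"
    "\<And>j. j \<in> {1..n} \<Longrightarrow> bisection_map_on G Y (f j)"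
    "\<And>i j. i \<in> {1..n} \<Longrightarrow> j \<in> {1..n} \<Longrightarrow> i \<noteq> j \<Longrightarrow> f i ` Y \<inter> f j ` Y = {}"
    by (rule P.tower_shrink[OF _ A(1,2) bm xU inj]) auto
  have tw: "P.tower Y n f" using Y by (simp add: P.tower_def)
  have orbY: "orb y = (\<lambda>j. f j y) ` {1..n}" if y: "y \<in> Y" for y
  proof
    show "(\<lambda>j. f j y) ` {1..n} \<subseteq> orb y"
    proof (rule image_subsetI)
      fix j assume j: "j \<in> {1..n}"
      then obtain u where u: "u \<in> U j" "y = gsrc G u" using Y(4) y by blast
      then have "u \<in> src_fibre G K y" using U[OF j] by (auto simp: src_fibre_def)
      then show "f j y \<in> orb y" using fU[OF j u(1)] u(2) by (auto simp: orb_def)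
    qed
    show "orb y \<subseteq> (\<lambda>j. f j y) ` {1..n}"
    proof
      fix z assume "z \<in> orb y"
      then obtain k where k: "k \<in> K" "gsrc G k = y" "z = grng G k" by (auto simp: orb_def src_fibre_def)
      have "y \<notin> gsrc G ` ?R" using y Y(3) A(3) by blast
      then have "k \<notin> ?R" using k by blast
      then obtain j where j: "j \<in> {1..n}" "k \<in> U j" using k K_arrows by (auto simp: arrows_def)
      have "z = f j y" using fU[OF j] k by simp
      then show "z \<in> (\<lambda>j. f j y) ` {1..n}" using j(1) by (rule image_eqI)
    qed
  qed
  show thesis
    by (rule that[of Y f e]) (use tw Y(2) orbY e fx in \<open>simp_all add: n_def\<close>)
qed

text \<open>Level \<open>j\<close> is good if the arrow by which \<open>\<alpha>\<close> moves
  \<open>f j x\<close> belongs to \<open>K\<close>; then \<open>\<alpha>\<close> stays in the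
  K-orbit, that is, in the fibre of the tower. The bad levels are counted by the set whose size
  almost finiteness bounds.\<close>

lemma local_permutation:
  assumes tw: "P.tower Y n f" and x: "x \<in> Y" and orbY: "\<forall>y\<in>Y. orb y = (\<lambda>j. f j y) ` {1..n}"
    and e: "bij_betw e {1..n} (src_fibre G K x)" "\<forall>j\<in>{1..n}. f j x = grng G (e j)"
    and U: "bis U" "gsrc G ` U = X" "U \<subseteq> C" "compactin (gtop G) C"
    and \<alpha>: "\<alpha> \<in> P.full_carrier" "\<And>u. u \<in> U \<Longrightarrow> \<alpha> (gsrc G u) = grng G u"
    and small: "8 * card (set_gmult G C (src_fibre G K x) - src_fibre G K x) \<le> n"
  obtains Z where "clopenin T Z" "x \<in> Z" "Z \<subseteq> Y" "\<And>W. W \<subseteq> Z \<Longrightarrow> P.mostly_permutes \<alpha> W n f"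
proof -
  let ?E = "gsrc G ` (U \<inter> K)"
  define J where "J = {j \<in> {1..n}. f j x \<in> ?E}"
  have bisUK: "bis (U \<inter> K)" by (rule bis_Int_clopen[OF U(1) K_compact K_open])
  have E: "clopenin T ?E" using bis_src_clopen[OF bisUK] by (simp add: clopenin_def)
  have ek: "e j \<in> K" "gsrc G (e j) = x" "e j \<in> src_fibre G K x" if "j \<in> {1..n}" for j
    using bij_betw_apply[OF e(1) that] by (auto simp: src_fibre_def)
  have alpha_orb: "\<alpha> z \<in> orb z" if "z \<in> ?E" for z
    using that \<alpha>(2) by (force simp: orb_def src_fibre_def)
  have inX: "f j y \<in> X" if "j \<in> {1..n}" "y \<in> Y" for j y
    using P.tower_in_X[OF tw that] by (simp add: topspace_unit_space)
  have "\<exists>u. u \<in> U \<and> gsrc G u = f j x" if "j \<in> {1..n}" for j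
    using inX[OF that x] U(2) by (metis imageE)
  then obtain u where u: "\<And>j. j \<in> {1..n} \<Longrightarrow> u j \<in> U \<and> gsrc G (u j) = f j x" by metis
  have comp: "u j \<in> arrows G" "e j \<in> arrows G" "gsrc G (u j) = grng G (e j)" if j: "j \<in> {1..n}" for j
    using u[OF j] bisD(6)[OF U(1)] ek(1)[OF j] K_arrow e(2) j by auto
  have rng_ue: "grng G (gmult G (u j) (e j)) = \<alpha> (f j x)" if j: "j \<in> {1..n}" for j
    using mult_rng[OF comp[OF j]] \<alpha>(2)[of "u j"] u[OF j] by simp
  \<comment> \<open>A bad level \<open>j\<close> yields the product of \<open>u j\<close> and
    \<open>e j\<close>, an arrow of CKx. It is not in Kx, since otherwise multiplying by the inverse
    of \<open>e j\<close> would put \<open>u j\<close> into \<open>K\<close>; different levels give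
    different ranges, hence different arrows.\<close>
  have "card ({1..n} - J) \<le> card (set_gmult G C (src_fibre G K x) - src_fibre G K x)"
  proof (rule card_inj_on_le)
    show "inj_on (\<lambda>j. gmult G (u j) (e j)) ({1..n} - J)"
    proof (rule inj_onI)
      fix i j assume ij: "i \<in> {1..n} - J" "j \<in> {1..n} - J" "gmult G (u i) (e i) = gmult G (u j) (e j)"
      then have "\<alpha> (f i x) = \<alpha> (f j x)" using rng_ue by (metis DiffD1)
      then have "f i x = f j x"
        using P.full_carrierD(3)[OF \<alpha>(1)] P.tower_in_X[OF tw _ x] ij by (meson DiffD1 inj_onD)
      then show "i = j" using P.tower_unique(1)[OF tw _ _ x x] ij by blast
    qed
    show "(\<lambda>j. gmult G (u j) (e j)) ` ({1..n} - J) \<subseteq> set_gmult G C (src_fibre G K x) - src_fibre G K x"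
    proof (rule image_subsetI)
      fix j assume j: "j \<in> {1..n} - J"
      then have j1: "j \<in> {1..n}" by blast
      have "gmult G (u j) (e j) \<in> set_gmult G C (src_fibre G K x)"
        unfolding set_gmult_def using u[OF j1] U(3) ek(3)[OF j1] comp(3)[OF j1] by blast
      moreover have "gmult G (u j) (e j) \<notin> src_fibre G K x"
      proof
        assume "gmult G (u j) (e j) \<in> src_fibre G K x"
        then have ue: "gmult G (u j) (e j) \<in> K" by (simp add: src_fibre_def)
        have "gmult G (gmult G (u j) (e j)) (ginv G (e j)) \<in> K"
          by (rule K_mult[OF ue K_inv[OF ek(1)[OF j1]]])
            (use mult_src[OF comp[OF j1]] rng_inv[OF comp(2)[OF j1]] in simp)
        then have "u j \<in> K" using mult_inv_cancel_right[OF comp[OF j1]] by simp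
        then have "f j x \<in> ?E" using u[OF j1] by (metis IntI imageI)
        then show False using j unfolding J_def by blast
      qed
      ultimately show "gmult G (u j) (e j) \<in> set_gmult G C (src_fibre G K x) - src_fibre G K x" by blast
    qed
    show "finite (set_gmult G C (src_fibre G K x) - src_fibre G K x)"
      using finite_set_gmult_fibre[OF U(4) K_compact] by blast
  qed
  then have J_large: "8 * card ({1..n} - J) \<le> n" using small by linarith
  have "\<exists>l Z. l \<in> {1..n} \<and> clopenin T Z \<and> x \<in> Z \<and> (\<forall>y\<in>Y \<inter> Z. \<alpha> (f j y) = f l y)" if j: "j \<in> J" for j
  proof -
    have j1: "j \<in> {1..n}" and jE: "f j x \<in> ?E" using j by (auto simp: J_def)
    have orb_f: "orb (f j y) = orb y" if "y \<in> Y" for y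
      using orb_eq[of "f j y" y] orbY that j1 by blast
    have "\<alpha> (f j x) \<in> (\<lambda>l. f l x) ` {1..n}"
      using alpha_orb[OF jE] orb_f[OF x] orbY x by blast
    then obtain l where l: "l \<in> {1..n}" "\<alpha> (f j x) = f l x" by blast
    have fj: "bisection_map_on G Y (f j)" by (rule P.tower_loc[OF tw j1])
    have "bisection_map_on G (f j ` Y) \<alpha>"
      by (rule P.loc_subset[OF P.full_carrierD(1)[OF \<alpha>(1)] P.tower_level_clopen[OF tw j1]
            P.clopen_subset[OF P.tower_level_clopen[OF tw j1]]])
    then have \<alpha>fj: "bisection_map_on G Y (\<alpha> \<circ> f j)" by (rule P.loc_comp[OF fj])
    \<comment> \<open>The first condition keeps the image in the orbit of \<open>y\<close>, so it is
      \<open>f m y\<close> for some \<open>m\<close>; the second puts it on level \<open>l\<close>,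
      so \<open>m\<close> is \<open>l\<close> throughout this neighbourhood.\<close>
    let ?Z = "{y \<in> Y. f j y \<in> ?E} \<inter> {y \<in> Y. (\<alpha> \<circ> f j) y \<in> f l ` Y}"
    have "clopenin T ?Z"
      by (rule P.clopen_Int[OF P.loc_vimage_clopen[OF fj E]
            P.loc_vimage_clopen[OF \<alpha>fj P.tower_level_clopen[OF tw l(1)]]])
    moreover have "x \<in> ?Z" using x jE l by auto
    moreover have "\<alpha> (f j y) = f l y" if y: "y \<in> ?Z" for y
    proof -
      have yY: "y \<in> Y" and yE: "f j y \<in> ?E" using y by auto
      obtain z where z: "z \<in> Y" "\<alpha> (f j y) = f l z" using y by auto
      have "\<alpha> (f j y) \<in> (\<lambda>l. f l y) ` {1..n}"
        using alpha_orb[OF yE] orb_f[OF yY] orbY yY by blast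
      then obtain m where m: "m \<in> {1..n}" "\<alpha> (f j y) = f m y" by blast
      then have "m = l" using P.tower_unique(1)[OF tw m(1) l(1) yY z(1)] z(2) by simp
      then show ?thesis using m by simp
    qed
    ultimately show ?thesis using l(1) by blast
  qed
  then obtain l Z where lZ: "\<And>j. j \<in> J \<Longrightarrow> l j \<in> {1..n} \<and> clopenin T (Z j) \<and> x \<in> Z j \<and>
      (\<forall>y\<in>Y \<inter> Z j. \<alpha> (f j y) = f (l j) y)" by metis
  have finJ: "finite J" by (simp add: J_def)
  show thesis
  proof
    show "clopenin T (Y \<inter> (\<Inter>j\<in>J. Z j))"
      using lZ by (intro P.clopen_INT[OF finJ P.tower_clopen[OF tw]]) blast
    show "x \<in> Y \<inter> (\<Inter>j\<in>J. Z j)" using x lZ by blast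
    show "P.mostly_permutes \<alpha> W n f" if W: "W \<subseteq> Y \<inter> (\<Inter>j\<in>J. Z j)" for W
      unfolding P.mostly_permutes_def
    proof (intro exI[of _ J] conjI ballI)
      show "J \<subseteq> {1..n}" by (auto simp: J_def)
      show "8 * card ({1..n} - J) \<le> n" by (rule J_large)
      fix j assume j: "j \<in> J"
      have "W \<subseteq> Y \<inter> Z j" using W j by blast
      then have "\<forall>y\<in>W. \<alpha> (f j y) = f (l j) y" using lZ[OF j] by blast
      then show "\<exists>l\<in>{1..n}. \<forall>y\<in>W. \<alpha> (f j y) = f l y" using lZ[OF j] by blast
    qed
  qed blast
qed

end

section \<open>From almost finiteness to tower partitions\<close>

context minimal_cantor_groupoid
begin

text \<open>Adding such a set to the invariance condition forces the fibres of \<open>K\<close> to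
  be large. Locally it is the union of the bisections of a tower with \<open>m\<close> levels;
  compactness assembles finitely many of these.\<close>

lemma compact_many_arrows:
  "\<exists>C. compactin (gtop G) C \<and> (\<forall>x\<in>X. m \<le> card {c \<in> C. gsrc G c = x})"
proof -
  let ?Q = "\<lambda>W. \<exists>C. compactin (gtop G) C \<and> (\<forall>x\<in>W. m \<le> card {c \<in> C. gsrc G c = x})"
  have "?Q (topspace T)"
  proof (rule compact_space_clopen_induct[where \<B> = "Collect (clopenin T)" and P = ?Q, OF compact_unit_space])
    show "?Q {}" by (rule exI[of _ "{}"]) simp
    show "openin T A" if "A \<in> Collect (clopenin T)" for A using that by (simp add: clopenin_def)
    fix A B assume "?Q A" "?Q B"
    then obtain C D where C: "compactin (gtop G) C" "\<forall>x\<in>A. m \<le> card {c \<in> C. gsrc G c = x}"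
      and D: "compactin (gtop G) D" "\<forall>x\<in>B. m \<le> card {c \<in> D. gsrc G c = x}" by blast
    have CD: "compactin (gtop G) (C \<union> D)" by (rule compactin_Un[OF C(1) D(1)])
    have "card {c \<in> C. gsrc G c = x} \<le> card {c \<in> C \<union> D. gsrc G c = x}"
      "card {c \<in> D. gsrc G c = x} \<le> card {c \<in> C \<union> D. gsrc G c = x}" for x
      by (rule card_mono[OF finite_src_fibre[OF CD]]; blast)+
    note mono = this
    have "m \<le> card {c \<in> C \<union> D. gsrc G c = x}" if "x \<in> A \<union> B" for x
      using that
    proof
      show ?thesis if "x \<in> A" using order_trans[OF bspec[OF C(2) that] mono(1)] .
      show ?thesis if "x \<in> B" using order_trans[OF bspec[OF D(2) that] mono(2)] .
    qed
    then show "?Q (A \<union> B)" using CD by blast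
  next
    fix x assume x: "x \<in> topspace T"
    obtain Y f where tw: "P.tower Y m f" and xY: "x \<in> Y" by (rule P.tower_exists[OF x])
    have "\<exists>U. bis U \<and> gsrc G ` U = Y \<and> (\<forall>u\<in>U. f j (gsrc G u) = grng G u)" if "j \<in> {1..m}" for j
      using P.tower_loc[OF tw that] by (simp add: bisection_map_on_def)
    then obtain U where U: "\<And>j. j \<in> {1..m} \<Longrightarrow>
        bis (U j) \<and> gsrc G ` U j = Y \<and> (\<forall>u\<in>U j. f j (gsrc G u) = grng G u)" by metis
    let ?C = "\<Union>j\<in>{1..m}. U j"
    have C: "compactin (gtop G) ?C"
      using U bisD(4) by (intro compactin_Union) auto
    have "m \<le> card {c \<in> ?C. gsrc G c = y}" if y: "y \<in> Y" for y
    proof -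
      have "(\<lambda>j. f j y) ` {1..m} \<subseteq> grng G ` {c \<in> ?C. gsrc G c = y}"
      proof (rule image_subsetI)
        fix j assume j: "j \<in> {1..m}"
        then obtain u where u: "u \<in> U j" "y = gsrc G u" using U[OF j] y by blast
        then have "f j y = grng G u" using U[OF j] by blast
        then show "f j y \<in> grng G ` {c \<in> ?C. gsrc G c = y}" using u j by blast
      qed
      moreover have "inj_on (\<lambda>j. f j y) {1..m}"
        using P.tower_unique(1)[OF tw _ _ y y] by (intro inj_onI) blast
      ultimately have "card {1..m} \<le> card {c \<in> ?C. gsrc G c = y}"
        using finite_src_fibre[OF C] by (meson card_image_le card_inj_on_le finite_imageI order_trans)
      then show ?thesis by simp
    qed
    then have "\<forall>W\<in>Collect (clopenin T). W \<subseteq> Y \<longrightarrow> ?Q W" using C by blast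
    then show "\<exists>Z\<in>Collect (clopenin T). x \<in> Z \<and> (\<forall>W\<in>Collect (clopenin T). W \<subseteq> Z \<longrightarrow> ?Q W)"
      using xY P.tower_clopen[OF tw] by blast
  qed (auto intro: P.clopen_Un P.clopen_Diff P.clopen_topspace)
  then show ?thesis by (simp add: topspace_unit_space)
qed

end

locale almost_finite_cantor_groupoid = minimal_cantor_groupoid +
  assumes almost_finite: "almost_finite G"
begin

lemma almost_finite_tower_partition:
  assumes \<alpha>: "\<alpha> \<in> P.full_carrier" and \<beta>: "\<beta> \<in> P.full_carrier"
  shows "\<exists>R. (\<forall>x\<in>X. R x \<subseteq> X \<and> x \<in> R x \<and> (\<forall>y\<in>R x. R y = R x)) \<and>
      (\<forall>x\<in>X. \<exists>Y n f. P.tower Y n f \<and> x \<in> Y \<and> 8 \<le> n \<and>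
         (\<forall>y\<in>Y. R y = (\<lambda>j. f j y) ` {1..n}) \<and>
         P.mostly_permutes \<alpha> Y n f \<and> P.mostly_permutes \<beta> Y n f)"
proof -
  obtain U where U: "bis U" "gsrc G ` U = X" "\<And>u. u \<in> U \<Longrightarrow> \<alpha> (gsrc G u) = grng G u"
    by (rule bisection_map_onE[OF P.full_carrierD(1)[OF \<alpha>, unfolded topspace_unit_space]]) blast
  obtain V where V: "bis V" "gsrc G ` V = X" "\<And>u. u \<in> V \<Longrightarrow> \<beta> (gsrc G u) = grng G u"
    by (rule bisection_map_onE[OF P.full_carrierD(1)[OF \<beta>, unfolded topspace_unit_space]]) blast
  obtain C8 where C8: "compactin (gtop G) C8" "\<And>x. x \<in> X \<Longrightarrow> 8 \<le> card {c \<in> C8. gsrc G c = x}"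
    using compact_many_arrows[of 8] by blast
  \<comment> \<open>One compact set controls everything: the bisections of \<open>\<alpha>\<close>
    and \<open>\<beta>\<close> bound the bad levels, and \<open>C8\<close> guarantees eight levels.
    The tolerance 1/8 is the one built into \<open>mostly_permutes\<close>.\<close>
  define C where "C = U \<union> V \<union> C8"
  have C: "compactin (gtop G) C"
    unfolding C_def using bisD(4)[OF U(1)] bisD(4)[OF V(1)] C8(1) by (intro compactin_Un)
  obtain K where K: "elementary_subgroupoid K G"
    and ratio: "\<And>x. x \<in> X \<Longrightarrow> real (card (set_gmult G C (src_fibre G K x) - src_fibre G K x))
                / real (card (src_fibre G K x)) < 1 / 8"
    using almost_finite C unfolding almost_finite_def
    by (metis divide_pos_pos zero_less_numeral zero_less_one)
  interpret K: elementary_in_cantor_groupoid G K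
    by unfold_locales (rule K)
  have small: "8 * card (set_gmult G C (src_fibre G K x) - src_fibre G K x) < card (src_fibre G K x)"
    if x: "x \<in> X" for x
  proof -
    have "finite (src_fibre G K x)" using finite_src_fibre[OF K.K_compact] by (simp add: src_fibre_def)
    moreover have "x \<in> src_fibre G K x" using K.unit_in_K[OF x] src_unit[OF x] by (simp add: src_fibre_def)
    ultimately have "0 < card (src_fibre G K x)" by (auto simp: card_gt_0_iff)
    then show ?thesis using ratio[OF x] by (simp add: divide_less_eq)
  qed
  \<comment> \<open>With fewer than eight arrows in Kx, an integer below an eighth of their number
    is 0, so CKx lies in Kx; but CKx contains the at least eight arrows of \<open>C8\<close> with
    source \<open>x\<close>, because the unit \<open>x\<close> belongs to Kx.\<close>
  have tall: "8 \<le> card (src_fibre G K x)" if x: "x \<in> X" for x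
  proof (rule ccontr)
    assume less: "\<not> 8 \<le> card (src_fibre G K x)"
    then have "card (set_gmult G C (src_fibre G K x) - src_fibre G K x) = 0" using small[OF x] by linarith
    then have sub: "set_gmult G C (src_fibre G K x) \<subseteq> src_fibre G K x"
      using finite_set_gmult_fibre[OF C K.K_compact, of x] by auto
    have "{c \<in> C8. gsrc G c = x} \<subseteq> set_gmult G C (src_fibre G K x)"
    proof
      fix c assume c: "c \<in> {c \<in> C8. gsrc G c = x}"
      then have cA: "c \<in> arrows G" using compactin_subset_topspace[OF C8(1)] by (auto simp: arrows_def)
      have "gmult G c x = c" using c src_right_unit[OF cA] by simp
      moreover have "x \<in> src_fibre G K x" using K.unit_in_K[OF x] src_unit[OF x] by (simp add: src_fibre_def)
      moreover have "c \<in> C" "gsrc G c = grng G x" using c rng_unit[OF x] by (auto simp: C_def)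
      ultimately show "c \<in> set_gmult G C (src_fibre G K x)" unfolding set_gmult_def by (metis (mono_tags, lifting) mem_Collect_eq)
    qed
    then have "card {c \<in> C8. gsrc G c = x} \<le> card (src_fibre G K x)"
      using sub finite_src_fibre[OF K.K_compact, of x] by (intro card_mono) (auto simp: src_fibre_def)
    then show False using C8(2)[OF x] less by linarith
  qed
  show ?thesis
  proof (rule exI[of _ K.orb], intro conjI ballI)
    show "K.orb x \<subseteq> X" "x \<in> K.orb x" if "x \<in> X" for x using K.orb_subset K.orb_self[OF that] .
    show "K.orb y = K.orb x" if "y \<in> K.orb x" for x y by (rule K.orb_eq[OF that])
    fix x assume x: "x \<in> X"
    let ?n = "card (src_fibre G K x)"
    obtain Y f e where tw: "P.tower Y ?n f" and xY: "x \<in> Y"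
      and orbY: "\<forall>y\<in>Y. K.orb y = (\<lambda>j. f j y) ` {1..?n}"
      and e: "bij_betw e {1..?n} (src_fibre G K x)" "\<forall>j\<in>{1..?n}. f j x = grng G (e j)"
      by (rule K.local_tower[OF x])
    have sm: "8 * card (set_gmult G C (src_fibre G K x) - src_fibre G K x) \<le> ?n"
      using small[OF x] by linarith
    obtain A where A: "clopenin T A" "x \<in> A" "A \<subseteq> Y" "\<And>W. W \<subseteq> A \<Longrightarrow> P.mostly_permutes \<alpha> W ?n f"
      by (rule K.local_permutation[OF tw xY orbY e U(1,2) _ C \<alpha> U(3) sm]) (auto simp: C_def)
    obtain B where B: "clopenin T B" "x \<in> B" "B \<subseteq> Y" "\<And>W. W \<subseteq> B \<Longrightarrow> P.mostly_permutes \<beta> W ?n f"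
      by (rule K.local_permutation[OF tw xY orbY e V(1,2) _ C \<beta> V(3) sm]) (auto simp: C_def)
    show "\<exists>Y n f. P.tower Y n f \<and> x \<in> Y \<and> 8 \<le> n \<and> (\<forall>y\<in>Y. K.orb y = (\<lambda>j. f j y) ` {1..n}) \<and>
         P.mostly_permutes \<alpha> Y n f \<and> P.mostly_permutes \<beta> Y n f"
    proof (intro exI conjI)
      show "P.tower (A \<inter> B) ?n f"
        by (rule P.tower_subset[OF tw P.clopen_Int[OF A(1) B(1)]]) (use A in blast)
      show "x \<in> A \<inter> B" using A B by blast
      show "8 \<le> ?n" by (rule tall[OF x])
      show "\<forall>y\<in>A \<inter> B. K.orb y = (\<lambda>j. f j y) ` {1..?n}" using orbY A(3) by blast
      show "P.mostly_permutes \<alpha> (A \<inter> B) ?n f" by (rule A(4)) blast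
      show "P.mostly_permutes \<beta> (A \<inter> B) ?n f" by (rule B(4)) blast
    qed
  qed
qed

sublocale P: almost_finite_pseudogroup T "bisection_map_on G"
proof
  fix \<alpha> \<beta> assume "\<alpha> \<in> P.full_carrier" "\<beta> \<in> P.full_carrier"
  then show "\<exists>R. (\<forall>x\<in>topspace T. R x \<subseteq> topspace T \<and> x \<in> R x \<and> (\<forall>y\<in>R x. R y = R x)) \<and>
      (\<forall>x\<in>topspace T. \<exists>Y n f. P.tower Y n f \<and> x \<in> Y \<and> 8 \<le> n \<and>
         (\<forall>y\<in>Y. R y = (\<lambda>j. f j y) ` {1..n}) \<and>
         P.mostly_permutes \<alpha> Y n f \<and> P.mostly_permutes \<beta> Y n f)"
    unfolding topspace_unit_space by (rule almost_finite_tower_partition)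
qed

end

theorem theorem4p7:
  fixes G :: "'a top_groupoid"
  assumes "etale_groupoid G"
    and "essentially_principal G"
    and "cantor_set (unit_space G)"
    and "almost_finite G"
    and "minimal_groupoid G"
  shows "(\<forall>N. subgroup N (topological_full_group G) \<and>
              N \<noteq> {\<one>\<^bsub>topological_full_group G\<^esub>} \<and>
              commutator_subgroup (topological_full_group G)
                \<subseteq> normalizer (topological_full_group G) N \<longrightarrow>
              commutator_subgroup (topological_full_group G) \<subseteq> N) \<and>
         is_simple ((topological_full_group G)
           \<lparr>carrier := commutator_subgroup (topological_full_group G)\<rparr>)"
proof -
  have "cantor_groupoid G"
    using assms(1,3) by (simp add: cantor_groupoid_def cantor_groupoid_axioms_def)
  then interpret almost_finite_cantor_groupoid G
    using assms(4,5)
    by (simp add: almost_finite_cantor_groupoid_def minimal_cantor_groupoid_def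
        almost_finite_cantor_groupoid_axioms_def minimal_cantor_groupoid_axioms_def)
  have "topspace (unit_space G) \<noteq> {}" using assms(3) by (simp add: cantor_set_def)
  note simple = P.simple_commutator_subgroup[OF this]
  show ?thesis
    unfolding topological_full_group_eq
  proof (intro conjI allI impI)
    fix N assume "subgroup N P.full_group \<and> N \<noteq> {\<one>\<^bsub>P.full_group\<^esub>} \<and>
      commutator_subgroup P.full_group \<subseteq> normalizer P.full_group N"
    then show "commutator_subgroup P.full_group \<subseteq> N"
      by (elim conjE) (rule P.derived_le_normalized)
  qed (rule simple)
qed

end
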